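(* Maximal exclusive double groupoids equipped with a section are in one to one correspondence with fibered semi-direct products of an abelian group bundle with a matched pair of groupoids. In precise form: let $\mathbf{MaxExcl}$, $\mathbf{2\text{-}semi}$ and the functor $\Gamma:\mathbf{2\text{-}semi}\to\mathbf{MaxExcl}$ be as described in the context. Then there exist a functor $\Lambda:\mathbf{MaxExcl}\to\mathbf{2\text{-}semi}$ and an isomorphism $\phi:\mathbf{MaxExcl}(\tau,\Gamma(G))\to\mathbf{2\text{-}semi}(\Lambda(\tau),G)$ such that $(\Lambda,\Gamma,\phi)$ is an adjunction; and, restricted to the full subcategory of $\mathbf{2\text{-}semi}$ whose objects $(G,H,K,A)$ satisfy $G=AKH$, this adjunction is an equivalence of categories.
   Context: Composition in groupoids is written in diagrammatic order: $fg$ means first $f$, then $g$. A groupoid is discrete if all its morphisms are identities. A (strict) double category has objects, horizontal arrows, vertical arrows and squares. Objects with horizontal arrows form a category, as do objects with vertical arrows. A square $X$ has a horizontal source and a horizontal target (left and right sides), which are vertical arrows, and a vertical source and a vertical target (top and bottom sides), which are horizontal arrows, with matching corners. Squares compose associatively and unitally, horizontally ($\circ_h$) and vertically ($\circ_v$), and the interchange law holds. A double groupoid is a double category in which every square has both a horizontal and a vertical inverse. Double functors are maps preserving all this structure. For a double groupoid $\tau$, the core groupoid consists of the squares whose two targets (right and bottom sides) are identities, and the core bundle consists of the squares all of whose sides are identities. $\tau$ is exclusive if its core groupoid and core bundle are identical. $\tau$ is maximal if any pair consisting of a vertical and a horizontal arrow (with common target object) is the target pair of a square. The frame $\blacksquare\tau$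 is obtained from $\tau$ by identifying squares that have the same boundary, and $\Pi:\tau\to\blacksquare\tau$ is the projection. A section of $\tau$ over its frame is a map $!:\blacksquare\tau\to\tau$, the identity on objects and arrows, which is a right inverse of $\Pi$, i.e. it chooses a square of $\tau$ for each boundary that occurs. $\mathbf{MaxExcl}$ is the category whose objects are maximal exclusive double groupoids together with a section over their frame, and whose arrows are section-preserving double functors. $\mathbf{2\text{-}semi}$ is the category whose objects are quadruples $(G,H,K,A)$ where $G$ is a groupoid, $H$ and $K$ are subgroupoids of $G$ with $H\cap K$ discrete and $HK=KH$, and $A$ is an abelian subgroupoid of $G$ such that $hah^{-1}\in A$ and $kak^{-1}\in A$ (for $h\in H$, $k\in K$, $a\in A$, when defined) and $A\cap H=A\cap K$ is discrete. Its arrows are functors sending each of the subgroupoids into its counterpart. Quadruples with $G=AKH$ are the fibered semi-direct products of an abelian group bundle $A$ with a matched pair of groupoids $H,K$. $\Gamma(G,H,K,A)$ is the double groupoid with horizontal arrows $H$ and vertical arrows $K$, whose squares with top $h$, right side $k'$, left side $k$ and bottom $h'$ are the pairs $(hk'=kh',a)$, where $hk'=kh'$ holds in $G$ and $a\in A$. Compositions are $$(hk'=kh',a)\circ_h(h''k''=k'h''',b)=\bigl((hh'')k''=k(h'h'''),\ a\,hbh^{-1}\bigr),$$ $$(hk'=kh',a)\circ_v(h'k'''=k''h'',b)=\bigl(h(k'k''')=(kk'')h'',\ a\,kbk^{-1}\bigr),$$ and the canonical section is $(hk'=kh')\mapsto(hk'=kh',e)$ with $e$ an identity. On arrows, $\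Gamma(f)(hk'=kh',a)=(f(h)f(k')=f(k)f(h'),f(a))$.
   Formalization: Sections are required to be double functors, not arbitrary choices of squares, and the subcategory requires A∩KH discrete besides G=AKH; without either the equivalence fails (Z/2 squares with the non-identity chosen; Klein four-group with H, K, A its three order-2 subgroups). *)

theory Defs
  imports "HOL-Library.FuncSet"
begin

section \<open>Categories and groupoids\<close>

text \<open>
  All composition is in diagrammatic order: \<open>f \<cdot> g\<close> is first \<open>f\<close>, then \<open>g\<close>.
  The record fields are total functions; their values are only meaningful on the carriers
  (and, for composition, on composable pairs).  The same record serves for
  small categories and for the large categories \<open>MaxExcl\<close> and \<open>TwoSemi\<close> below.
\<close>

record ('o, 'a) cat =
  Obj :: "'o set"
  Arr :: "'a set"
  Dom :: "'a \<Rightarrow> 'o"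
  Cod :: "'a \<Rightarrow> 'o"
  Ide :: "'o \<Rightarrow> 'a"
  Cmp :: "'a \<Rightarrow> 'a \<Rightarrow> 'a" (infixl "\<cdot>\<index>" 70)

locale category =
  fixes C :: "('o, 'a) cat" (structure)
  assumes Dom_in: "f \<in> Arr C \<Longrightarrow> Dom C f \<in> Obj C"
    and Cod_in: "f \<in> Arr C \<Longrightarrow> Cod C f \<in> Obj C"
    and Ide_in: "x \<in> Obj C \<Longrightarrow> Ide C x \<in> Arr C"
    and Dom_Ide: "x \<in> Obj C \<Longrightarrow> Dom C (Ide C x) = x"
    and Cod_Ide: "x \<in> Obj C \<Longrightarrow> Cod C (Ide C x) = x"
    and Cmp_in: "\<lbrakk>f \<in> Arr C; g \<in> Arr C; Cod C f = Dom C g\<rbrakk> \<Longrightarrow> f \<cdot> g \<in> Arr C"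
    and Dom_Cmp: "\<lbrakk>f \<in> Arr C; g \<in> Arr C; Cod C f = Dom C g\<rbrakk> \<Longrightarrow> Dom C (f \<cdot> g) = Dom C f"
    and Cod_Cmp: "\<lbrakk>f \<in> Arr C; g \<in> Arr C; Cod C f = Dom C g\<rbrakk> \<Longrightarrow> Cod C (f \<cdot> g) = Cod C g"
    and Ide_left: "f \<in> Arr C \<Longrightarrow> Ide C (Dom C f) \<cdot> f = f"
    and Ide_right: "f \<in> Arr C \<Longrightarrow> f \<cdot> Ide C (Cod C f) = f"
    and Cmp_assoc: "\<lbrakk>f \<in> Arr C; g \<in> Arr C; h \<in> Arr C; Cod C f = Dom C g; Cod C g = Dom C h\<rbrakk>
      \<Longrightarrow> (f \<cdot> g) \<cdot> h = f \<cdot> (g \<cdot> h)"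

definition hom :: "('o, 'a) cat \<Rightarrow> 'o \<Rightarrow> 'o \<Rightarrow> 'a set" where
  "hom C x y = {f \<in> Arr C. Dom C f = x \<and> Cod C f = y}"

definition is_inverse :: "('o, 'a) cat \<Rightarrow> 'a \<Rightarrow> 'a \<Rightarrow> bool" where
  "is_inverse C f g \<longleftrightarrow> f \<in> Arr C \<and> g \<in> Arr C \<and> Dom C g = Cod C f \<and> Cod C g = Dom C f \<and>
     f \<cdot>\<^bsub>C\<^esub> g = Ide C (Dom C f) \<and> g \<cdot>\<^bsub>C\<^esub> f = Ide C (Cod C f)"

definition isomorphism :: "('o, 'a) cat \<Rightarrow> 'a \<Rightarrow> bool" where
  "isomorphism C f \<longleftrightarrow> (\<exists>g. is_inverse C f g)"

definition inverse_arr :: "('o, 'a) cat \<Rightarrow> 'a \<Rightarrow> 'a" where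
  "inverse_arr C f = (THE g. is_inverse C f g)"

locale groupoid = category +
  assumes all_isomorphisms: "f \<in> Arr C \<Longrightarrow> isomorphism C f"

definition identities :: "('o, 'a) cat \<Rightarrow> 'a set" where
  "identities C = Ide C ` Obj C"

definition is_functor :: "('o, 'a) cat \<Rightarrow> ('p, 'b) cat \<Rightarrow> ('o \<Rightarrow> 'p) \<Rightarrow> ('a \<Rightarrow> 'b) \<Rightarrow> bool" where
  "is_functor C D Fo Fa \<longleftrightarrow>
     Fo \<in> Obj C \<rightarrow> Obj D \<and> Fa \<in> Arr C \<rightarrow> Arr D \<and>
     (\<forall>f\<in>Arr C. Dom D (Fa f) = Fo (Dom C f) \<and> Cod D (Fa f) = Fo (Cod C f)) \<and>
     (\<forall>x\<in>Obj C. Fa (Ide C x) = Ide D (Fo x)) \<and>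
     (\<forall>f\<in>Arr C. \<forall>g\<in>Arr C. Cod C f = Dom C g \<longrightarrow> Fa (f \<cdot>\<^bsub>C\<^esub> g) = Fa f \<cdot>\<^bsub>D\<^esub> Fa g)"

definition full_subcategory :: "('o, 'a) cat \<Rightarrow> ('o \<Rightarrow> bool) \<Rightarrow> ('o, 'a) cat" where
  "full_subcategory C P =
     C\<lparr>Obj := {x \<in> Obj C. P x}, Arr := {f \<in> Arr C. P (Dom C f) \<and> P (Cod C f)}\<rparr>"


section \<open>Adjunctions and equivalences\<close>

text \<open>\<open>L : C \<rightarrow> D\<close> is left adjoint to \<open>R : D \<rightarrow> C\<close> via the natural bijections
  \<open>\<phi> X Y : C(X, R Y) \<rightarrow> D(L X, Y)\<close>.\<close>

definition adjunction ::
  "('o, 'a) cat \<Rightarrow> ('p, 'b) cat \<Rightarrow> ('o \<Rightarrow> 'p) \<Rightarrow> ('a \<Rightarrow> 'b) \<Rightarrow> ('p \<Rightarrow> 'o) \<Rightarrow> ('b \<Rightarrow> 'a) \<Rightarrow>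
   ('o \<Rightarrow> 'p \<Rightarrow> 'a \<Rightarrow> 'b) \<Rightarrow> bool" where
  "adjunction C D Lo La Ro Ra \<phi> \<longleftrightarrow>
     category C \<and> category D \<and> is_functor C D Lo La \<and> is_functor D C Ro Ra \<and>
     (\<forall>X\<in>Obj C. \<forall>Y\<in>Obj D. bij_betw (\<phi> X Y) (hom C X (Ro Y)) (hom D (Lo X) Y)) \<and>
     (\<forall>X\<in>Obj C. \<forall>X'\<in>Obj C. \<forall>Y\<in>Obj D. \<forall>u\<in>hom C X' X. \<forall>f\<in>hom C X (Ro Y).
        \<phi> X' Y (u \<cdot>\<^bsub>C\<^esub> f) = La u \<cdot>\<^bsub>D\<^esub> \<phi> X Y f) \<and>
     (\<forall>X\<in>Obj C. \<forall>Y\<in>Obj D. \<forall>Y'\<in>Obj D. \<forall>w\<in>hom D Y Y'. \<forall>f\<in>hom C X (Ro Y).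
        \<phi> X Y' (f \<cdot>\<^bsub>C\<^esub> Ra w) = \<phi> X Y f \<cdot>\<^bsub>D\<^esub> w)"

definition adj_unit ::
  "('o, 'a) cat \<Rightarrow> ('p, 'b) cat \<Rightarrow> ('o \<Rightarrow> 'p) \<Rightarrow> ('p \<Rightarrow> 'o) \<Rightarrow>
   ('o \<Rightarrow> 'p \<Rightarrow> 'a \<Rightarrow> 'b) \<Rightarrow> 'o \<Rightarrow> 'a" where
  "adj_unit C D Lo Ro \<phi> X = inv_into (hom C X (Ro (Lo X))) (\<phi> X (Lo X)) (Ide D (Lo X))"

definition adj_counit ::
  "('o, 'a) cat \<Rightarrow> ('p \<Rightarrow> 'o) \<Rightarrow> ('o \<Rightarrow> 'p \<Rightarrow> 'a \<Rightarrow> 'b) \<Rightarrow> 'p \<Rightarrow> 'b" where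
  "adj_counit C Ro \<phi> Y = \<phi> (Ro Y) Y (Ide C (Ro Y))"

definition adjoint_equivalence ::
  "('o, 'a) cat \<Rightarrow> ('p, 'b) cat \<Rightarrow> ('o \<Rightarrow> 'p) \<Rightarrow> ('a \<Rightarrow> 'b) \<Rightarrow> ('p \<Rightarrow> 'o) \<Rightarrow> ('b \<Rightarrow> 'a) \<Rightarrow>
   ('o \<Rightarrow> 'p \<Rightarrow> 'a \<Rightarrow> 'b) \<Rightarrow> bool" where
  "adjoint_equivalence C D Lo La Ro Ra \<phi> \<longleftrightarrow>
     adjunction C D Lo La Ro Ra \<phi> \<and>
     (\<forall>X\<in>Obj C. isomorphism C (adj_unit C D Lo Ro \<phi> X)) \<and>
     (\<forall>Y\<in>Obj D. isomorphism D (adj_counit C Ro \<phi> Y))"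


section \<open>Double categories and double groupoids\<close>

text \<open>
  A double category consists of four categories.  \<open>HSq\<close> has the vertical arrows as objects and
  the squares as arrows, with horizontal composition; \<open>VSq\<close> has the horizontal arrows as objects
  and the squares as arrows, with vertical composition.
\<close>

record ('o, 'h, 'v, 's) dcat =
  Hor :: "('o, 'h) cat"
  Ver :: "('o, 'v) cat"
  HSq :: "('v, 's) cat"
  VSq :: "('h, 's) cat"

abbreviation Sqr :: "('o, 'h, 'v, 's) dcat \<Rightarrow> 's set" where
  "Sqr T \<equiv> Arr (HSq T)"
abbreviation sLeft :: "('o, 'h, 'v, 's) dcat \<Rightarrow> 's \<Rightarrow> 'v" where
  "sLeft T \<equiv> Dom (HSq T)"
abbreviation sRight :: "('o, 'h, 'v, 's) dcat \<Rightarrow> 's \<Rightarrow> 'v" where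
  "sRight T \<equiv> Cod (HSq T)"
abbreviation sTop :: "('o, 'h, 'v, 's) dcat \<Rightarrow> 's \<Rightarrow> 'h" where
  "sTop T \<equiv> Dom (VSq T)"
abbreviation sBot :: "('o, 'h, 'v, 's) dcat \<Rightarrow> 's \<Rightarrow> 'h" where
  "sBot T \<equiv> Cod (VSq T)"

locale double_category =
  fixes T :: "('o, 'h, 'v, 's) dcat"
  assumes cat_Hor: "category (Hor T)" and cat_Ver: "category (Ver T)"
    and cat_HSq: "category (HSq T)" and cat_VSq: "category (VSq T)"
    and Obj_Ver: "Obj (Ver T) = Obj (Hor T)"
    and Obj_HSq: "Obj (HSq T) = Arr (Ver T)"
    and Obj_VSq: "Obj (VSq T) = Arr (Hor T)"
    and Arr_VSq: "Arr (VSq T) = Sqr T"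
    and corners: "X \<in> Sqr T \<Longrightarrow>
      Dom (Hor T) (sTop T X) = Dom (Ver T) (sLeft T X) \<and>
      Cod (Hor T) (sTop T X) = Dom (Ver T) (sRight T X) \<and>
      Dom (Hor T) (sBot T X) = Cod (Ver T) (sLeft T X) \<and>
      Cod (Hor T) (sBot T X) = Cod (Ver T) (sRight T X)"
    and hcomp_boundary: "\<lbrakk>X \<in> Sqr T; Y \<in> Sqr T; sRight T X = sLeft T Y\<rbrakk> \<Longrightarrow>
      sTop T (X \<cdot>\<^bsub>HSq T\<^esub> Y) = sTop T X \<cdot>\<^bsub>Hor T\<^esub> sTop T Y \<and>
      sBot T (X \<cdot>\<^bsub>HSq T\<^esub> Y) = sBot T X \<cdot>\<^bsub>Hor T\<^esub> sBot T Y"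
    and vcomp_boundary: "\<lbrakk>X \<in> Sqr T; Y \<in> Sqr T; sBot T X = sTop T Y\<rbrakk> \<Longrightarrow>
      sLeft T (X \<cdot>\<^bsub>VSq T\<^esub> Y) = sLeft T X \<cdot>\<^bsub>Ver T\<^esub> sLeft T Y \<and>
      sRight T (X \<cdot>\<^bsub>VSq T\<^esub> Y) = sRight T X \<cdot>\<^bsub>Ver T\<^esub> sRight T Y"
    and hid_boundary: "v \<in> Arr (Ver T) \<Longrightarrow>
      sTop T (Ide (HSq T) v) = Ide (Hor T) (Dom (Ver T) v) \<and>
      sBot T (Ide (HSq T) v) = Ide (Hor T) (Cod (Ver T) v)"
    and vid_boundary: "h \<in> Arr (Hor T) \<Longrightarrow>
      sLeft T (Ide (VSq T) h) = Ide (Ver T) (Dom (Hor T) h) \<and>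
      sRight T (Ide (VSq T) h) = Ide (Ver T) (Cod (Hor T) h)"
    and hid_vcomp: "\<lbrakk>v \<in> Arr (Ver T); w \<in> Arr (Ver T); Cod (Ver T) v = Dom (Ver T) w\<rbrakk> \<Longrightarrow>
      Ide (HSq T) (v \<cdot>\<^bsub>Ver T\<^esub> w) = Ide (HSq T) v \<cdot>\<^bsub>VSq T\<^esub> Ide (HSq T) w"
    and vid_hcomp: "\<lbrakk>h \<in> Arr (Hor T); g \<in> Arr (Hor T); Cod (Hor T) h = Dom (Hor T) g\<rbrakk> \<Longrightarrow>
      Ide (VSq T) (h \<cdot>\<^bsub>Hor T\<^esub> g) = Ide (VSq T) h \<cdot>\<^bsub>HSq T\<^esub> Ide (VSq T) g"
    and hid_vid: "x \<in> Obj (Hor T) \<Longrightarrow>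
      Ide (HSq T) (Ide (Ver T) x) = Ide (VSq T) (Ide (Hor T) x)"
    and interchange: "\<lbrakk>X \<in> Sqr T; Y \<in> Sqr T; Z \<in> Sqr T; W \<in> Sqr T;
      sRight T X = sLeft T Y; sRight T Z = sLeft T W;
      sBot T X = sTop T Z; sBot T Y = sTop T W\<rbrakk> \<Longrightarrow>
      (X \<cdot>\<^bsub>HSq T\<^esub> Y) \<cdot>\<^bsub>VSq T\<^esub> (Z \<cdot>\<^bsub>HSq T\<^esub> W) = (X \<cdot>\<^bsub>VSq T\<^esub> Z) \<cdot>\<^bsub>HSq T\<^esub> (Y \<cdot>\<^bsub>VSq T\<^esub> W)"

locale double_groupoid = double_category +
  assumes h_invertible: "X \<in> Sqr T \<Longrightarrow> isomorphism (HSq T) X"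
    and v_invertible: "X \<in> Sqr T \<Longrightarrow> isomorphism (VSq T) X"

definition double_functor ::
  "('o, 'h, 'v, 's) dcat \<Rightarrow> ('p, 'i, 'w, 't) dcat \<Rightarrow>
   ('o \<Rightarrow> 'p) \<Rightarrow> ('h \<Rightarrow> 'i) \<Rightarrow> ('v \<Rightarrow> 'w) \<Rightarrow> ('s \<Rightarrow> 't) \<Rightarrow> bool" where
  "double_functor T T' Fo Fh Fv Fs \<longleftrightarrow>
     is_functor (Hor T) (Hor T') Fo Fh \<and> is_functor (Ver T) (Ver T') Fo Fv \<and>
     is_functor (HSq T) (HSq T') Fv Fs \<and> is_functor (VSq T) (VSq T') Fh Fs"

definition core_groupoid :: "('o, 'h, 'v, 's) dcat \<Rightarrow> 's set" where
  "core_groupoid T = {X \<in> Sqr T. sRight T X \<in> identities (Ver T) \<and> sBot T X \<in> identities (Hor T)}"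

definition core_bundle :: "('o, 'h, 'v, 's) dcat \<Rightarrow> 's set" where
  "core_bundle T = {X \<in> Sqr T.
     sLeft T X \<in> identities (Ver T) \<and> sRight T X \<in> identities (Ver T) \<and>
     sTop T X \<in> identities (Hor T) \<and> sBot T X \<in> identities (Hor T)}"

definition exclusive :: "('o, 'h, 'v, 's) dcat \<Rightarrow> bool" where
  "exclusive T \<longleftrightarrow> core_groupoid T = core_bundle T"

definition maximal :: "('o, 'h, 'v, 's) dcat \<Rightarrow> bool" where
  "maximal T \<longleftrightarrow> (\<forall>v\<in>Arr (Ver T). \<forall>h\<in>Arr (Hor T). Cod (Ver T) v = Cod (Hor T) h \<longrightarrow>
     (\<exists>X\<in>Sqr T. sRight T X = v \<and> sBot T X = h))"


section \<open>The frame and its sections\<close>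

text \<open>\<open>proj_frame T X\<close> is the class of all squares with the same boundary as \<open>X\<close>;
  it is the projection \<open>\<Pi>\<close> from \<open>T\<close> onto its frame.\<close>

definition proj_frame :: "('o, 'h, 'v, 's) dcat \<Rightarrow> 's \<Rightarrow> 's set" where
  "proj_frame T X = {Y \<in> Sqr T. sTop T Y = sTop T X \<and> sRight T Y = sRight T X \<and>
     sLeft T Y = sLeft T X \<and> sBot T Y = sBot T X}"

text \<open>The operations of the quotient are defined on representatives; the union in a
  composition is the union of copies of one and the same class.\<close>

definition frame :: "('o, 'h, 'v, 's) dcat \<Rightarrow> ('o, 'h, 'v, 's set) dcat" where
  "frame T = \<lparr>Hor = Hor T, Ver = Ver T,
     HSq = \<lparr>Obj = Obj (HSq T), Arr = proj_frame T ` Sqr T,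
       Dom = (\<lambda>P. the_elem (sLeft T ` P)), Cod = (\<lambda>P. the_elem (sRight T ` P)),
       Ide = (\<lambda>v. proj_frame T (Ide (HSq T) v)),
       Cmp = (\<lambda>P Q. \<Union>X\<in>P. \<Union>Y\<in>Q. proj_frame T (X \<cdot>\<^bsub>HSq T\<^esub> Y))\<rparr>,
     VSq = \<lparr>Obj = Obj (VSq T), Arr = proj_frame T ` Sqr T,
       Dom = (\<lambda>P. the_elem (sTop T ` P)), Cod = (\<lambda>P. the_elem (sBot T ` P)),
       Ide = (\<lambda>h. proj_frame T (Ide (VSq T) h)),
       Cmp = (\<lambda>P Q. \<Union>X\<in>P. \<Union>Y\<in>Q. proj_frame T (X \<cdot>\<^bsub>VSq T\<^esub> Y))\<rparr>\<rparr>"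

text \<open>The map induced on frames by the square component \<open>Fs\<close> of a double functor into \<open>T'\<close>.\<close>

definition frame_map :: "('p, 'i, 'w, 't) dcat \<Rightarrow> ('s \<Rightarrow> 't) \<Rightarrow> 's set \<Rightarrow> 't set" where
  "frame_map T' Fs P = (\<Union>X\<in>P. proj_frame T' (Fs X))"

text \<open>A section is a morphism of double groupoids, i.e. a double functor.  A mere choice of
  squares would not do: the canonical section of \<open>\<Gamma>(G,H,K,A)\<close> is a double functor and this property
  is invariant under section-preserving isomorphism.\<close>

definition is_section :: "('o, 'h, 'v, 's) dcat \<Rightarrow> ('s set \<Rightarrow> 's) \<Rightarrow> bool" where
  "is_section T s \<longleftrightarrow>
     double_functor (frame T) T (\<lambda>x. x) (\<lambda>h. h) (\<lambda>v. v) s \<and>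
     (\<forall>P\<in>Sqr (frame T). proj_frame T (s P) = P)"


section \<open>The category of maximal exclusive double groupoids with section\<close>

text \<open>
  Size convention: objects are taken from a type \<open>'o\<close>, arrows and squares from a type \<open>'u\<close>.
  An arrow of each of the two large categories below is a triple (domain, data, codomain), where
  the data are functions that are \<open>undefined\<close> outside the carriers of the domain, so that
  equality of arrows is equality on these carriers.
\<close>

type_synonym ('o, 'u) max_excl = "('o, 'u, 'u, 'u) dcat \<times> ('u set \<Rightarrow> 'u)"
type_synonym ('o, 'u) dmap = "('o \<Rightarrow> 'o) \<times> ('u \<Rightarrow> 'u) \<times> ('u \<Rightarrow> 'u) \<times> ('u \<Rightarrow> 'u)"
type_synonym ('o, 'u) max_excl_arr = "('o, 'u) max_excl \<times> ('o, 'u) dmap \<times> ('o, 'u) max_excl"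

fun is_max_excl :: "('o, 'u) max_excl \<Rightarrow> bool" where
  "is_max_excl (T, s) \<longleftrightarrow> double_groupoid T \<and> maximal T \<and> exclusive T \<and> is_section T s"

fun is_max_excl_map :: "('o, 'u) max_excl \<Rightarrow> ('o, 'u) dmap \<Rightarrow> ('o, 'u) max_excl \<Rightarrow> bool" where
  "is_max_excl_map (T, s) (Fo, Fh, Fv, Fs) (T', s') \<longleftrightarrow>
     double_functor T T' Fo Fh Fv Fs \<and>
     (\<forall>P\<in>Sqr (frame T). Fs (s P) = s' (frame_map T' Fs P)) \<and>
     Fo \<in> extensional (Obj (Hor T)) \<and> Fh \<in> extensional (Arr (Hor T)) \<and>
     Fv \<in> extensional (Arr (Ver T)) \<and> Fs \<in> extensional (Sqr T)"

fun max_excl_id :: "('o, 'u) max_excl \<Rightarrow> ('o, 'u) dmap" where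
  "max_excl_id (T, s) =
     (\<lambda>x\<in>Obj (Hor T). x, \<lambda>h\<in>Arr (Hor T). h, \<lambda>v\<in>Arr (Ver T). v, \<lambda>X\<in>Sqr T. X)"

fun max_excl_comp :: "('o, 'u) max_excl_arr \<Rightarrow> ('o, 'u) max_excl_arr \<Rightarrow> ('o, 'u) max_excl_arr" where
  "max_excl_comp ((T, s), (Fo, Fh, Fv, Fs), \<tau>') (\<tau>'', (Eo, Eh, Ev, Es), \<tau>''') =
     ((T, s),
      (compose (Obj (Hor T)) Eo Fo, compose (Arr (Hor T)) Eh Fh,
       compose (Arr (Ver T)) Ev Fv, compose (Sqr T) Es Fs),
      \<tau>''')"

definition MaxExcl :: "(('o, 'u) max_excl, ('o, 'u) max_excl_arr) cat" where
  "MaxExcl = \<lparr>Obj = {\<tau>. is_max_excl \<tau>},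
     Arr = {(\<tau>, F, \<tau>'). is_max_excl \<tau> \<and> is_max_excl \<tau>' \<and> is_max_excl_map \<tau> F \<tau>'},
     Dom = (\<lambda>(\<tau>, F, \<tau>'). \<tau>), Cod = (\<lambda>(\<tau>, F, \<tau>'). \<tau>'),
     Ide = (\<lambda>\<tau>. (\<tau>, max_excl_id \<tau>, \<tau>)), Cmp = max_excl_comp\<rparr>"


section \<open>The category of quadruples\<close>

text \<open>Subgroupoids are wide, i.e. contain all identities: \<open>H\<close> and \<open>K\<close> are the arrows of a
  double groupoid over the objects of \<open>G\<close>.\<close>

definition subgroupoid :: "'u set \<Rightarrow> ('o, 'u) cat \<Rightarrow> bool" where
  "subgroupoid H G \<longleftrightarrow> H \<subseteq> Arr G \<and> identities G \<subseteq> H \<and>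
     (\<forall>f\<in>H. \<forall>g\<in>H. Cod G f = Dom G g \<longrightarrow> f \<cdot>\<^bsub>G\<^esub> g \<in> H) \<and>
     (\<forall>f\<in>H. inverse_arr G f \<in> H)"

definition discrete :: "('o, 'u) cat \<Rightarrow> 'u set \<Rightarrow> bool" where
  "discrete G S \<longleftrightarrow> S \<subseteq> identities G"

definition set_cmp :: "('o, 'u) cat \<Rightarrow> 'u set \<Rightarrow> 'u set \<Rightarrow> 'u set" where
  "set_cmp G S S' = {f \<cdot>\<^bsub>G\<^esub> g |f g. f \<in> S \<and> g \<in> S' \<and> Cod G f = Dom G g}"

definition conj_arr :: "('o, 'u) cat \<Rightarrow> 'u \<Rightarrow> 'u \<Rightarrow> 'u" where
  "conj_arr G h a = h \<cdot>\<^bsub>G\<^esub> a \<cdot>\<^bsub>G\<^esub> inverse_arr G h"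

text \<open>An abelian groupoid is a bundle of abelian groups: \<open>a b = b a\<close> whenever \<open>a b\<close> is defined
  forces (taking \<open>b\<close> an identity) every arrow to be an endomorphism.\<close>

definition abelian_subgroupoid :: "'u set \<Rightarrow> ('o, 'u) cat \<Rightarrow> bool" where
  "abelian_subgroupoid A G \<longleftrightarrow> subgroupoid A G \<and> (\<forall>a\<in>A. Dom G a = Cod G a) \<and>
     (\<forall>a\<in>A. \<forall>b\<in>A. Cod G a = Dom G b \<longrightarrow> a \<cdot>\<^bsub>G\<^esub> b = b \<cdot>\<^bsub>G\<^esub> a)"

type_synonym ('o, 'u) quad = "('o, 'u) cat \<times> 'u set \<times> 'u set \<times> 'u set"
type_synonym ('o, 'u) quad_map = "('o \<Rightarrow> 'o) \<times> ('u \<Rightarrow> 'u)"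
type_synonym ('o, 'u) quad_arr = "('o, 'u) quad \<times> ('o, 'u) quad_map \<times> ('o, 'u) quad"

fun is_quad :: "('o, 'u) quad \<Rightarrow> bool" where
  "is_quad (G, H, K, A) \<longleftrightarrow>
     groupoid G \<and> subgroupoid H G \<and> subgroupoid K G \<and> discrete G (H \<inter> K) \<and>
     set_cmp G H K = set_cmp G K H \<and> abelian_subgroupoid A G \<and>
     (\<forall>h\<in>H. \<forall>a\<in>A. Cod G h = Dom G a \<longrightarrow> conj_arr G h a \<in> A) \<and>
     (\<forall>k\<in>K. \<forall>a\<in>A. Cod G k = Dom G a \<longrightarrow> conj_arr G k a \<in> A) \<and>
     A \<inter> H = A \<inter> K \<and> discrete G (A \<inter> H)"

fun is_quad_map :: "('o, 'u) quad \<Rightarrow> ('o, 'u) quad_map \<Rightarrow> ('o, 'u) quad \<Rightarrow> bool" where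
  "is_quad_map (G, H, K, A) (fo, fa) (G', H', K', A') \<longleftrightarrow>
     is_functor G G' fo fa \<and> fa ` H \<subseteq> H' \<and> fa ` K \<subseteq> K' \<and> fa ` A \<subseteq> A' \<and>
     fo \<in> extensional (Obj G) \<and> fa \<in> extensional (Arr G)"

fun quad_id :: "('o, 'u) quad \<Rightarrow> ('o, 'u) quad_map" where
  "quad_id (G, H, K, A) = (\<lambda>x\<in>Obj G. x, \<lambda>f\<in>Arr G. f)"

fun quad_comp :: "('o, 'u) quad_arr \<Rightarrow> ('o, 'u) quad_arr \<Rightarrow> ('o, 'u) quad_arr" where
  "quad_comp ((G, H, K, A), (fo, fa), Y) (Y', (eo, ea), Z) =
     ((G, H, K, A), (compose (Obj G) eo fo, compose (Arr G) ea fa), Z)"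

definition TwoSemi :: "(('o, 'u) quad, ('o, 'u) quad_arr) cat" where
  "TwoSemi = \<lparr>Obj = {X. is_quad X},
     Arr = {(X, f, Y). is_quad X \<and> is_quad Y \<and> is_quad_map X f Y},
     Dom = (\<lambda>(X, f, Y). X), Cod = (\<lambda>(X, f, Y). Y),
     Ide = (\<lambda>X. (X, quad_id X, X)), Cmp = quad_comp\<rparr>"

text \<open>
  \<open>G = AKH\<close> as a semi-direct product of \<open>A\<close> with \<open>KH\<close>.  The clause on \<open>A \<inter> KH\<close> does not follow
  from \<open>is_quad\<close>: in the Klein four-group let \<open>H\<close>, \<open>K\<close>, \<open>A\<close> be the three subgroups of order two;
  then \<open>G = AKH\<close> but the product is not semi-direct, and \<open>\<Gamma>\<close> sends this quadruple and the
  one given by the three coordinate subgroups of the elementary abelian group of order eight to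
  isomorphic objects.
\<close>

fun fibered_semidirect :: "('o, 'u) quad \<Rightarrow> bool" where
  "fibered_semidirect (G, H, K, A) \<longleftrightarrow>
     Arr G = set_cmp G (set_cmp G A K) H \<and> discrete G (A \<inter> set_cmp G K H)"


section \<open>The functor \<open>\<Gamma>\<close>\<close>

text \<open>
  A square of \<open>\<Gamma>(G,H,K,A)\<close> is a quintuple: the pair \<open>(hk' = kh', a)\<close> is
  \<open>(h, k', k, h', a)\<close>, that is (top, right, left, bottom, element of the bundle).  To have squares
  in the same type \<open>'u\<close> as arrows, quintuples are coded by an injection
  \<open>pr :: 'u \<times> 'u \<Rightarrow> 'u\<close>, which exists for every infinite \<open>'u\<close>.  For the formula
  \<open>a (h b h\<^sup>-\<^sup>1)\<close> to make sense, \<open>a\<close> lies over the top left corner.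
\<close>

fun sq5 :: "('u \<times> 'u \<Rightarrow> 'u) \<Rightarrow> 'u \<times> 'u \<times> 'u \<times> 'u \<times> 'u \<Rightarrow> 'u" where
  "sq5 pr (h, k', k, h', a) = pr (h, pr (k', pr (k, pr (h', a))))"

definition unsq5 :: "('u \<times> 'u \<Rightarrow> 'u) \<Rightarrow> 'u \<Rightarrow> 'u \<times> 'u \<times> 'u \<times> 'u \<times> 'u" where
  "unsq5 pr = inv (sq5 pr)"

fun Gamma_squares :: "('u \<times> 'u \<Rightarrow> 'u) \<Rightarrow> ('o, 'u) quad \<Rightarrow> 'u set" where
  "Gamma_squares pr (G, H, K, A) =
     {sq5 pr (h, k', k, h', a) |h k' k h' a.
        h \<in> H \<and> k' \<in> K \<and> k \<in> K \<and> h' \<in> H \<and> a \<in> A \<and>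
        Cod G h = Dom G k' \<and> Cod G k = Dom G h' \<and> h \<cdot>\<^bsub>G\<^esub> k' = k \<cdot>\<^bsub>G\<^esub> h' \<and> Dom G a = Dom G h}"

fun Gamma_dcat :: "('u \<times> 'u \<Rightarrow> 'u) \<Rightarrow> ('o, 'u) quad \<Rightarrow> ('o, 'u, 'u, 'u) dcat" where
  "Gamma_dcat pr (G, H, K, A) =
     \<lparr>Hor = G\<lparr>Arr := H\<rparr>, Ver = G\<lparr>Arr := K\<rparr>,
      HSq = \<lparr>Obj = K, Arr = Gamma_squares pr (G, H, K, A),
        Dom = (\<lambda>X. case unsq5 pr X of (h, k', k, h', a) \<Rightarrow> k),
        Cod = (\<lambda>X. case unsq5 pr X of (h, k', k, h', a) \<Rightarrow> k'),
        Ide = (\<lambda>k. sq5 pr (Ide G (Dom G k), k, k, Ide G (Cod G k), Ide G (Dom G k))),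
        Cmp = (\<lambda>X Y. case unsq5 pr X of (h, k', k, h', a) \<Rightarrow>
                     case unsq5 pr Y of (h'', k'', _, h''', b) \<Rightarrow>
                     sq5 pr (h \<cdot>\<^bsub>G\<^esub> h'', k'', k, h' \<cdot>\<^bsub>G\<^esub> h''', a \<cdot>\<^bsub>G\<^esub> conj_arr G h b))\<rparr>,
      VSq = \<lparr>Obj = H, Arr = Gamma_squares pr (G, H, K, A),
        Dom = (\<lambda>X. case unsq5 pr X of (h, k', k, h', a) \<Rightarrow> h),
        Cod = (\<lambda>X. case unsq5 pr X of (h, k', k, h', a) \<Rightarrow> h'),
        Ide = (\<lambda>h. sq5 pr (h, Ide G (Cod G h), Ide G (Dom G h), h, Ide G (Dom G h))),
        Cmp = (\<lambda>X Y. case unsq5 pr X of (h, k', k, h', a) \<Rightarrow>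
                     case unsq5 pr Y of (_, k''', k'', h'', b) \<Rightarrow>
                     sq5 pr (h, k' \<cdot>\<^bsub>G\<^esub> k''', k \<cdot>\<^bsub>G\<^esub> k'', h'', a \<cdot>\<^bsub>G\<^esub> conj_arr G k b))\<rparr>\<rparr>"

fun Gamma_section :: "('u \<times> 'u \<Rightarrow> 'u) \<Rightarrow> ('o, 'u) quad \<Rightarrow> 'u set \<Rightarrow> 'u" where
  "Gamma_section pr (G, H, K, A) P =
     (let F = frame (Gamma_dcat pr (G, H, K, A)) in
      sq5 pr (sTop F P, sRight F P, sLeft F P, sBot F P, Ide G (Dom G (sTop F P))))"

definition Gamma_obj :: "('u \<times> 'u \<Rightarrow> 'u) \<Rightarrow> ('o, 'u) quad \<Rightarrow> ('o, 'u) max_excl" where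
  "Gamma_obj pr X = (Gamma_dcat pr X, Gamma_section pr X)"

fun Gamma_map :: "('u \<times> 'u \<Rightarrow> 'u) \<Rightarrow> ('o, 'u) quad \<Rightarrow> ('o, 'u) quad_map \<Rightarrow> ('o, 'u) dmap" where
  "Gamma_map pr (G, H, K, A) (fo, fa) =
     (restrict fo (Obj G), restrict fa H, restrict fa K,
      \<lambda>X\<in>Gamma_squares pr (G, H, K, A).
        case unsq5 pr X of (h, k', k, h', a) \<Rightarrow> sq5 pr (fa h, fa k', fa k, fa h', fa a))"

fun Gamma_arr :: "('u \<times> 'u \<Rightarrow> 'u) \<Rightarrow> ('o, 'u) quad_arr \<Rightarrow> ('o, 'u) max_excl_arr" where
  "Gamma_arr pr (X, f, Y) = (Gamma_obj pr X, Gamma_map pr X f, Gamma_obj pr Y)"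

end

theory Submission
  imports Defs
begin

text \<open>
  \<open>\<Lambda>(\<tau>)\<close> is the diagonal groupoid of \<open>\<tau>\<close>: its arrows are the squares of \<open>\<tau>\<close>, going from the top left
  to the bottom right corner, and \<open>X\<close>, \<open>Y\<close> are composed by placing them on the diagonal of a 2 by 2
  array whose two other entries are squares in the image of the section; maximality provides them and
  exclusivity makes them unique.  The subgroupoids \<open>H\<close>, \<open>K\<close> consist of the identity squares of
  horizontal and vertical arrows, and \<open>A\<close> is the core bundle, which is the kernel of the endofunctor
  sending a square to the section square with the same boundary; the image of this endofunctor is
  \<open>HK = KH\<close>.  Both compositions of \<open>\<tau>\<close> can be recovered from the diagonal one, e.g.
  \<open>X \<circ>\<^sub>h Y = X r\<^sup>-\<^sup>1 Y\<close> where \<open>r \<in> K\<close> is the common side, so that mapping \<open>X\<close> to its boundary together with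
  the element of \<open>A\<close> by which it differs from the section square is an isomorphism
  \<open>\<tau> \<cong> \<Gamma>(\<Lambda>(\<tau>))\<close>.  This is the unit.  The counit sends \<open>(hk' = kh', a)\<close> to \<open>ahk'\<close>.
\<close>

section \<open>Categories, groupoids and functors\<close>

text \<open>Everything rests on the section being a double functor: pastings of canonical squares,
  those in its image, are again canonical. As a canonical square is determined by two of its sides,
  the filler needed for a product can be recognised as a pasting of smaller fillers, and this gives
  associativity of the diagonal product. Inverses are found by splitting a square into a core bundle
  element times a canonical square. The latter is a product of two identity squares of arrows. The
  former is inverted inside the core bundle, where by an Eckmann-Hilton argument the diagonal,
  horizontal and vertical compositions agree and commute. The adjunction is assembled from unit,
  counit and triangle identities. The unit is invertible at every object and every
  \<open>\<Lambda>(\<tau>)\<close> satisfies the semi-direct condition, so the same bijections serve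
  for the full subcategory. There the counit is bijective: \<open>G = AKH\<close> makes it
  surjective, and discreteness of \<open>A \<inter> KH\<close>, together with that of
  \<open>H \<inter> K\<close>, makes it injective.\<close>

lemmas (in category) cat_simps =
  Dom_in Cod_in Ide_in Dom_Ide Cod_Ide Cmp_in Dom_Cmp Cod_Cmp Ide_left Ide_right

lemma (in category) Ide_left': "\<lbrakk>f \<in> Arr C; Dom C f = x\<rbrakk> \<Longrightarrow> Ide C x \<cdot> f = f"
  using Ide_left by blast

lemma (in category) Ide_right': "\<lbrakk>f \<in> Arr C; Cod C f = x\<rbrakk> \<Longrightarrow> f \<cdot> Ide C x = f"
  using Ide_right by blast

lemma (in category) is_inverse_unique:
  assumes "is_inverse C f g" "is_inverse C f g'"
  shows "g = g'"
proof -
  note i = assms[unfolded is_inverse_def]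
  have "g \<cdot> (f \<cdot> g') = g"
    using i Ide_right'[of g "Dom C f"] by simp
  moreover have "(g \<cdot> f) \<cdot> g' = g'"
    using i Ide_left'[of g' "Cod C f"] by simp
  ultimately show ?thesis
    using i Cmp_assoc[of g f g'] by simp
qed

lemma (in category) inverse_arr_eq: "is_inverse C f g \<Longrightarrow> inverse_arr C f = g"
  unfolding inverse_arr_def using is_inverse_unique by blast

lemma (in category) is_inverse_Ide: "x \<in> Obj C \<Longrightarrow> is_inverse C (Ide C x) (Ide C x)"
  by (simp add: is_inverse_def Ide_in Dom_Ide Cod_Ide Ide_left')

lemma is_inverse_sym: "is_inverse C f g \<Longrightarrow> is_inverse C g f"
  unfolding is_inverse_def by auto

lemma (in category) is_inverse_Cmp:
  assumes "is_inverse C f f'" "is_inverse C g g'" "Cod C f = Dom C g"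
  shows "is_inverse C (f \<cdot> g) (g' \<cdot> f')"
proof -
  note * = assms[unfolded is_inverse_def]
  have "g \<cdot> (g' \<cdot> f') = f'" "f' \<cdot> (f \<cdot> g) = g"
    using * Cmp_assoc[of g g' f'] Cmp_assoc[of f' f g] by (simp_all add: Ide_left')
  then show ?thesis
    using * by (simp add: is_inverse_def Cmp_in Dom_Cmp Cod_Cmp Cmp_assoc)
qed

section \<open>Calculus of inverses in a groupoid\<close>

lemma groupoidI:
  assumes "category C" and "\<And>f. f \<in> Arr C \<Longrightarrow> isomorphism C f"
  shows "groupoid C"
  using assms by (simp add: groupoid_axioms_def groupoid_def)

context groupoid
begin

lemma is_inverse_inverse_arr: "f \<in> Arr C \<Longrightarrow> is_inverse C f (inverse_arr C f)"
  using all_isomorphisms inverse_arr_eq isomorphism_def by metis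

lemma inv_in: "f \<in> Arr C \<Longrightarrow> inverse_arr C f \<in> Arr C"
  and Dom_inv: "f \<in> Arr C \<Longrightarrow> Dom C (inverse_arr C f) = Cod C f"
  and Cod_inv: "f \<in> Arr C \<Longrightarrow> Cod C (inverse_arr C f) = Dom C f"
  and inv_right: "f \<in> Arr C \<Longrightarrow> f \<cdot> inverse_arr C f = Ide C (Dom C f)"
  and inv_left: "f \<in> Arr C \<Longrightarrow> inverse_arr C f \<cdot> f = Ide C (Cod C f)"
  using is_inverse_inverse_arr unfolding is_inverse_def by auto

lemma inv_cancel_left:
  "\<lbrakk>f \<in> Arr C; g \<in> Arr C; Cod C f = Dom C g\<rbrakk> \<Longrightarrow> inverse_arr C f \<cdot> (f \<cdot> g) = g"
  by (metis Cmp_assoc Cod_inv Ide_left inv_in inv_left)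

lemma inv_cancel_left':
  "\<lbrakk>f \<in> Arr C; g \<in> Arr C; Dom C f = Dom C g\<rbrakk> \<Longrightarrow> f \<cdot> (inverse_arr C f \<cdot> g) = g"
  by (metis Cmp_assoc Cod_inv Dom_inv Ide_left inv_in inv_right)

lemma inv_inv: "f \<in> Arr C \<Longrightarrow> inverse_arr C (inverse_arr C f) = f"
  by (simp add: inverse_arr_eq is_inverse_inverse_arr is_inverse_sym)

lemma inv_Ide: "x \<in> Obj C \<Longrightarrow> inverse_arr C (Ide C x) = Ide C x"
  by (simp add: inverse_arr_eq is_inverse_Ide)

lemma inv_Cmp: "\<lbrakk>f \<in> Arr C; g \<in> Arr C; Cod C f = Dom C g\<rbrakk> \<Longrightarrow>
    inverse_arr C (f \<cdot> g) = inverse_arr C g \<cdot> inverse_arr C f"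
  by (simp add: inverse_arr_eq is_inverse_Cmp is_inverse_inverse_arr)

lemmas grp_simps = cat_simps Ide_left' Ide_right' Cmp_assoc inv_in Dom_inv Cod_inv inv_right inv_left
  inv_cancel_left inv_cancel_left' inv_inv inv_Ide inv_Cmp

lemma left_cancel:
  assumes "f \<cdot> g = f \<cdot> g'" "f \<in> Arr C" "g \<in> Arr C" "g' \<in> Arr C" "Cod C f = Dom C g" "Cod C f = Dom C g'"
  shows "g = g'"
  by (metis assms inv_cancel_left)

lemma right_cancel:
  assumes "f \<cdot> g = f' \<cdot> g" "f \<in> Arr C" "f' \<in> Arr C" "g \<in> Arr C" "Cod C f = Dom C g" "Cod C f' = Dom C g"
  shows "f = f'"
  by (metis assms Cmp_assoc Ide_right inv_right inv_in Dom_inv)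

end

section \<open>Functors, their composites and inverses\<close>

lemma is_functor_Obj: "is_functor C D Fo Fa \<Longrightarrow> x \<in> Obj C \<Longrightarrow> Fo x \<in> Obj D"
  and is_functor_Arr: "is_functor C D Fo Fa \<Longrightarrow> f \<in> Arr C \<Longrightarrow> Fa f \<in> Arr D"
  and is_functor_Dom: "is_functor C D Fo Fa \<Longrightarrow> f \<in> Arr C \<Longrightarrow> Dom D (Fa f) = Fo (Dom C f)"
  and is_functor_Cod: "is_functor C D Fo Fa \<Longrightarrow> f \<in> Arr C \<Longrightarrow> Cod D (Fa f) = Fo (Cod C f)"
  and is_functor_Ide: "is_functor C D Fo Fa \<Longrightarrow> x \<in> Obj C \<Longrightarrow> Fa (Ide C x) = Ide D (Fo x)"
  and is_functor_Cmp: "is_functor C D Fo Fa \<Longrightarrow> f \<in> Arr C \<Longrightarrow> g \<in> Arr C \<Longrightarrow> Cod C f = Dom C g \<Longrightarrow>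
    Fa (f \<cdot>\<^bsub>C\<^esub> g) = Fa f \<cdot>\<^bsub>D\<^esub> Fa g"
  unfolding is_functor_def by auto

lemmas functor_simps =
  is_functor_Obj is_functor_Arr is_functor_Dom is_functor_Cod is_functor_Ide is_functor_Cmp

lemma is_functorI:
  assumes "\<And>x. x \<in> Obj C \<Longrightarrow> Fo x \<in> Obj D"
    and "\<And>f. f \<in> Arr C \<Longrightarrow> Fa f \<in> Arr D"
    and "\<And>f. f \<in> Arr C \<Longrightarrow> Dom D (Fa f) = Fo (Dom C f)"
    and "\<And>f. f \<in> Arr C \<Longrightarrow> Cod D (Fa f) = Fo (Cod C f)"
    and "\<And>x. x \<in> Obj C \<Longrightarrow> Fa (Ide C x) = Ide D (Fo x)"
    and "\<And>f g. \<lbrakk>f \<in> Arr C; g \<in> Arr C; Cod C f = Dom C g\<rbrakk> \<Longrightarrow> Fa (f \<cdot>\<^bsub>C\<^esub> g) = Fa f \<cdot>\<^bsub>D\<^esub> Fa g"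
  shows "is_functor C D Fo Fa"
  using assms unfolding is_functor_def by auto

text \<open>\<open>compose\<close> cuts the composite down to the carriers, because arrows of the
  two large categories are made of extensional functions.\<close>

lemma is_functor_compose:
  assumes "category C" "is_functor C D Fo Fa" "is_functor D E Go Ga"
  shows "is_functor C E (compose (Obj C) Go Fo) (compose (Arr C) Ga Fa)"
proof -
  interpret category C by fact
  show ?thesis
    using assms(2,3) by (intro is_functorI) (simp_all add: compose_eq functor_simps cat_simps)
qed

lemma is_functor_restrict_id: "category C \<Longrightarrow> is_functor C C (\<lambda>x\<in>Obj C. x) (\<lambda>f\<in>Arr C. f)"
  by (intro is_functorI) (simp_all add: category.cat_simps)

lemma is_functor_isomorphism:
  assumes "category C" "category D" "is_functor C D Fo Fa" "is_inverse C f g"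
  shows "is_inverse D (Fa f) (Fa g)"
proof -
  interpret C: category C by fact
  note i = assms(4)[unfolded is_inverse_def]
  have "Fa f \<cdot>\<^bsub>D\<^esub> Fa g = Ide D (Fo (Dom C f))" "Fa g \<cdot>\<^bsub>D\<^esub> Fa f = Ide D (Fo (Cod C f))"
    using i is_functor_Cmp[OF assms(3), of f g] is_functor_Cmp[OF assms(3), of g f]
      is_functor_Ide[OF assms(3)] C.Dom_in C.Cod_in by auto
  then show ?thesis
    using i assms(3) by (simp add: is_inverse_def functor_simps)
qed

lemma is_functor_inverse_arr:
  assumes "groupoid C" "category D" "is_functor C D Fo Fa" "f \<in> Arr C"
  shows "Fa (inverse_arr C f) = inverse_arr D (Fa f)"
proof -
  interpret groupoid C by fact
  show ?thesis
    using assms is_functor_isomorphism[OF category_axioms]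
    by (metis category.inverse_arr_eq is_inverse_inverse_arr)
qed

text \<open>Each law for the inverse arises from the law for \<open>Fa\<close> by applying
  \<open>Ga\<close> to both sides. This is the common core of the isomorphism criteria in both large
  categories.\<close>

lemma is_functor_inverse_functor:
  assumes "category C" "is_functor C D Fo Fa"
    and Go: "\<And>y. y \<in> Obj D \<Longrightarrow> Go y \<in> Obj C" "\<And>y. y \<in> Obj D \<Longrightarrow> Fo (Go y) = y" "\<And>x. x \<in> Obj C \<Longrightarrow> Go (Fo x) = x"
    and Ga: "\<And>g. g \<in> Arr D \<Longrightarrow> Ga g \<in> Arr C" "\<And>g. g \<in> Arr D \<Longrightarrow> Fa (Ga g) = g" "\<And>f. f \<in> Arr C \<Longrightarrow> Ga (Fa f) = f"
  shows "is_functor D C Go Ga"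
proof -
  interpret C: category C by fact
  note F = functor_simps[OF assms(2)]
  have D: "Dom C (Ga g) = Go (Dom D g)" "Cod C (Ga g) = Go (Cod D g)" if "g \<in> Arr D" for g
    using that by (metis C.Dom_in F(3) Ga(1,2) Go(3)) (metis that C.Cod_in F(4) Ga(1,2) Go(3))
  show ?thesis
  proof (intro is_functorI)
    show "Ga (Ide D x) = Ide C (Go x)" if "x \<in> Obj D" for x
      using that by (metis C.Ide_in F(5) Ga(3) Go(1,2))
    show "Ga (f \<cdot>\<^bsub>D\<^esub> g) = Ga f \<cdot>\<^bsub>C\<^esub> Ga g" if "f \<in> Arr D" "g \<in> Arr D" "Cod D f = Dom D g" for f g
      using that by (metis C.Cmp_in F(6) Ga D)
  qed (auto simp: Go Ga D)
qed

section \<open>Adjunctions from a unit and a counit\<close>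

lemma homI: "f \<in> Arr C \<Longrightarrow> Dom C f = x \<Longrightarrow> Cod C f = y \<Longrightarrow> f \<in> hom C x y"
  by (simp add: hom_def)

text \<open>Instantiated twice with the same unit and counit: once for all quadruples and once for
  the full subcategory of fibered semi-direct products.\<close>

locale unit_counit =
  C: category C + D: category D
  for C :: "('o, 'a) cat" and D :: "('p, 'b) cat" +
  fixes Lo La Ro Ra \<eta> \<epsilon>
  assumes L: "is_functor C D Lo La" and R: "is_functor D C Ro Ra"
    and unit_hom: "X \<in> Obj C \<Longrightarrow> \<eta> X \<in> hom C X (Ro (Lo X))"
    and counit_hom: "Y \<in> Obj D \<Longrightarrow> \<epsilon> Y \<in> hom D (Lo (Ro Y)) Y"
    and unit_natural: "u \<in> Arr C \<Longrightarrow> u \<cdot>\<^bsub>C\<^esub> \<eta> (Cod C u) = \<eta> (Dom C u) \<cdot>\<^bsub>C\<^esub> Ra (La u)"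
    and counit_natural: "w \<in> Arr D \<Longrightarrow> La (Ra w) \<cdot>\<^bsub>D\<^esub> \<epsilon> (Cod D w) = \<epsilon> (Dom D w) \<cdot>\<^bsub>D\<^esub> w"
    and triangle_L: "X \<in> Obj C \<Longrightarrow> La (\<eta> X) \<cdot>\<^bsub>D\<^esub> \<epsilon> (Lo X) = Ide D (Lo X)"
    and triangle_R: "Y \<in> Obj D \<Longrightarrow> \<eta> (Ro Y) \<cdot>\<^bsub>C\<^esub> Ra (\<epsilon> Y) = Ide C (Ro Y)"
begin

text \<open>Of the target category only the composition occurs. A full subcategory has the same
  composition, so both instances of the locale define one and the same function.\<close>

definition transpose :: "'o \<Rightarrow> 'p \<Rightarrow> 'a \<Rightarrow> 'b" where
  "transpose X Y f = La f \<cdot>\<^bsub>D\<^esub> \<epsilon> Y"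

lemmas L_simps = functor_simps[OF L] and R_simps = functor_simps[OF R]

lemma unit_simps:
  "X \<in> Obj C \<Longrightarrow> \<eta> X \<in> Arr C" "X \<in> Obj C \<Longrightarrow> Dom C (\<eta> X) = X"
  "X \<in> Obj C \<Longrightarrow> Cod C (\<eta> X) = Ro (Lo X)"
  using unit_hom by (auto simp: hom_def)

lemma counit_simps:
  "Y \<in> Obj D \<Longrightarrow> \<epsilon> Y \<in> Arr D" "Y \<in> Obj D \<Longrightarrow> Dom D (\<epsilon> Y) = Lo (Ro Y)"
  "Y \<in> Obj D \<Longrightarrow> Cod D (\<epsilon> Y) = Y"
  using counit_hom by (auto simp: hom_def)

lemmas all_simps = L_simps R_simps unit_simps counit_simps C.cat_simps D.cat_simps

lemma transpose_hom:
  assumes "X \<in> Obj C" "Y \<in> Obj D" "f \<in> hom C X (Ro Y)"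
  shows "transpose X Y f \<in> hom D (Lo X) Y"
  using assms by (auto simp: hom_def transpose_def all_simps)

text \<open>Naturality of the unit moves \<open>f\<close> in front of it, and what remains is the
  triangle identity at \<open>Y\<close>. The lemma below is the dual argument, with naturality of
  the counit.\<close>

lemma transpose_inverse_left:
  assumes "X \<in> Obj C" "Y \<in> Obj D" "f \<in> hom C X (Ro Y)"
  shows "\<eta> X \<cdot>\<^bsub>C\<^esub> Ra (transpose X Y f) = f"
proof -
  have f: "f \<in> Arr C" "Dom C f = X" "Cod C f = Ro Y"
    using assms by (auto simp: hom_def)
  have "\<eta> X \<cdot>\<^bsub>C\<^esub> Ra (transpose X Y f) = \<eta> X \<cdot>\<^bsub>C\<^esub> (Ra (La f) \<cdot>\<^bsub>C\<^esub> Ra (\<epsilon> Y))"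
    using assms f by (simp add: transpose_def all_simps)
  also have "\<dots> = (f \<cdot>\<^bsub>C\<^esub> \<eta> (Ro Y)) \<cdot>\<^bsub>C\<^esub> Ra (\<epsilon> Y)"
    using assms f unit_natural[of f] by (simp add: C.Cmp_assoc all_simps)
  also have "\<dots> = f"
    using assms f triangle_R[of Y] C.Ide_right[of f] by (simp add: C.Cmp_assoc all_simps)
  finally show ?thesis .
qed

lemma transpose_inverse_right:
  assumes "X \<in> Obj C" "Y \<in> Obj D" "g \<in> hom D (Lo X) Y"
  shows "transpose X Y (\<eta> X \<cdot>\<^bsub>C\<^esub> Ra g) = g"
proof -
  have g: "g \<in> Arr D" "Dom D g = Lo X" "Cod D g = Y"
    using assms by (auto simp: hom_def)
  have "transpose X Y (\<eta> X \<cdot>\<^bsub>C\<^esub> Ra g) = La (\<eta> X) \<cdot>\<^bsub>D\<^esub> (La (Ra g) \<cdot>\<^bsub>D\<^esub> \<epsilon> Y)"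
    using assms g by (simp add: transpose_def D.Cmp_assoc all_simps)
  also have "\<dots> = (La (\<eta> X) \<cdot>\<^bsub>D\<^esub> \<epsilon> (Lo X)) \<cdot>\<^bsub>D\<^esub> g"
    using assms g counit_natural[of g] by (simp add: D.Cmp_assoc all_simps)
  also have "\<dots> = g"
    using assms g triangle_L[of X] D.Ide_left[of g] by simp
  finally show ?thesis .
qed

lemma unit_Ra_hom:
  assumes "X \<in> Obj C" "Y \<in> Obj D" "g \<in> hom D (Lo X) Y"
  shows "\<eta> X \<cdot>\<^bsub>C\<^esub> Ra g \<in> hom C X (Ro Y)"
  using assms by (auto simp: hom_def all_simps)

lemma bij_betw_transpose:
  assumes "X \<in> Obj C" "Y \<in> Obj D"
  shows "bij_betw (transpose X Y) (hom C X (Ro Y)) (hom D (Lo X) Y)"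
  by (rule bij_betwI[where g = "\<lambda>g. \<eta> X \<cdot>\<^bsub>C\<^esub> Ra g"])
    (auto simp: assms transpose_hom transpose_inverse_left transpose_inverse_right unit_Ra_hom)

theorem adjunction_transpose: "adjunction C D Lo La Ro Ra transpose"
  unfolding adjunction_def
proof (intro conjI ballI)
  show "transpose X' Y (u \<cdot>\<^bsub>C\<^esub> f) = La u \<cdot>\<^bsub>D\<^esub> transpose X Y f"
    if "X \<in> Obj C" "X' \<in> Obj C" "Y \<in> Obj D" "u \<in> hom C X' X" "f \<in> hom C X (Ro Y)" for X X' Y u f
    using that by (auto simp: transpose_def hom_def all_simps D.Cmp_assoc)
  show "transpose X Y' (f \<cdot>\<^bsub>C\<^esub> Ra w) = transpose X Y f \<cdot>\<^bsub>D\<^esub> w"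
    if "X \<in> Obj C" "Y \<in> Obj D" "Y' \<in> Obj D" "w \<in> hom D Y Y'" "f \<in> hom C X (Ro Y)" for X Y Y' w f
  proof -
    have "transpose X Y' (f \<cdot>\<^bsub>C\<^esub> Ra w) = La f \<cdot>\<^bsub>D\<^esub> (La (Ra w) \<cdot>\<^bsub>D\<^esub> \<epsilon> Y')"
      using that by (auto simp: transpose_def hom_def all_simps D.Cmp_assoc)
    also have "\<dots> = La f \<cdot>\<^bsub>D\<^esub> (\<epsilon> Y \<cdot>\<^bsub>D\<^esub> w)"
      using that counit_natural[of w] by (auto simp: hom_def)
    finally show ?thesis
      using that by (auto simp: transpose_def hom_def all_simps D.Cmp_assoc)
  qed
qed (auto simp: C.category_axioms D.category_axioms L R bij_betw_transpose)

text \<open>\<open>adj_unit\<close> is obtained by inverting the hom-set bijection at an identity;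
  the triangle identity says that \<open>\<eta> X\<close> is a preimage of it, and injectivity that
  it is the only one.\<close>

lemma adj_unit_transpose:
  assumes "X \<in> Obj C"
  shows "adj_unit C D Lo Ro transpose X = \<eta> X"
  unfolding adj_unit_def
proof (rule inv_into_f_eq)
  show "inj_on (transpose X (Lo X)) (hom C X (Ro (Lo X)))"
    using assms bij_betw_transpose by (simp add: all_simps bij_betw_def)
qed (use assms in \<open>simp_all add: unit_hom transpose_def triangle_L\<close>)

lemma adj_counit_transpose:
  assumes "Y \<in> Obj D"
  shows "adj_counit C Ro transpose Y = \<epsilon> Y"
  using assms D.Ide_left[of "\<epsilon> Y"] by (simp add: adj_counit_def transpose_def all_simps)

end

section \<open>Full subcategories and restriction of the adjunction\<close>

lemma full_subcategory_sel [simp]: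
  "Obj (full_subcategory C P) = {x \<in> Obj C. P x}"
  "Arr (full_subcategory C P) = {f \<in> Arr C. P (Dom C f) \<and> P (Cod C f)}"
  "Dom (full_subcategory C P) = Dom C" "Cod (full_subcategory C P) = Cod C"
  "Ide (full_subcategory C P) = Ide C" "Cmp (full_subcategory C P) = Cmp C"
  by (simp_all add: full_subcategory_def)

lemma category_full_subcategory: "category C \<Longrightarrow> category (full_subcategory C P)"
  unfolding category_def by auto

lemma isomorphism_full_subcategory:
  "\<lbrakk>isomorphism C f; P (Dom C f); P (Cod C f)\<rbrakk> \<Longrightarrow> isomorphism (full_subcategory C P) f"
  unfolding isomorphism_def is_inverse_def by auto

text \<open>The counit at \<open>Y\<close> runs from \<open>Lo (Ro Y)\<close> to \<open>Y\<close>,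
  so it stays inside the subcategory as soon as all values of \<open>Lo\<close> lie there.\<close>

lemma (in unit_counit) unit_counit_full_subcategory:
  assumes "\<And>X. X \<in> Obj C \<Longrightarrow> P (Lo X)"
  shows "unit_counit C (full_subcategory D P) Lo La Ro Ra \<eta> \<epsilon>"
proof -
  interpret D': category "full_subcategory D P"
    by (rule category_full_subcategory) (rule D.category_axioms)
  show ?thesis
  proof
    show "is_functor C (full_subcategory D P) Lo La"
      using L by (intro is_functorI) (auto simp: all_simps assms)
    show "is_functor (full_subcategory D P) C Ro Ra"
      using R by (intro is_functorI) (auto simp: all_simps)
  qed (auto simp: hom_def all_simps assms unit_natural counit_natural triangle_L triangle_R)
qed

section \<open>The category of quadruples\<close>

lemma TwoSemi_sel [simp]:
  "X \<in> Obj TwoSemi \<longleftrightarrow> is_quad X"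
  "(X, f, Y) \<in> Arr TwoSemi \<longleftrightarrow> is_quad X \<and> is_quad Y \<and> is_quad_map X f Y"
  "Dom TwoSemi (X, f, Y) = X" "Cod TwoSemi (X, f, Y) = Y"
  "Ide TwoSemi X = (X, quad_id X, X)" "Cmp TwoSemi = quad_comp"
  by (simp_all add: TwoSemi_def)

lemma is_quad_subsets:
  assumes "is_quad (G, H, K, A)"
  shows "groupoid G" "category G" "H \<subseteq> Arr G" "K \<subseteq> Arr G" "A \<subseteq> Arr G"
  using assms by (auto simp: subgroupoid_def abelian_subgroupoid_def groupoid_def)

lemma is_quad_map_compose:
  assumes "is_quad (G, H, K, A)" "is_quad_map (G, H, K, A) (fo, fa) Y" "is_quad_map Y (eo, ea) Z"
  shows "is_quad_map (G, H, K, A) (compose (Obj G) eo fo, compose (Arr G) ea fa) Z"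
proof -
  obtain G' H' K' A' where Y: "Y = (G', H', K', A')" by (cases Y)
  obtain G'' H'' K'' A'' where Z: "Z = (G'', H'', K'', A'')" by (cases Z)
  have *: "compose (Arr G) ea fa ` S \<subseteq> S''" if "fa ` S \<subseteq> S'" "ea ` S' \<subseteq> S''" "S \<subseteq> Arr G" for S S' S''
    using that by (auto simp: compose_eq subset_iff)
  note q = is_quad_subsets[OF assms(1)]
  note f = assms(2)[unfolded Y is_quad_map.simps] and g = assms(3)[unfolded Y Z is_quad_map.simps]
  show ?thesis
    using f g is_functor_compose[OF q(2), of G' fo fa G'' eo ea]
      *[of H H' H''] *[of K K' K''] *[of A A' A''] q(3-5)
    unfolding Z is_quad_map.simps by (simp only: compose_extensional simp_thms)
qed

lemma category_TwoSemi: "category TwoSemi"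
proof
  fix f g :: "('o, 'u) quad_arr"
  assume f: "f \<in> Arr TwoSemi" and g: "g \<in> Arr TwoSemi" and fg: "Cod TwoSemi f = Dom TwoSemi g"
  obtain G H K A fo fa Y where f': "f = ((G, H, K, A), (fo, fa), Y)" by (metis prod.exhaust)
  obtain eo ea Z where g': "g = (Y, (eo, ea), Z)" using fg f' by (cases g) auto
  show "f \<cdot>\<^bsub>TwoSemi\<^esub> g \<in> Arr TwoSemi"
    using f g is_quad_map_compose[of G H K A fo fa Y eo ea Z] unfolding f' g'
    by (simp del: is_quad.simps is_quad_map.simps)
  show "Dom TwoSemi (f \<cdot>\<^bsub>TwoSemi\<^esub> g) = Dom TwoSemi f" "Cod TwoSemi (f \<cdot>\<^bsub>TwoSemi\<^esub> g) = Cod TwoSemi g"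
    unfolding f' g' by simp_all
  fix h :: "('o, 'u) quad_arr"
  assume h: "h \<in> Arr TwoSemi" and gh: "Cod TwoSemi g = Dom TwoSemi h"
  obtain G' H' K' A' where Y: "Y = (G', H', K', A')" by (cases Y)
  obtain io ia W where h': "h = (Z, (io, ia), W)" using gh g' by (cases h) auto
  have "fo \<in> Obj G \<rightarrow> Obj G'" "fa \<in> Arr G \<rightarrow> Arr G'"
    using f by (auto simp: f' Y functor_simps)
  then show "(f \<cdot>\<^bsub>TwoSemi\<^esub> g) \<cdot>\<^bsub>TwoSemi\<^esub> h = f \<cdot>\<^bsub>TwoSemi\<^esub> (g \<cdot>\<^bsub>TwoSemi\<^esub> h)"
    unfolding f' g' h' Y by (simp add: compose_assoc)
next
  fix f :: "('o, 'u) quad_arr"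
  assume f: "f \<in> Arr TwoSemi"
  obtain G H K A fo fa G' H' K' A' where f': "f = ((G, H, K, A), (fo, fa), (G', H', K', A'))"
    by (metis prod.exhaust)
  show "Dom TwoSemi f \<in> Obj TwoSemi" "Cod TwoSemi f \<in> Obj TwoSemi"
    using f unfolding f' by (simp_all del: is_quad.simps is_quad_map.simps)
  \<comment> \<open>Under restricted composition the unit laws hold for maps that are extensional
    and take their values in the right carriers.\<close>
  have "fo \<in> Obj G \<rightarrow> Obj G'" "fa \<in> Arr G \<rightarrow> Arr G'" "fo \<in> extensional (Obj G)" "fa \<in> extensional (Arr G)"
    using f by (auto simp: f' functor_simps)
  then show "Ide TwoSemi (Dom TwoSemi f) \<cdot>\<^bsub>TwoSemi\<^esub> f = f" "f \<cdot>\<^bsub>TwoSemi\<^esub> Ide TwoSemi (Cod TwoSemi f) = f"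
    unfolding f' by (simp_all add: compose_Id Id_compose)
next
  fix X :: "('o, 'u) quad"
  assume X: "X \<in> Obj TwoSemi"
  obtain G H K A where X': "X = (G, H, K, A)" by (cases X)
  show "Dom TwoSemi (Ide TwoSemi X) = X" "Cod TwoSemi (Ide TwoSemi X) = X"
    by simp_all
  note q = is_quad_subsets[OF X[unfolded X', simplified TwoSemi_sel]]
  have "is_quad_map X (quad_id X) X"
    using is_functor_restrict_id[OF q(2)] q(3-5) unfolding X' by auto
  then show "Ide TwoSemi X \<in> Arr TwoSemi"
    using X by simp
qed

section \<open>Double functors\<close>

lemma (in double_category) corner_simps:
  assumes "X \<in> Sqr T"
  shows "Dom (Hor T) (sTop T X) = Dom (Ver T) (sLeft T X)"
    "Cod (Hor T) (sTop T X) = Dom (Ver T) (sRight T X)"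
    "Dom (Hor T) (sBot T X) = Cod (Ver T) (sLeft T X)"
    "Cod (Hor T) (sBot T X) = Cod (Ver T) (sRight T X)"
  using corners[OF assms] by auto

sublocale double_category \<subseteq> Hor: category "Hor T" by (rule cat_Hor)
sublocale double_category \<subseteq> Ver: category "Ver T" by (rule cat_Ver)
sublocale double_category \<subseteq> HSq: category "HSq T" by (rule cat_HSq)
sublocale double_category \<subseteq> VSq: category "VSq T" by (rule cat_VSq)

context double_category
begin

lemma sides_in:
  assumes "X \<in> Sqr T"
  shows "sLeft T X \<in> Arr (Ver T)" "sRight T X \<in> Arr (Ver T)"
    "sTop T X \<in> Arr (Hor T)" "sBot T X \<in> Arr (Hor T)"
  using assms HSq.Dom_in HSq.Cod_in VSq.Dom_in VSq.Cod_in Obj_HSq Obj_VSq Arr_VSq by auto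

lemma hcomp_simps:
  assumes "X \<in> Sqr T" "Y \<in> Sqr T" "sRight T X = sLeft T Y"
  shows "X \<cdot>\<^bsub>HSq T\<^esub> Y \<in> Sqr T"
    "sLeft T (X \<cdot>\<^bsub>HSq T\<^esub> Y) = sLeft T X" "sRight T (X \<cdot>\<^bsub>HSq T\<^esub> Y) = sRight T Y"
    "sTop T (X \<cdot>\<^bsub>HSq T\<^esub> Y) = sTop T X \<cdot>\<^bsub>Hor T\<^esub> sTop T Y"
    "sBot T (X \<cdot>\<^bsub>HSq T\<^esub> Y) = sBot T X \<cdot>\<^bsub>Hor T\<^esub> sBot T Y"
  using assms hcomp_boundary by (auto simp: HSq.cat_simps)

lemma vcomp_simps:
  assumes "X \<in> Sqr T" "Y \<in> Sqr T" "sBot T X = sTop T Y"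
  shows "X \<cdot>\<^bsub>VSq T\<^esub> Y \<in> Sqr T"
    "sTop T (X \<cdot>\<^bsub>VSq T\<^esub> Y) = sTop T X" "sBot T (X \<cdot>\<^bsub>VSq T\<^esub> Y) = sBot T Y"
    "sLeft T (X \<cdot>\<^bsub>VSq T\<^esub> Y) = sLeft T X \<cdot>\<^bsub>Ver T\<^esub> sLeft T Y"
    "sRight T (X \<cdot>\<^bsub>VSq T\<^esub> Y) = sRight T X \<cdot>\<^bsub>Ver T\<^esub> sRight T Y"
  using assms vcomp_boundary VSq.Cmp_in by (auto simp: VSq.cat_simps Arr_VSq)

lemma hid_simps:
  assumes "v \<in> Arr (Ver T)"
  shows "Ide (HSq T) v \<in> Sqr T" "sLeft T (Ide (HSq T) v) = v" "sRight T (Ide (HSq T) v) = v"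
    "sTop T (Ide (HSq T) v) = Ide (Hor T) (Dom (Ver T) v)"
    "sBot T (Ide (HSq T) v) = Ide (Hor T) (Cod (Ver T) v)"
  using assms hid_boundary by (auto simp: HSq.cat_simps Obj_HSq)

lemma vid_simps:
  assumes "h \<in> Arr (Hor T)"
  shows "Ide (VSq T) h \<in> Sqr T" "sTop T (Ide (VSq T) h) = h" "sBot T (Ide (VSq T) h) = h"
    "sLeft T (Ide (VSq T) h) = Ide (Ver T) (Dom (Hor T) h)"
    "sRight T (Ide (VSq T) h) = Ide (Ver T) (Cod (Hor T) h)"
  using assms vid_boundary VSq.Ide_in by (auto simp: VSq.cat_simps Obj_VSq Arr_VSq)

lemma hcomp_id:
  "\<lbrakk>X \<in> Sqr T; sLeft T X = v\<rbrakk> \<Longrightarrow> Ide (HSq T) v \<cdot>\<^bsub>HSq T\<^esub> X = X"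
  "\<lbrakk>X \<in> Sqr T; sRight T X = v\<rbrakk> \<Longrightarrow> X \<cdot>\<^bsub>HSq T\<^esub> Ide (HSq T) v = X"
  by (simp_all add: HSq.Ide_left' HSq.Ide_right')

lemma vcomp_id:
  "\<lbrakk>X \<in> Sqr T; sTop T X = h\<rbrakk> \<Longrightarrow> Ide (VSq T) h \<cdot>\<^bsub>VSq T\<^esub> X = X"
  "\<lbrakk>X \<in> Sqr T; sBot T X = h\<rbrakk> \<Longrightarrow> X \<cdot>\<^bsub>VSq T\<^esub> Ide (VSq T) h = X"
  by (simp_all add: VSq.Ide_left' VSq.Ide_right' Arr_VSq)

lemma proj_frame_eq_iff:
  assumes "X \<in> Sqr T"
  shows "proj_frame T X = proj_frame T Y \<longleftrightarrow>
    sTop T X = sTop T Y \<and> sRight T X = sRight T Y \<and> sLeft T X = sLeft T Y \<and> sBot T X = sBot T Y"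
proof
  assume "proj_frame T X = proj_frame T Y"
  moreover have "X \<in> proj_frame T X"
    using assms by (simp add: proj_frame_def)
  ultimately have "X \<in> proj_frame T Y" by simp
  then show "sTop T X = sTop T Y \<and> sRight T X = sRight T Y \<and> sLeft T X = sLeft T Y \<and> sBot T X = sBot T Y"
    by (simp add: proj_frame_def)
qed (simp add: proj_frame_def)

lemma mem_proj_frame: "X \<in> Sqr T \<Longrightarrow> X \<in> proj_frame T X"
  by (simp add: proj_frame_def)

text \<open>\<open>the_elem\<close> is meaningful here because a side is constant on a class and the
  class contains \<open>X\<close>.\<close>

lemma frame_sides:
  assumes "X \<in> Sqr T"
  shows "sLeft (frame T) (proj_frame T X) = sLeft T X" "sRight (frame T) (proj_frame T X) = sRight T X"
    "sTop (frame T) (proj_frame T X) = sTop T X" "sBot (frame T) (proj_frame T X) = sBot T X"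
proof -
  have "proj_frame T X \<noteq> {}"
    using mem_proj_frame[OF assms] by blast
  note * = the_elem_image_unique[OF this]
  have "the_elem (sLeft T ` proj_frame T X) = sLeft T X" "the_elem (sRight T ` proj_frame T X) = sRight T X"
    "the_elem (sTop T ` proj_frame T X) = sTop T X" "the_elem (sBot T ` proj_frame T X) = sBot T X"
    by (rule *; simp add: proj_frame_def)+
  then show "sLeft (frame T) (proj_frame T X) = sLeft T X" "sRight (frame T) (proj_frame T X) = sRight T X"
    "sTop (frame T) (proj_frame T X) = sTop T X" "sBot (frame T) (proj_frame T X) = sBot T X"
    by (simp_all add: frame_def)
qed

text \<open>The boundary of a composite depends only on the boundaries of the factors, so all
  classes in the union over representatives coincide. The union then collapses because both index
  classes are inhabited.\<close>

lemma frame_hcomp: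
  assumes "X \<in> Sqr T" "Y \<in> Sqr T" "sRight T X = sLeft T Y"
  shows "proj_frame T X \<cdot>\<^bsub>HSq (frame T)\<^esub> proj_frame T Y = proj_frame T (X \<cdot>\<^bsub>HSq T\<^esub> Y)"
proof -
  have "proj_frame T (X' \<cdot>\<^bsub>HSq T\<^esub> Y') = proj_frame T (X \<cdot>\<^bsub>HSq T\<^esub> Y)"
    if "X' \<in> proj_frame T X" "Y' \<in> proj_frame T Y" for X' Y'
    using that assms by (subst proj_frame_eq_iff) (auto simp: proj_frame_def hcomp_simps)
  then have "(\<Union>X'\<in>proj_frame T X. \<Union>Y'\<in>proj_frame T Y. proj_frame T (X' \<cdot>\<^bsub>HSq T\<^esub> Y')) =
      (\<Union>X'\<in>proj_frame T X. \<Union>Y'\<in>proj_frame T Y. proj_frame T (X \<cdot>\<^bsub>HSq T\<^esub> Y))"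
    by (intro SUP_cong refl)
  then show ?thesis
    using mem_proj_frame[OF assms(1)] mem_proj_frame[OF assms(2)] by (auto simp: frame_def)
qed

lemma frame_vcomp:
  assumes "X \<in> Sqr T" "Y \<in> Sqr T" "sBot T X = sTop T Y"
  shows "proj_frame T X \<cdot>\<^bsub>VSq (frame T)\<^esub> proj_frame T Y = proj_frame T (X \<cdot>\<^bsub>VSq T\<^esub> Y)"
proof -
  have "proj_frame T (X' \<cdot>\<^bsub>VSq T\<^esub> Y') = proj_frame T (X \<cdot>\<^bsub>VSq T\<^esub> Y)"
    if "X' \<in> proj_frame T X" "Y' \<in> proj_frame T Y" for X' Y'
    using that assms by (subst proj_frame_eq_iff) (auto simp: proj_frame_def vcomp_simps)
  then have "(\<Union>X'\<in>proj_frame T X. \<Union>Y'\<in>proj_frame T Y. proj_frame T (X' \<cdot>\<^bsub>VSq T\<^esub> Y')) =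
      (\<Union>X'\<in>proj_frame T X. \<Union>Y'\<in>proj_frame T Y. proj_frame T (X \<cdot>\<^bsub>VSq T\<^esub> Y))"
    by (intro SUP_cong refl)
  then show ?thesis
    using mem_proj_frame[OF assms(1)] mem_proj_frame[OF assms(2)] by (auto simp: frame_def)
qed

lemma frame_sel:
  "Hor (frame T) = Hor T" "Ver (frame T) = Ver T"
  "Obj (HSq (frame T)) = Arr (Ver T)" "Obj (VSq (frame T)) = Arr (Hor T)"
  "Arr (HSq (frame T)) = proj_frame T ` Sqr T" "Arr (VSq (frame T)) = proj_frame T ` Sqr T"
  "Ide (HSq (frame T)) v = proj_frame T (Ide (HSq T) v)"
  "Ide (VSq (frame T)) h = proj_frame T (Ide (VSq T) h)"
  by (simp_all add: frame_def Obj_HSq Obj_VSq)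

text \<open>Lets a section be verified on representatives, which spares computing with the quotient
  operations in each instance; \<open>is_sectionD\<close> is the way back.\<close>

lemma is_sectionI:
  assumes boundary: "\<And>X. X \<in> Sqr T \<Longrightarrow> s (proj_frame T X) \<in> proj_frame T X"
    and "\<And>v. v \<in> Arr (Ver T) \<Longrightarrow> s (proj_frame T (Ide (HSq T) v)) = Ide (HSq T) v"
    and "\<And>h. h \<in> Arr (Hor T) \<Longrightarrow> s (proj_frame T (Ide (VSq T) h)) = Ide (VSq T) h"
    and "\<And>X Y. \<lbrakk>X \<in> Sqr T; Y \<in> Sqr T; sRight T X = sLeft T Y\<rbrakk> \<Longrightarrow>
      s (proj_frame T (X \<cdot>\<^bsub>HSq T\<^esub> Y)) = s (proj_frame T X) \<cdot>\<^bsub>HSq T\<^esub> s (proj_frame T Y)"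
    and "\<And>X Y. \<lbrakk>X \<in> Sqr T; Y \<in> Sqr T; sBot T X = sTop T Y\<rbrakk> \<Longrightarrow>
      s (proj_frame T (X \<cdot>\<^bsub>VSq T\<^esub> Y)) = s (proj_frame T X) \<cdot>\<^bsub>VSq T\<^esub> s (proj_frame T Y)"
  shows "is_section T s"
proof -
  have b: "s (proj_frame T X) \<in> Sqr T" "sTop T (s (proj_frame T X)) = sTop T X"
    "sRight T (s (proj_frame T X)) = sRight T X" "sLeft T (s (proj_frame T X)) = sLeft T X"
    "sBot T (s (proj_frame T X)) = sBot T X" if "X \<in> Sqr T" for X
    using boundary[OF that] by (auto simp: proj_frame_def)
  have "is_functor (HSq (frame T)) (HSq T) (\<lambda>v. v) s"
    by (intro is_functorI) (auto simp: frame_sel frame_sides frame_hcomp Obj_HSq b assms(2-5))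
  moreover have "is_functor (VSq (frame T)) (VSq T) (\<lambda>v. v) s"
    by (intro is_functorI) (auto simp: frame_sel frame_sides frame_vcomp Obj_VSq Arr_VSq b assms(2-5))
  moreover have "is_functor (Hor (frame T)) (Hor T) (\<lambda>v. v) (\<lambda>v. v)"
    "is_functor (Ver (frame T)) (Ver T) (\<lambda>v. v) (\<lambda>v. v)"
    by (auto intro!: is_functorI simp: frame_sel)
  moreover have "proj_frame T (s (proj_frame T X)) = proj_frame T X" if "X \<in> Sqr T" for X
    using that b by (subst proj_frame_eq_iff) auto
  ultimately show ?thesis
    by (auto simp: is_section_def double_functor_def frame_sel)
qed

lemma is_sectionD:
  assumes "is_section T s"
  shows "\<And>X. X \<in> Sqr T \<Longrightarrow> s (proj_frame T X) \<in> proj_frame T X"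
    and "\<And>v. v \<in> Arr (Ver T) \<Longrightarrow> s (proj_frame T (Ide (HSq T) v)) = Ide (HSq T) v"
    and "\<And>h. h \<in> Arr (Hor T) \<Longrightarrow> s (proj_frame T (Ide (VSq T) h)) = Ide (VSq T) h"
    and "\<And>X Y. \<lbrakk>X \<in> Sqr T; Y \<in> Sqr T; sRight T X = sLeft T Y\<rbrakk> \<Longrightarrow>
      s (proj_frame T (X \<cdot>\<^bsub>HSq T\<^esub> Y)) = s (proj_frame T X) \<cdot>\<^bsub>HSq T\<^esub> s (proj_frame T Y)"
    and "\<And>X Y. \<lbrakk>X \<in> Sqr T; Y \<in> Sqr T; sBot T X = sTop T Y\<rbrakk> \<Longrightarrow>
      s (proj_frame T (X \<cdot>\<^bsub>VSq T\<^esub> Y)) = s (proj_frame T X) \<cdot>\<^bsub>VSq T\<^esub> s (proj_frame T Y)"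
proof -
  have H: "is_functor (HSq (frame T)) (HSq T) (\<lambda>v. v) s"
    and V: "is_functor (VSq (frame T)) (VSq T) (\<lambda>v. v) s"
    and r: "\<And>X. X \<in> Sqr T \<Longrightarrow> proj_frame T (s (proj_frame T X)) = proj_frame T X"
    using assms by (auto simp: is_section_def double_functor_def frame_sel)
  show "s (proj_frame T X) \<in> proj_frame T X" if "X \<in> Sqr T" for X
    using is_functor_Arr[OF H, of "proj_frame T X"] r[OF that] mem_proj_frame that
    by (force simp: frame_sel)
  show "s (proj_frame T (Ide (HSq T) v)) = Ide (HSq T) v" if "v \<in> Arr (Ver T)" for v
    using is_functor_Ide[OF H] that by (simp add: frame_sel)
  show "s (proj_frame T (Ide (VSq T) h)) = Ide (VSq T) h" if "h \<in> Arr (Hor T)" for h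
    using is_functor_Ide[OF V] that by (simp add: frame_sel)
  show "s (proj_frame T (X \<cdot>\<^bsub>HSq T\<^esub> Y)) = s (proj_frame T X) \<cdot>\<^bsub>HSq T\<^esub> s (proj_frame T Y)"
    if "X \<in> Sqr T" "Y \<in> Sqr T" "sRight T X = sLeft T Y" for X Y
    using is_functor_Cmp[OF H, of "proj_frame T X" "proj_frame T Y"] that
    by (simp add: frame_sel frame_sides frame_hcomp)
  show "s (proj_frame T (X \<cdot>\<^bsub>VSq T\<^esub> Y)) = s (proj_frame T X) \<cdot>\<^bsub>VSq T\<^esub> s (proj_frame T Y)"
    if "X \<in> Sqr T" "Y \<in> Sqr T" "sBot T X = sTop T Y" for X Y
    using is_functor_Cmp[OF V, of "proj_frame T X" "proj_frame T Y"] that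
    by (simp add: frame_sel frame_sides frame_vcomp)
qed

lemma frame_map_proj_frame:
  assumes "double_functor T T' Fo Fh Fv Fs" "X \<in> Sqr T"
  shows "frame_map T' Fs (proj_frame T X) = proj_frame T' (Fs X)"
proof -
  have "proj_frame T' (Fs Y) = proj_frame T' (Fs X)" if "Y \<in> proj_frame T X" for Y
    using that assms unfolding proj_frame_def double_functor_def
    by (auto simp: is_functor_Dom[of "HSq T" "HSq T'"] is_functor_Cod[of "HSq T" "HSq T'"]
        is_functor_Dom[of "VSq T" "VSq T'"] is_functor_Cod[of "VSq T" "VSq T'"] Arr_VSq)
  then have "(\<Union>Y\<in>proj_frame T X. proj_frame T' (Fs Y)) = (\<Union>Y\<in>proj_frame T X. proj_frame T' (Fs X))"
    by (intro SUP_cong refl)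
  then show ?thesis
    using mem_proj_frame[OF assms(2)] by (auto simp: frame_map_def)
qed

lemma double_functor_compose:
  assumes "double_functor T T' Fo Fh Fv Fs" "double_functor T' T'' Eo Eh Ev Es"
  shows "double_functor T T'' (compose (Obj (Hor T)) Eo Fo) (compose (Arr (Hor T)) Eh Fh)
    (compose (Arr (Ver T)) Ev Fv) (compose (Sqr T) Es Fs)"
  using assms is_functor_compose[OF cat_Hor, of "Hor T'" Fo Fh "Hor T''" Eo Eh]
    is_functor_compose[OF cat_Ver, of "Ver T'" Fo Fv "Ver T''" Eo Ev]
    is_functor_compose[OF cat_HSq, of "HSq T'" Fv Fs "HSq T''" Ev Es]
    is_functor_compose[OF cat_VSq, of "VSq T'" Fh Fs "VSq T''" Eh Es]
  by (simp add: double_functor_def Obj_Ver Obj_HSq Obj_VSq Arr_VSq)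

lemma double_functor_restrict_id:
  "double_functor T T (\<lambda>x\<in>Obj (Hor T). x) (\<lambda>h\<in>Arr (Hor T). h) (\<lambda>v\<in>Arr (Ver T). v) (\<lambda>X\<in>Sqr T. X)"
  using is_functor_restrict_id[OF cat_Hor] is_functor_restrict_id[OF cat_Ver]
    is_functor_restrict_id[OF cat_HSq] is_functor_restrict_id[OF cat_VSq]
  unfolding double_functor_def Obj_Ver Obj_HSq Obj_VSq Arr_VSq by blast

lemma double_functor_Pi:
  assumes "double_functor T T' Fo Fh Fv Fs" "double_category T'"
  shows "Fo \<in> Obj (Hor T) \<rightarrow> Obj (Hor T')" "Fh \<in> Arr (Hor T) \<rightarrow> Arr (Hor T')"
    "Fv \<in> Arr (Ver T) \<rightarrow> Arr (Ver T')" "Fs \<in> Sqr T \<rightarrow> Sqr T'"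
  using assms by (auto simp: double_functor_def functor_simps)

end

section \<open>The category of maximal exclusive double groupoids with section\<close>

lemma MaxExcl_sel [simp]:
  "X \<in> Obj MaxExcl \<longleftrightarrow> is_max_excl X"
  "(X, f, Y) \<in> Arr MaxExcl \<longleftrightarrow> is_max_excl X \<and> is_max_excl Y \<and> is_max_excl_map X f Y"
  "Dom MaxExcl (X, f, Y) = X" "Cod MaxExcl (X, f, Y) = Y"
  "Ide MaxExcl X = (X, max_excl_id X, X)" "Cmp MaxExcl = max_excl_comp"
  by (simp_all add: MaxExcl_def)

lemma is_max_excl_double_category: "is_max_excl (T, s) \<Longrightarrow> double_category T"
  by (simp add: double_groupoid_def)

text \<open>Every element of the frame has the form \<open>proj_frame T X\<close>, so preservation
  of the section can be tested on squares.\<close>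

lemma is_max_excl_map_iff:
  assumes "double_category T"
  shows "is_max_excl_map (T, s) (Fo, Fh, Fv, Fs) (T', s') \<longleftrightarrow>
     double_functor T T' Fo Fh Fv Fs \<and>
     (\<forall>X\<in>Sqr T. Fs (s (proj_frame T X)) = s' (proj_frame T' (Fs X))) \<and>
     Fo \<in> extensional (Obj (Hor T)) \<and> Fh \<in> extensional (Arr (Hor T)) \<and>
     Fv \<in> extensional (Arr (Ver T)) \<and> Fs \<in> extensional (Sqr T)"
  using double_category.frame_map_proj_frame[OF assms]
  by (fastforce simp: double_category.frame_sel[OF assms])

lemma is_max_excl_map_compose:
  assumes "is_max_excl (T, s)" "is_max_excl (T', s')" "is_max_excl_map (T, s) (Fo, Fh, Fv, Fs) (T', s')"
    "is_max_excl_map (T', s') (Eo, Eh, Ev, Es) (T'', s'')"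
  shows "is_max_excl_map (T, s) (compose (Obj (Hor T)) Eo Fo, compose (Arr (Hor T)) Eh Fh,
       compose (Arr (Ver T)) Ev Fv, compose (Sqr T) Es Fs) (T'', s'')"
proof -
  interpret T: double_category T using assms is_max_excl_double_category by blast
  interpret T': double_category T' using assms is_max_excl_double_category by blast
  note F = assms(3)[unfolded is_max_excl_map_iff[OF T.double_category_axioms]] and E = assms(4)[unfolded is_max_excl_map_iff[OF T'.double_category_axioms]]
  \<comment> \<open>\<open>compose\<close> unfolds only on the carrier, so the values of the section
    have to be known as squares.\<close>
  have "s (proj_frame T X) \<in> Sqr T" if "X \<in> Sqr T" for X
    using T.is_sectionD(1) assms(1) that by (force simp: proj_frame_def)
  moreover have "Fs X \<in> Sqr T'" if "X \<in> Sqr T" for X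
    using T.double_functor_Pi(4)[OF conjunct1[OF F] T'.double_category_axioms] that by blast
  ultimately show ?thesis
    using F E unfolding is_max_excl_map_iff[OF T.double_category_axioms]
    by (simp add: compose_extensional compose_eq T.double_functor_compose[of T' Fo Fh Fv Fs])
qed

lemma category_MaxExcl: "category MaxExcl"
proof
  fix f g :: "('o, 'u) max_excl_arr"
  assume f: "f \<in> Arr MaxExcl" and g: "g \<in> Arr MaxExcl" and fg: "Cod MaxExcl f = Dom MaxExcl g"
  obtain T s Fo Fh Fv Fs T' s' where f': "f = ((T, s), (Fo, Fh, Fv, Fs), (T', s'))" by (metis prod.exhaust)
  obtain Eo Eh Ev Es T'' s'' where g': "g = ((T', s'), (Eo, Eh, Ev, Es), (T'', s''))"
    using fg f' by (cases g) auto
  show "f \<cdot>\<^bsub>MaxExcl\<^esub> g \<in> Arr MaxExcl"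
    using f g is_max_excl_map_compose[of T s T' s' Fo Fh Fv Fs] unfolding f' g'
    by (simp del: is_max_excl.simps is_max_excl_map.simps)
  show "Dom MaxExcl (f \<cdot>\<^bsub>MaxExcl\<^esub> g) = Dom MaxExcl f" "Cod MaxExcl (f \<cdot>\<^bsub>MaxExcl\<^esub> g) = Cod MaxExcl g"
    unfolding f' g' by simp_all
  fix h :: "('o, 'u) max_excl_arr"
  assume h: "h \<in> Arr MaxExcl" and gh: "Cod MaxExcl g = Dom MaxExcl h"
  obtain Do Dh Dv Ds Z where h': "h = ((T'', s''), (Do, Dh, Dv, Ds), Z)" using gh g' by (cases h) auto
  interpret T: double_category T using f is_max_excl_double_category unfolding f' by fastforce
  have "double_category T'" "double_functor T T' Fo Fh Fv Fs"
    using f by (auto simp: f' double_groupoid_def)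
  note T.double_functor_Pi[OF this(2,1)]
  then show "(f \<cdot>\<^bsub>MaxExcl\<^esub> g) \<cdot>\<^bsub>MaxExcl\<^esub> h = f \<cdot>\<^bsub>MaxExcl\<^esub> (g \<cdot>\<^bsub>MaxExcl\<^esub> h)"
    unfolding f' g' h' by (simp add: compose_assoc)
next
  fix f :: "('o, 'u) max_excl_arr"
  assume f: "f \<in> Arr MaxExcl"
  obtain T s Fo Fh Fv Fs T' s' where f': "f = ((T, s), (Fo, Fh, Fv, Fs), (T', s'))" by (metis prod.exhaust)
  show "Dom MaxExcl f \<in> Obj MaxExcl" "Cod MaxExcl f \<in> Obj MaxExcl"
    using f unfolding f' by (simp_all del: is_max_excl.simps is_max_excl_map.simps)
  interpret T: double_category T using f is_max_excl_double_category unfolding f' by fastforce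
  have "double_category T'" "double_functor T T' Fo Fh Fv Fs"
    using f by (auto simp: f' double_groupoid_def)
  note T.double_functor_Pi[OF this(2,1)]
  moreover have "Fo \<in> extensional (Obj (Hor T))" "Fh \<in> extensional (Arr (Hor T))"
    "Fv \<in> extensional (Arr (Ver T))" "Fs \<in> extensional (Sqr T)"
    using f by (auto simp: f')
  ultimately show "Ide MaxExcl (Dom MaxExcl f) \<cdot>\<^bsub>MaxExcl\<^esub> f = f"
    "f \<cdot>\<^bsub>MaxExcl\<^esub> Ide MaxExcl (Cod MaxExcl f) = f"
    unfolding f' by (simp_all add: compose_Id Id_compose)
next
  fix X :: "('o, 'u) max_excl"
  assume X: "X \<in> Obj MaxExcl"
  obtain T s where X': "X = (T, s)" by (cases X)
  show "Dom MaxExcl (Ide MaxExcl X) = X" "Cod MaxExcl (Ide MaxExcl X) = X"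
    by simp_all
  interpret T: double_category T using X is_max_excl_double_category unfolding X' by fastforce
  have "s (proj_frame T X) \<in> Sqr T" if "X \<in> Sqr T" for X
    using T.is_sectionD(1) X that by (force simp: proj_frame_def X')
  then have "is_max_excl_map X (max_excl_id X) X"
    using T.double_functor_restrict_id unfolding X' max_excl_id.simps is_max_excl_map_iff[OF T.double_category_axioms] by auto
  then show "Ide MaxExcl X \<in> Arr MaxExcl"
    using X by simp
qed

section \<open>The functor \<open>\<Gamma>\<close>\<close>

text \<open>Boundary of a composite square of \<open>\<Gamma>\<close>. Horizontal composition uses
  it as stated; vertical composition uses it reversed, with the roles of \<open>H\<close> and
  \<open>K\<close> exchanged.\<close>

lemma (in category) paste_squares:
  assumes "f \<cdot> l = k \<cdot> g" "f' \<cdot> m = l \<cdot> g'"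
    "f \<in> Arr C" "f' \<in> Arr C" "g \<in> Arr C" "g' \<in> Arr C" "k \<in> Arr C" "l \<in> Arr C" "m \<in> Arr C"
    "Cod C f = Dom C l" "Cod C k = Dom C g" "Cod C f' = Dom C m" "Cod C l = Dom C g'"
    "Cod C f = Dom C f'" "Cod C g = Dom C g'"
  shows "(f \<cdot> f') \<cdot> m = k \<cdot> (g \<cdot> g')"
proof -
  have "(f \<cdot> f') \<cdot> m = (f \<cdot> l) \<cdot> g'"
    using assms(2-) by (simp add: Cmp_assoc)
  then show ?thesis
    using assms by (simp add: Cmp_assoc)
qed

text \<open>Boundary of an inverse square of \<open>\<Gamma>\<close>. The same rearrangement later
  compares two factorisations of one arrow by bringing like factors to the same side.\<close>

lemma (in groupoid) flip_square:
  assumes "f \<cdot> l = k \<cdot> g" "f \<in> Arr C" "g \<in> Arr C" "k \<in> Arr C" "l \<in> Arr C"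
    "Cod C f = Dom C l" "Cod C k = Dom C g"
  shows "inverse_arr C f \<cdot> k = l \<cdot> inverse_arr C g"
proof -
  have *: "Dom C f = Dom C k" "Cod C l = Cod C g"
    using assms by (metis Dom_Cmp) (metis assms Cod_Cmp)
  have "inverse_arr C f \<cdot> k = inverse_arr C f \<cdot> (k \<cdot> g) \<cdot> inverse_arr C g"
    using assms(2-) * by (simp add: grp_simps)
  also have "\<dots> = l \<cdot> inverse_arr C g"
    unfolding assms(1)[symmetric] using assms(2-) * by (simp add: grp_simps)
  finally show ?thesis .
qed

context groupoid
begin

lemma conj_simps:
  assumes "f \<in> Arr C" "a \<in> Arr C" "Cod C f = Dom C a" "Cod C a = Dom C a"
  shows "conj_arr C f a \<in> Arr C" "Dom C (conj_arr C f a) = Dom C f" "Cod C (conj_arr C f a) = Dom C f"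
  using assms by (simp_all add: conj_arr_def grp_simps)

lemma conj_Ide_left: "\<lbrakk>a \<in> Arr C; Dom C a = x; Cod C a = x\<rbrakk> \<Longrightarrow> conj_arr C (Ide C x) a = a"
  using Dom_in[of a] by (auto simp add: conj_arr_def grp_simps)

lemma conj_Ide_right: "\<lbrakk>f \<in> Arr C; Cod C f = x\<rbrakk> \<Longrightarrow> conj_arr C f (Ide C x) = Ide C (Dom C f)"
  using Cod_in[of f] by (auto simp add: conj_arr_def grp_simps)

lemma conj_inverse:
  assumes "f \<in> Arr C" "a \<in> Arr C" "Cod C a = Dom C a" "Dom C f = Dom C a"
  shows "conj_arr C f (conj_arr C (inverse_arr C f) a) = a"
  using assms by (simp add: conj_arr_def grp_simps)

end

section \<open>Quadruples and the conjugation action on the bundle\<close>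

lemma (in groupoid) category_subgroupoid:
  assumes "subgroupoid H C"
  shows "category (C\<lparr>Arr := H\<rparr>)"
proof
qed (use assms in \<open>auto simp: subgroupoid_def identities_def subset_iff cat_simps Cmp_assoc\<close>)

locale quadruple =
  fixes G :: "('o, 'u) cat" (structure) and H K A
  assumes quad: "is_quad (G, H, K, A)"

sublocale quadruple \<subseteq> groupoid G
  using quad by simp

context quadruple
begin

lemma subgroupoid_H: "subgroupoid H G" and subgroupoid_K: "subgroupoid K G"
  using quad by auto

lemma H_simps:
  "h \<in> H \<Longrightarrow> h \<in> Arr G" "x \<in> Obj G \<Longrightarrow> Ide G x \<in> H" "h \<in> H \<Longrightarrow> inverse_arr G h \<in> H"
  "\<lbrakk>h \<in> H; h' \<in> H; Cod G h = Dom G h'\<rbrakk> \<Longrightarrow> h \<cdot> h' \<in> H"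
  using subgroupoid_H by (auto simp: subgroupoid_def identities_def)

lemma K_simps:
  "k \<in> K \<Longrightarrow> k \<in> Arr G" "x \<in> Obj G \<Longrightarrow> Ide G x \<in> K" "k \<in> K \<Longrightarrow> inverse_arr G k \<in> K"
  "\<lbrakk>k \<in> K; k' \<in> K; Cod G k = Dom G k'\<rbrakk> \<Longrightarrow> k \<cdot> k' \<in> K"
  using subgroupoid_K by (auto simp: subgroupoid_def identities_def)

text \<open>The elements of \<open>A\<close> are loops, so composability inside \<open>A\<close> is
  expressed by equal domains throughout.\<close>

lemma A_simps:
  "a \<in> A \<Longrightarrow> a \<in> Arr G" "x \<in> Obj G \<Longrightarrow> Ide G x \<in> A" "a \<in> A \<Longrightarrow> inverse_arr G a \<in> A"
  "\<lbrakk>a \<in> A; a' \<in> A; Dom G a = Dom G a'\<rbrakk> \<Longrightarrow> a \<cdot> a' \<in> A"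
  "a \<in> A \<Longrightarrow> Cod G a = Dom G a"
  "\<lbrakk>h \<in> H; a \<in> A; Cod G h = Dom G a\<rbrakk> \<Longrightarrow> conj_arr G h a \<in> A"
  "\<lbrakk>k \<in> K; a \<in> A; Cod G k = Dom G a\<rbrakk> \<Longrightarrow> conj_arr G k a \<in> A"
  using quad by (auto simp: abelian_subgroupoid_def subgroupoid_def identities_def)

lemma A_commute: "\<lbrakk>a \<in> A; a' \<in> A; Dom G a = Dom G a'\<rbrakk> \<Longrightarrow> a \<cdot> a' = a' \<cdot> a"
  using quad by (auto simp: abelian_subgroupoid_def)

lemma H_Int_K: "f \<in> H \<Longrightarrow> f \<in> K \<Longrightarrow> f \<in> identities G"
  using quad by (auto simp: discrete_def)

lemma HK_KH: "set_cmp G H K = set_cmp G K H"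
  using quad by simp

lemma conj_Cmp_right:
  assumes "f \<in> Arr G" "a \<in> A" "b \<in> A" "Cod G f = Dom G a" "Cod G f = Dom G b"
  shows "conj_arr G f (a \<cdot> b) = conj_arr G f a \<cdot> conj_arr G f b"
  using assms by (simp add: conj_arr_def grp_simps A_simps)

lemma conj_Cmp_left:
  assumes "f \<in> Arr G" "g \<in> Arr G" "Cod G f = Dom G g" "a \<in> A" "Cod G g = Dom G a"
  shows "conj_arr G (f \<cdot> g) a = conj_arr G f (conj_arr G g a)"
  using assms by (simp add: conj_arr_def grp_simps A_simps)

end

section \<open>The double groupoid of a quadruple\<close>

locale gamma = quadruple G H K A
  for G :: "('o, 'u) cat" (structure) and H K A +
  fixes pr :: "'u \<times> 'u \<Rightarrow> 'u"
  assumes inj_pr: "inj pr"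
begin

abbreviation \<Gamma> :: "('o, 'u, 'u, 'u) dcat" where "\<Gamma> \<equiv> Gamma_dcat pr (G, H, K, A)"
abbreviation sq :: "'u \<Rightarrow> 'u \<Rightarrow> 'u \<Rightarrow> 'u \<Rightarrow> 'u \<Rightarrow> 'u" where "sq h k' k h' a \<equiv> sq5 pr (h, k', k, h', a)"

abbreviation squares :: "'u set" where "squares \<equiv> Gamma_squares pr (G, H, K, A)"
abbreviation sctn :: "'u set \<Rightarrow> 'u" where "sctn \<equiv> Gamma_section pr (G, H, K, A)"

lemma inj_sq5: "inj (sq5 pr)"
  using inj_pr by (auto intro!: injI simp: inj_eq)

lemma unsq5_sq5 [simp]: "unsq5 pr (sq5 pr x) = x"
  by (simp add: unsq5_def inj_sq5)

lemma sq_eq_iff [simp]: "sq5 pr x = sq5 pr y \<longleftrightarrow> x = y"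
  using inj_sq5 by (simp add: inj_eq)

declare sq5.simps [simp del]

lemma Gamma_sel:
  "Hor \<Gamma> = G\<lparr>Arr := H\<rparr>" "Ver \<Gamma> = G\<lparr>Arr := K\<rparr>" "Obj (HSq \<Gamma>) = K" "Obj (VSq \<Gamma>) = H"
  "Sqr \<Gamma> = squares" "Arr (VSq \<Gamma>) = squares"
  "sLeft \<Gamma> (sq h k' k h' a) = k" "sRight \<Gamma> (sq h k' k h' a) = k'"
  "sTop \<Gamma> (sq h k' k h' a) = h" "sBot \<Gamma> (sq h k' k h' a) = h'"
  "Ide (HSq \<Gamma>) k = sq (Ide G (Dom G k)) k k (Ide G (Cod G k)) (Ide G (Dom G k))"
  "Ide (VSq \<Gamma>) h = sq h (Ide G (Cod G h)) (Ide G (Dom G h)) h (Ide G (Dom G h))"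
  "sq h k' k h' a \<cdot>\<^bsub>HSq \<Gamma>\<^esub> sq g l' l g' b = sq (h \<cdot> g) l' k (h' \<cdot> g') (a \<cdot> conj_arr G h b)"
  "sq h k' k h' a \<cdot>\<^bsub>VSq \<Gamma>\<^esub> sq g l' l g' b = sq h (k' \<cdot> l') (k \<cdot> l) g' (a \<cdot> conj_arr G k b)"
  by simp_all

lemma sq_mem_iff:
  "sq h k' k h' a \<in> squares \<longleftrightarrow>
    h \<in> H \<and> k' \<in> K \<and> k \<in> K \<and> h' \<in> H \<and> a \<in> A \<and>
    Cod G h = Dom G k' \<and> Cod G k = Dom G h' \<and> h \<cdot> k' = k \<cdot> h' \<and> Dom G a = Dom G h"
  by auto

text \<open>The two corner equations that \<open>Gamma_squares\<close> does not list come from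
  comparing domains and codomains in \<open>hk' = kh'\<close>.\<close>

lemma Gamma_squares_cases:
  assumes "X \<in> squares"
  obtains h k' k h' a where "X = sq h k' k h' a" "h \<in> H" "k' \<in> K" "k \<in> K" "h' \<in> H" "a \<in> A"
    "Cod G h = Dom G k'" "Cod G k = Dom G h'" "h \<cdot> k' = k \<cdot> h'" "Dom G a = Dom G h"
    "Dom G k = Dom G h" "Cod G k' = Cod G h'"
proof -
  obtain h k' k h' a where *: "X = sq h k' k h' a" "h \<in> H" "k' \<in> K" "k \<in> K" "h' \<in> H" "a \<in> A"
    "Cod G h = Dom G k'" "Cod G k = Dom G h'" "h \<cdot> k' = k \<cdot> h'" "Dom G a = Dom G h"
    using assms by auto
  then have "Dom G k = Dom G h" "Cod G k' = Cod G h'"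
    using Dom_Cmp[of h k'] Dom_Cmp[of k h'] Cod_Cmp[of h k'] Cod_Cmp[of k h']
    by (simp_all add: H_simps K_simps)
  with * that show thesis by blast
qed

declare Gamma_dcat.simps [simp del] Gamma_squares.simps [simp del]

lemmas quad_simps = H_simps K_simps A_simps grp_simps conj_simps conj_Ide_left conj_Ide_right
  conj_Cmp_right conj_Cmp_left

text \<open>In the bundle coordinate associativity is that of a semi-direct product: conjugation is
  multiplicative on \<open>A\<close>, and conjugation by a composite is iterated
  conjugation.\<close>

lemma category_HSq_Gamma: "category (HSq \<Gamma>)"
proof
  show "(X \<cdot>\<^bsub>HSq \<Gamma>\<^esub> Y) \<cdot>\<^bsub>HSq \<Gamma>\<^esub> Z = X \<cdot>\<^bsub>HSq \<Gamma>\<^esub> (Y \<cdot>\<^bsub>HSq \<Gamma>\<^esub> Z)"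
    if "X \<in> Sqr \<Gamma>" "Y \<in> Sqr \<Gamma>" "Z \<in> Sqr \<Gamma>" "sRight \<Gamma> X = sLeft \<Gamma> Y" "sRight \<Gamma> Y = sLeft \<Gamma> Z" for X Y Z
    using that by (auto elim!: Gamma_squares_cases simp: Gamma_sel quad_simps)
  show "X \<cdot>\<^bsub>HSq \<Gamma>\<^esub> Y \<in> Sqr \<Gamma>" if "X \<in> Sqr \<Gamma>" "Y \<in> Sqr \<Gamma>" "sRight \<Gamma> X = sLeft \<Gamma> Y" for X Y
    using that by (auto elim!: Gamma_squares_cases simp: Gamma_sel sq_mem_iff H_simps K_simps A_simps
        conj_simps Dom_Cmp Cod_Cmp intro!: paste_squares)
qed (auto elim!: Gamma_squares_cases simp: Gamma_sel sq_mem_iff quad_simps)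

lemma category_VSq_Gamma: "category (VSq \<Gamma>)"
proof
  show "(X \<cdot>\<^bsub>VSq \<Gamma>\<^esub> Y) \<cdot>\<^bsub>VSq \<Gamma>\<^esub> Z = X \<cdot>\<^bsub>VSq \<Gamma>\<^esub> (Y \<cdot>\<^bsub>VSq \<Gamma>\<^esub> Z)"
    if "X \<in> Arr (VSq \<Gamma>)" "Y \<in> Arr (VSq \<Gamma>)" "Z \<in> Arr (VSq \<Gamma>)" "sBot \<Gamma> X = sTop \<Gamma> Y" "sBot \<Gamma> Y = sTop \<Gamma> Z" for X Y Z
    using that by (auto elim!: Gamma_squares_cases simp: Gamma_sel quad_simps)
  show "X \<cdot>\<^bsub>VSq \<Gamma>\<^esub> Y \<in> Arr (VSq \<Gamma>)" if "X \<in> Arr (VSq \<Gamma>)" "Y \<in> Arr (VSq \<Gamma>)" "sBot \<Gamma> X = sTop \<Gamma> Y" for X Y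
    using that by (auto elim!: Gamma_squares_cases simp: Gamma_sel sq_mem_iff H_simps K_simps A_simps
        conj_simps Dom_Cmp Cod_Cmp intro!: paste_squares[symmetric])
qed (auto elim!: Gamma_squares_cases simp: Gamma_sel sq_mem_iff quad_simps)

lemma double_category_Gamma: "double_category \<Gamma>"
proof (rule double_category.intro)
  show "category (Hor \<Gamma>)" "category (Ver \<Gamma>)"
    by (simp_all add: Gamma_sel category_subgroupoid subgroupoid_H subgroupoid_K)
  show "category (HSq \<Gamma>)" "category (VSq \<Gamma>)"
    by (rule category_HSq_Gamma category_VSq_Gamma)+
  show "(X \<cdot>\<^bsub>HSq \<Gamma>\<^esub> Y) \<cdot>\<^bsub>VSq \<Gamma>\<^esub> (Z \<cdot>\<^bsub>HSq \<Gamma>\<^esub> W) = (X \<cdot>\<^bsub>VSq \<Gamma>\<^esub> Z) \<cdot>\<^bsub>HSq \<Gamma>\<^esub> (Y \<cdot>\<^bsub>VSq \<Gamma>\<^esub> W)"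
    if "X \<in> Sqr \<Gamma>" "Y \<in> Sqr \<Gamma>" "Z \<in> Sqr \<Gamma>" "W \<in> Sqr \<Gamma>" "sRight \<Gamma> X = sLeft \<Gamma> Y"
      "sRight \<Gamma> Z = sLeft \<Gamma> W" "sBot \<Gamma> X = sTop \<Gamma> Z" "sBot \<Gamma> Y = sTop \<Gamma> W" for X Y Z W
  proof -
    obtain h k' k h' a where X: "X = sq h k' k h' a" "h \<in> H" "k' \<in> K" "k \<in> K" "h' \<in> H" "a \<in> A"
      "Cod G h = Dom G k'" "Cod G k = Dom G h'" "h \<cdot> k' = k \<cdot> h'" "Dom G a = Dom G h"
      "Dom G k = Dom G h" "Cod G k' = Cod G h'"
      using \<open>X \<in> Sqr \<Gamma>\<close> unfolding Gamma_sel by (rule Gamma_squares_cases)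
    obtain g l' g' b where Y: "Y = sq g l' k' g' b" "g \<in> H" "l' \<in> K" "g' \<in> H" "b \<in> A"
      "Cod G g = Dom G l'" "Cod G k' = Dom G g'" "Dom G b = Dom G g" "Dom G k' = Dom G g" "Cod G l' = Cod G g'"
      using \<open>Y \<in> Sqr \<Gamma>\<close> \<open>sRight \<Gamma> X = sLeft \<Gamma> Y\<close> X(1) unfolding Gamma_sel
      by (auto elim!: Gamma_squares_cases simp: Gamma_sel)
    obtain m' m f' c where Z: "Z = sq h' m' m f' c" "m' \<in> K" "m \<in> K" "f' \<in> H" "c \<in> A"
      "Cod G h' = Dom G m'" "Cod G m = Dom G f'" "Dom G c = Dom G h'" "Dom G m = Dom G h'" "Cod G m' = Cod G f'"
      using \<open>Z \<in> Sqr \<Gamma>\<close> \<open>sBot \<Gamma> X = sTop \<Gamma> Z\<close> X(1) unfolding Gamma_sel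
      by (auto elim!: Gamma_squares_cases simp: Gamma_sel)
    obtain n' e' d where W: "W = sq g' n' m' e' d" "n' \<in> K" "e' \<in> H" "d \<in> A"
      "Cod G g' = Dom G n'" "Dom G d = Dom G g'" "Cod G n' = Cod G e'"
      using \<open>W \<in> Sqr \<Gamma>\<close> \<open>sRight \<Gamma> Z = sLeft \<Gamma> W\<close> \<open>sBot \<Gamma> Y = sTop \<Gamma> W\<close> Y(1) Z(1) unfolding Gamma_sel
      by (auto elim!: Gamma_squares_cases simp: Gamma_sel)
    \<comment> \<open>The bundle element of \<open>W\<close> reaches the top left corner along
      either path around \<open>X\<close>; the paths act alike because the boundary of
      \<open>X\<close> commutes.\<close>
    have D: "conj_arr G k (conj_arr G h' d) = conj_arr G h (conj_arr G k' d)"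
      using X Y Z W conj_Cmp_left[of k h' d] conj_Cmp_left[of h k' d] by (simp add: H_simps K_simps)
    have "(a \<cdot> conj_arr G h b) \<cdot> conj_arr G k (c \<cdot> conj_arr G h' d) =
        a \<cdot> ((conj_arr G h b \<cdot> conj_arr G k c) \<cdot> conj_arr G h (conj_arr G k' d))"
      using X Y Z W by (simp add: D[symmetric] quad_simps)
    \<comment> \<open>The elements of \<open>Y\<close> and \<open>Z\<close>, both transported to the
      top left corner of \<open>X\<close>, have to change places. This is where the interchange law
      requires \<open>A\<close> to be abelian.\<close>
    also have "conj_arr G h b \<cdot> conj_arr G k c = conj_arr G k c \<cdot> conj_arr G h b"
      using X Y Z by (intro A_commute) (simp_all add: quad_simps)
    also have "a \<cdot> ((conj_arr G k c \<cdot> conj_arr G h b) \<cdot> conj_arr G h (conj_arr G k' d)) =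
        (a \<cdot> conj_arr G k c) \<cdot> conj_arr G h (b \<cdot> conj_arr G k' d)"
      using X Y Z W by (simp add: quad_simps)
    finally show ?thesis
      by (simp add: X(1) Y(1) Z(1) W(1) Gamma_sel)
  qed
qed (auto elim!: Gamma_squares_cases simp: Gamma_sel quad_simps)

end

sublocale gamma \<subseteq> \<Gamma>: double_category \<Gamma>
  by (rule double_category_Gamma)

context gamma
begin

lemma double_groupoid_Gamma: "double_groupoid \<Gamma>"
proof
  fix X
  assume "X \<in> Sqr \<Gamma>"
  then obtain h k' k h' a where X: "X = sq h k' k h' a" "h \<in> H" "k' \<in> K" "k \<in> K" "h' \<in> H" "a \<in> A"
    "Cod G h = Dom G k'" "Cod G k = Dom G h'" "h \<cdot> k' = k \<cdot> h'" "Dom G a = Dom G h"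
    "Dom G k = Dom G h" "Cod G k' = Cod G h'"
    unfolding Gamma_sel by (rule Gamma_squares_cases)
  have c: "conj_arr G f (inverse_arr G a) \<cdot> conj_arr G f a = Ide G (Dom G f)"
    if "f \<in> Arr G" "Cod G f = Dom G h" for f
    using that X by (simp add: conj_Cmp_right[symmetric] quad_simps)
  have d: "a \<cdot> conj_arr G f (conj_arr G (inverse_arr G f) (inverse_arr G a)) = Ide G (Dom G a)"
    if "f \<in> Arr G" "Dom G f = Dom G h" for f
    using that X by (simp add: conj_inverse quad_simps)
  have "inverse_arr G h \<cdot> k = k' \<cdot> inverse_arr G h'"
    using X by (intro flip_square) (simp_all add: H_simps K_simps)
  \<comment> \<open>A bundle element lies over the top left corner, and the top left corner of the
    inverse square is the old top right one. Hence the inverse of \<open>a\<close> is carried along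
    \<open>h\<close>, becoming \<open>h\<^sup>-\<^sup>1 a\<^sup>-\<^sup>1 h\<close>.\<close>
  then have "is_inverse (HSq \<Gamma>) X (sq (inverse_arr G h) k k' (inverse_arr G h') (conj_arr G (inverse_arr G h) (inverse_arr G a)))"
    using X c[of "inverse_arr G h"] d[of h] by (simp add: is_inverse_def Gamma_sel sq_mem_iff quad_simps)
  then show "isomorphism (HSq \<Gamma>) X"
    unfolding isomorphism_def by blast
  have "inverse_arr G k \<cdot> h = h' \<cdot> inverse_arr G k'"
    using X by (intro flip_square) (simp_all add: H_simps K_simps)
  then have "is_inverse (VSq \<Gamma>) X (sq h' (inverse_arr G k') (inverse_arr G k) h (conj_arr G (inverse_arr G k) (inverse_arr G a)))"
    using X c[of "inverse_arr G k"] d[of k] by (simp add: is_inverse_def Gamma_sel sq_mem_iff quad_simps)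
  then show "isomorphism (VSq \<Gamma>) X"
    unfolding isomorphism_def by blast
qed

text \<open>By \<open>HK = KH\<close> the product of \<open>k'\<close> with the inverse of
  \<open>h'\<close> can be rewritten as \<open>h k\<close> with the factors in the other order.
  Solving for the boundary, the inverse of \<open>h\<close> becomes the top and \<open>k\<close> the
  left side.\<close>

lemma maximal_Gamma: "maximal \<Gamma>"
  unfolding maximal_def
proof (intro ballI impI)
  fix k' h'
  assume "k' \<in> Arr (Ver \<Gamma>)" "h' \<in> Arr (Hor \<Gamma>)" "Cod (Ver \<Gamma>) k' = Cod (Hor \<Gamma>) h'"
  then have k': "k' \<in> K" and h': "h' \<in> H" and eq: "Cod G k' = Cod G h'"
    by (simp_all add: Gamma_sel)
  have "k' \<cdot> inverse_arr G h' \<in> set_cmp G K H"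
    unfolding set_cmp_def using k' h' eq
    by (intro CollectI exI[of _ k'] exI[of _ "inverse_arr G h'"]) (simp add: quad_simps)
  then obtain h k where hk: "k' \<cdot> inverse_arr G h' = h \<cdot> k" "h \<in> H" "k \<in> K" "Cod G h = Dom G k"
    unfolding HK_KH[symmetric] by (auto simp: set_cmp_def)
  have D: "Dom G k' = Dom G h" "Cod G k = Dom G h'"
    using arg_cong[OF hk(1), of "Dom G"] arg_cong[OF hk(1), of "Cod G"] hk(2-) k' h' eq
    by (simp_all add: quad_simps)
  have "inverse_arr G h \<cdot> k' = k \<cdot> inverse_arr G (inverse_arr G h')"
    using hk k' h' eq by (intro flip_square) (simp_all add: quad_simps)
  then have "sq (inverse_arr G h) k' k h' (Ide G (Cod G h)) \<in> Sqr \<Gamma>"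
    using hk(2-) k' h' D by (simp add: Gamma_sel sq_mem_iff quad_simps)
  then show "\<exists>X\<in>Sqr \<Gamma>. sRight \<Gamma> X = k' \<and> sBot \<Gamma> X = h'"
    by (rule rev_bexI) (simp add: Gamma_sel)
qed

text \<open>If the right and bottom sides are identities, the equation \<open>hk' = kh'\<close>
  becomes \<open>h = k\<close>, an element of the discrete intersection
  \<open>H \<inter> K\<close>.\<close>

lemma exclusive_Gamma: "exclusive \<Gamma>"
proof -
  have i: "identities (G\<lparr>Arr := S\<rparr>) = identities G" for S
    by (simp add: identities_def)
  have "X \<in> core_bundle \<Gamma>" if "X \<in> core_groupoid \<Gamma>" for X
  proof -
    have "X \<in> Sqr \<Gamma>" using that by (simp add: core_groupoid_def)
    then obtain h k' k h' a where X: "X = sq h k' k h' a" "h \<in> H" "k' \<in> K" "k \<in> K" "h' \<in> H"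
      "Cod G h = Dom G k'" "Cod G k = Dom G h'" "h \<cdot> k' = k \<cdot> h'"
      unfolding Gamma_sel by (rule Gamma_squares_cases)
    have "k' \<in> identities G" "h' \<in> identities G"
      using that X(1) by (auto simp: core_groupoid_def i Gamma_sel)
    then have "h \<cdot> k' = h" "k \<cdot> h' = k"
      using X by (auto simp: identities_def quad_simps)
    then have "h = k" using X by simp
    then have "h \<in> identities G" using X H_Int_K by simp
    with \<open>h = k\<close> show ?thesis
      using that X(1) by (simp add: core_bundle_def core_groupoid_def i Gamma_sel)
  qed
  then show ?thesis
    by (auto simp: exclusive_def core_bundle_def core_groupoid_def)
qed

lemma Gamma_section_proj_frame:
  assumes "sq h k' k h' a \<in> Sqr \<Gamma>"
  shows "sctn (proj_frame \<Gamma> (sq h k' k h' a)) = sq h k' k h' (Ide G (Dom G h))"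
  by (simp add: \<Gamma>.frame_sides[OF assms] Gamma_sel)

declare Gamma_section.simps [simp del]

text \<open>Conjugates and products of identities are identities, so squares with trivial bundle
  element are closed under both compositions. This makes the choice of squares a double
  functor.\<close>

lemma is_section_Gamma: "is_section \<Gamma> (sctn)"
proof (rule \<Gamma>.is_sectionI)
  show "sctn (proj_frame \<Gamma> X) \<in> proj_frame \<Gamma> X" if "X \<in> Sqr \<Gamma>" for X
  proof -
    obtain h k' k h' a where X: "X = sq h k' k h' a" using \<open>X \<in> Sqr \<Gamma>\<close> by (auto simp: Gamma_sel elim: Gamma_squares_cases)
    then show ?thesis
      using that unfolding X Gamma_section_proj_frame[OF that[unfolded X]]
      by (simp add: proj_frame_def sq_mem_iff Gamma_sel quad_simps)
  qed
  show "sctn (proj_frame \<Gamma> (Ide (HSq \<Gamma>) k)) = Ide (HSq \<Gamma>) k" if "k \<in> Arr (Ver \<Gamma>)" for k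
    using that \<Gamma>.hid_simps(1)[OF that] by (simp add: Gamma_sel(11) Gamma_section_proj_frame) (simp add: Gamma_sel quad_simps)
  show "sctn (proj_frame \<Gamma> (Ide (VSq \<Gamma>) h)) = Ide (VSq \<Gamma>) h" if "h \<in> Arr (Hor \<Gamma>)" for h
    using that \<Gamma>.vid_simps(1)[OF that] by (simp add: Gamma_sel(12) Gamma_section_proj_frame)
  show "sctn (proj_frame \<Gamma> (X \<cdot>\<^bsub>HSq \<Gamma>\<^esub> Y)) =
      sctn (proj_frame \<Gamma> X) \<cdot>\<^bsub>HSq \<Gamma>\<^esub> sctn (proj_frame \<Gamma> Y)"
    if "X \<in> Sqr \<Gamma>" "Y \<in> Sqr \<Gamma>" "sRight \<Gamma> X = sLeft \<Gamma> Y" for X Y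
  proof -
    obtain h k' k h' a where X: "X = sq h k' k h' a" "h \<in> H" "k' \<in> K" "Cod G h = Dom G k'"
      using \<open>X \<in> Sqr \<Gamma>\<close> unfolding Gamma_sel by (elim Gamma_squares_cases) blast
    obtain g l' l g' b where Y: "Y = sq g l' l g' b" "g \<in> H" "Dom G l = Dom G g"
      using \<open>Y \<in> Sqr \<Gamma>\<close> unfolding Gamma_sel by (elim Gamma_squares_cases) blast
    note XY = \<Gamma>.hcomp_simps(1)[OF that]
    show ?thesis
      using that(3) X Y
        Gamma_section_proj_frame[OF that(1)[unfolded X(1)]] Gamma_section_proj_frame[OF that(2)[unfolded Y(1)]]
        Gamma_section_proj_frame[OF XY[unfolded X(1) Y(1) Gamma_sel(13)]]
      by (simp add: Gamma_sel quad_simps)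
  qed
  show "sctn (proj_frame \<Gamma> (X \<cdot>\<^bsub>VSq \<Gamma>\<^esub> Y)) =
      sctn (proj_frame \<Gamma> X) \<cdot>\<^bsub>VSq \<Gamma>\<^esub> sctn (proj_frame \<Gamma> Y)"
    if "X \<in> Sqr \<Gamma>" "Y \<in> Sqr \<Gamma>" "sBot \<Gamma> X = sTop \<Gamma> Y" for X Y
  proof -
    obtain h k' k h' a where X: "X = sq h k' k h' a" "h \<in> H" "k \<in> K" "h' \<in> H" "Cod G k = Dom G h'" "Dom G k = Dom G h"
      using \<open>X \<in> Sqr \<Gamma>\<close> unfolding Gamma_sel by (elim Gamma_squares_cases) blast
    obtain g l' l g' b where Y: "Y = sq g l' l g' b" "g \<in> H" "Dom G l = Dom G g"
      using \<open>Y \<in> Sqr \<Gamma>\<close> unfolding Gamma_sel by (elim Gamma_squares_cases) blast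
    note XY = \<Gamma>.vcomp_simps(1)[OF that]
    show ?thesis
      using that(3) X Y
        Gamma_section_proj_frame[OF that(1)[unfolded X(1)]] Gamma_section_proj_frame[OF that(2)[unfolded Y(1)]]
        Gamma_section_proj_frame[OF XY[unfolded X(1) Y(1) Gamma_sel(14)]]
      by (simp add: Gamma_sel quad_simps)
  qed
qed

lemma is_max_excl_Gamma: "is_max_excl (Gamma_obj pr (G, H, K, A))"
  by (simp add: Gamma_obj_def double_groupoid_Gamma maximal_Gamma exclusive_Gamma is_section_Gamma)

end

section \<open>\<open>\<Gamma>\<close> on arrows and its functoriality\<close>

lemma is_functor_conj_arr:
  assumes "groupoid G" "groupoid G'" "is_functor G G' fo fa"
    "f \<in> Arr G" "a \<in> Arr G" "Cod G f = Dom G a" "Cod G a = Cod G f"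
  shows "fa (conj_arr G f a) = conj_arr G' (fa f) (fa a)"
proof -
  interpret G: groupoid G by fact
  interpret G': groupoid G' by fact
  show ?thesis
    using assms(4-) by (simp add: conj_arr_def functor_simps[OF assms(3)] G.cat_simps G.inv_in G.Dom_inv
        is_functor_inverse_arr[OF assms(1) G'.category_axioms assms(3)])
qed

locale gamma_map = X: gamma G H K A pr + Y: gamma G' H' K' A' pr
  for G :: "('o, 'u) cat" and H K A pr and G' :: "('o, 'u) cat" and H' K' A' +
  fixes fo fa
  assumes quad_map: "is_quad_map (G, H, K, A) (fo, fa) (G', H', K', A')"
begin

lemma functor_f: "is_functor G G' fo fa"
  using quad_map by simp

lemma f_mem: "h \<in> H \<Longrightarrow> fa h \<in> H'" "k \<in> K \<Longrightarrow> fa k \<in> K'" "a \<in> A \<Longrightarrow> fa a \<in> A'"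
  using quad_map by auto

lemmas f_simps = functor_simps[OF functor_f] f_mem

lemma f_conj: "\<lbrakk>f \<in> Arr G; a \<in> A; Cod G f = Dom G a\<rbrakk> \<Longrightarrow> fa (conj_arr G f a) = conj_arr G' (fa f) (fa a)"
  using is_functor_conj_arr[OF X.groupoid_axioms Y.groupoid_axioms functor_f] by (simp add: X.A_simps)

definition F_sq :: "'u \<Rightarrow> 'u" where
  "F_sq = (\<lambda>X\<in>Gamma_squares pr (G, H, K, A).
        case unsq5 pr X of (h, k', k, h', a) \<Rightarrow> sq5 pr (fa h, fa k', fa k, fa h', fa a))"

lemma Gamma_map_eq:
  "Gamma_map pr (G, H, K, A) (fo, fa) = (restrict fo (Obj G), restrict fa H, restrict fa K, F_sq)"
  by (simp add: F_sq_def)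

lemma F_sq: "X.sq h k' k h' a \<in> Gamma_squares pr (G, H, K, A) \<Longrightarrow>
    F_sq (X.sq h k' k h' a) = X.sq (fa h) (fa k') (fa k) (fa h') (fa a)"
  by (simp add: F_sq_def)

lemma F_sq_mem:
  assumes "X.sq h k' k h' a \<in> Gamma_squares pr (G, H, K, A)"
  shows "X.sq (fa h) (fa k') (fa k) (fa h') (fa a) \<in> Gamma_squares pr (G', H', K', A')"
proof -
  note * = assms[unfolded X.sq_mem_iff]
  have "fa (h \<cdot>\<^bsub>G\<^esub> k') = fa (k \<cdot>\<^bsub>G\<^esub> h')" using * by simp
  then have "fa h \<cdot>\<^bsub>G'\<^esub> fa k' = fa k \<cdot>\<^bsub>G'\<^esub> fa h'"
    using * is_functor_Cmp[OF functor_f, of h k'] is_functor_Cmp[OF functor_f, of k h']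
    by (simp add: X.H_simps X.K_simps)
  then show ?thesis
    using * by (simp add: Y.sq_mem_iff f_simps X.H_simps X.K_simps X.A_simps)
qed

text \<open>The sides are handled by functoriality of \<open>fa\<close>; in the bundle coordinate
  the point is that a functor of groupoids commutes with conjugation.\<close>

lemma double_functor_Gamma:
  "double_functor X.\<Gamma> Y.\<Gamma> (restrict fo (Obj G)) (restrict fa H) (restrict fa K) F_sq"
  unfolding double_functor_def
proof (intro conjI)
  show "is_functor (Hor X.\<Gamma>) (Hor Y.\<Gamma>) (restrict fo (Obj G)) (restrict fa H)"
    "is_functor (Ver X.\<Gamma>) (Ver Y.\<Gamma>) (restrict fo (Obj G)) (restrict fa K)"
    by (intro is_functorI; simp add: X.Gamma_sel Y.Gamma_sel f_simps X.H_simps X.K_simps X.cat_simps)+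
  show "is_functor (HSq X.\<Gamma>) (HSq Y.\<Gamma>) (restrict fa K) F_sq"
  proof (rule is_functorI)
    show "F_sq (P \<cdot>\<^bsub>HSq X.\<Gamma>\<^esub> Q) = F_sq P \<cdot>\<^bsub>HSq Y.\<Gamma>\<^esub> F_sq Q"
      if P: "P \<in> Sqr X.\<Gamma>" and Q: "Q \<in> Sqr X.\<Gamma>" and PQ: "sRight X.\<Gamma> P = sLeft X.\<Gamma> Q" for P Q
    proof -
      obtain h k' k h' a where P': "P = X.sq h k' k h' a" "h \<in> H" "k' \<in> K" "k \<in> K" "h' \<in> H" "a \<in> A"
        "Cod G h = Dom G k'" "Cod G k = Dom G h'" "Dom G a = Dom G h" "Dom G k = Dom G h" "Cod G k' = Cod G h'"
        using P unfolding X.Gamma_sel by (elim X.Gamma_squares_cases) blast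
      obtain g l' l g' b where Q': "Q = X.sq g l' l g' b" "g \<in> H" "l' \<in> K" "l \<in> K" "g' \<in> H" "b \<in> A"
        "Cod G g = Dom G l'" "Cod G l = Dom G g'" "Dom G b = Dom G g" "Dom G l = Dom G g" "Cod G l' = Cod G g'"
        using Q unfolding X.Gamma_sel by (elim X.Gamma_squares_cases) blast
      have n: "l = k'"
        using PQ by (simp add: P' Q' X.Gamma_sel)
      have M: "P \<cdot>\<^bsub>HSq X.\<Gamma>\<^esub> Q \<in> Gamma_squares pr (G, H, K, A)"
        using X.\<Gamma>.hcomp_simps(1)[OF _ _ PQ] P Q by (simp add: X.Gamma_sel)
      show ?thesis
        using P Q M F_sq[of h k' k h' a] F_sq[of g l' l g' b] P'(2-) Q'(2-) n
          F_sq[OF M[unfolded P'(1) Q'(1) X.Gamma_sel]]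
        by (simp add: P'(1) Q'(1) X.Gamma_sel Y.Gamma_sel f_simps f_conj X.H_simps X.K_simps X.A_simps X.conj_simps)
    qed
    show "F_sq (Ide (HSq X.\<Gamma>) k) = Ide (HSq Y.\<Gamma>) (restrict fa K k)" if "k \<in> Obj (HSq X.\<Gamma>)" for k
      using that X.\<Gamma>.hid_simps(1)[of k] by (simp add: X.Gamma_sel F_sq Y.Gamma_sel f_simps X.quad_simps)
  qed (auto elim!: X.Gamma_squares_cases simp: X.Gamma_sel Y.Gamma_sel F_sq F_sq_mem X.sq_mem_iff f_simps)
  show "is_functor (VSq X.\<Gamma>) (VSq Y.\<Gamma>) (restrict fa H) F_sq"
  proof (rule is_functorI)
    show "F_sq (P \<cdot>\<^bsub>VSq X.\<Gamma>\<^esub> Q) = F_sq P \<cdot>\<^bsub>VSq Y.\<Gamma>\<^esub> F_sq Q"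
      if P: "P \<in> Arr (VSq X.\<Gamma>)" and Q: "Q \<in> Arr (VSq X.\<Gamma>)" and PQ: "sBot X.\<Gamma> P = sTop X.\<Gamma> Q" for P Q
    proof -
      obtain h k' k h' a where P': "P = X.sq h k' k h' a" "h \<in> H" "k' \<in> K" "k \<in> K" "h' \<in> H" "a \<in> A"
        "Cod G h = Dom G k'" "Cod G k = Dom G h'" "Dom G a = Dom G h" "Dom G k = Dom G h" "Cod G k' = Cod G h'"
        using P unfolding X.Gamma_sel by (elim X.Gamma_squares_cases) blast
      obtain g l' l g' b where Q': "Q = X.sq g l' l g' b" "g \<in> H" "l' \<in> K" "l \<in> K" "g' \<in> H" "b \<in> A"
        "Cod G g = Dom G l'" "Cod G l = Dom G g'" "Dom G b = Dom G g" "Dom G l = Dom G g" "Cod G l' = Cod G g'"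
        using Q unfolding X.Gamma_sel by (elim X.Gamma_squares_cases) blast
      have n: "g = h'"
        using PQ by (simp add: P' Q' X.Gamma_sel)
      have M: "P \<cdot>\<^bsub>VSq X.\<Gamma>\<^esub> Q \<in> Gamma_squares pr (G, H, K, A)"
        using X.\<Gamma>.vcomp_simps(1)[OF _ _ PQ] P Q by (simp add: X.Gamma_sel)
      show ?thesis
        using P Q M F_sq[of h k' k h' a] F_sq[of g l' l g' b] P'(2-) Q'(2-) n
          F_sq[OF M[unfolded P'(1) Q'(1) X.Gamma_sel]]
        by (simp add: P'(1) Q'(1) X.Gamma_sel Y.Gamma_sel f_simps f_conj X.H_simps X.K_simps X.A_simps X.conj_simps)
    qed
    show "F_sq (Ide (VSq X.\<Gamma>) k) = Ide (VSq Y.\<Gamma>) (restrict fa H k)" if "k \<in> Obj (VSq X.\<Gamma>)" for k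
      using that X.\<Gamma>.vid_simps(1)[of k] by (simp add: X.Gamma_sel F_sq Y.Gamma_sel f_simps X.quad_simps)
  qed (auto elim!: X.Gamma_squares_cases simp: X.Gamma_sel Y.Gamma_sel F_sq F_sq_mem X.sq_mem_iff f_simps)
qed

lemma is_max_excl_map_Gamma:
  "is_max_excl_map (Gamma_obj pr (G, H, K, A)) (Gamma_map pr (G, H, K, A) (fo, fa)) (Gamma_obj pr (G', H', K', A'))"
  unfolding Gamma_obj_def Gamma_map_eq is_max_excl_map_iff[OF X.double_category_Gamma]
proof (intro conjI ballI)
  show "F_sq (Gamma_section pr (G, H, K, A) (proj_frame X.\<Gamma> P)) =
      Gamma_section pr (G', H', K', A') (proj_frame Y.\<Gamma> (F_sq P))" if "P \<in> Sqr X.\<Gamma>" for P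
  proof -
    obtain h k' k h' a where P: "P = X.sq h k' k h' a" "h \<in> H"
      using \<open>P \<in> Sqr X.\<Gamma>\<close> unfolding X.Gamma_sel by (elim X.Gamma_squares_cases) blast
    have P': "X.sq h k' k h' a \<in> Gamma_squares pr (G, H, K, A)"
      using that unfolding P X.Gamma_sel .
    then have "X.sq h k' k h' (Ide G (Dom G h)) \<in> Gamma_squares pr (G, H, K, A)"
      by (simp add: X.sq_mem_iff X.quad_simps)
    then show ?thesis
      using P P' F_sq_mem[OF P']
      by (simp add: X.Gamma_section_proj_frame Y.Gamma_section_proj_frame X.Gamma_sel Y.Gamma_sel F_sq
          f_simps X.H_simps X.Dom_in)
  qed
qed (simp_all add: double_functor_Gamma X.Gamma_sel, simp add: F_sq_def)

end

lemma is_functor_Gamma: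
  fixes pr :: "'u \<times> 'u \<Rightarrow> 'u"
  assumes "inj pr"
  shows "is_functor (TwoSemi :: (('o, 'u) quad, _) cat) MaxExcl (Gamma_obj pr) (Gamma_arr pr)"
proof (rule is_functorI)
  fix X :: "('o, 'u) quad"
  assume "X \<in> Obj TwoSemi"
  moreover obtain G H K A where X: "X = (G, H, K, A)" by (cases X)
  ultimately interpret gamma G H K A pr by unfold_locales (simp_all add: assms del: is_quad.simps)
  show "Gamma_obj pr X \<in> Obj MaxExcl"
    using is_max_excl_Gamma by (simp add: X)
  have "(\<lambda>X\<in>Gamma_squares pr (G, H, K, A). case unsq5 pr X of (h, k', k, h', a) \<Rightarrow>
      sq5 pr ((\<lambda>f\<in>Arr G. f) h, (\<lambda>f\<in>Arr G. f) k', (\<lambda>f\<in>Arr G. f) k, (\<lambda>f\<in>Arr G. f) h', (\<lambda>f\<in>Arr G. f) a)) =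
    (\<lambda>X\<in>Gamma_squares pr (G, H, K, A). X)"
    by (rule restrict_ext) (auto elim!: Gamma_squares_cases simp: H_simps K_simps A_simps)
  moreover have "restrict (\<lambda>f\<in>Arr G. f) H = (\<lambda>f\<in>H. f)" "restrict (\<lambda>f\<in>Arr G. f) K = (\<lambda>f\<in>K. f)"
    by (rule restrict_ext; simp add: H_simps K_simps)+
  ultimately show "Gamma_arr pr (Ide TwoSemi X) = Ide MaxExcl (Gamma_obj pr X)"
    by (simp add: X Gamma_obj_def Gamma_sel)
next
  fix f :: "('o, 'u) quad_arr"
  assume f: "f \<in> Arr TwoSemi"
  obtain G H K A fo fa G' H' K' A' where f': "f = ((G, H, K, A), (fo, fa), (G', H', K', A'))"
    by (metis prod.exhaust)
  interpret gamma_map G H K A pr G' H' K' A' fo fa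
    using f by unfold_locales (simp_all add: f' assms del: is_quad.simps is_quad_map.simps)
  show "Gamma_arr pr f \<in> Arr MaxExcl"
    using is_max_excl_map_Gamma X.is_max_excl_Gamma Y.is_max_excl_Gamma
    by (simp add: f' del: Gamma_map.simps is_max_excl_map.simps)
  show "Dom MaxExcl (Gamma_arr pr f) = Gamma_obj pr (Dom TwoSemi f)"
    "Cod MaxExcl (Gamma_arr pr f) = Gamma_obj pr (Cod TwoSemi f)"
    by (simp_all add: f')
  fix g :: "('o, 'u) quad_arr"
  assume g: "g \<in> Arr TwoSemi" and fg: "Cod TwoSemi f = Dom TwoSemi g"
  obtain eo ea G'' H'' K'' A'' where g': "g = ((G', H', K', A'), (eo, ea), (G'', H'', K'', A''))"
    using fg f' by (cases g) auto
  interpret g: gamma_map G' H' K' A' pr G'' H'' K'' A'' eo ea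
    using g by unfold_locales (simp_all add: g' assms del: is_quad.simps is_quad_map.simps)
  have fg: "is_quad_map (G, H, K, A) (compose (Obj G) eo fo, compose (Arr G) ea fa) (G'', H'', K'', A'')"
    using is_quad_map_compose[OF X.quad quad_map g.quad_map] .
  interpret fg: gamma_map G H K A pr G'' H'' K'' A'' "compose (Obj G) eo fo" "compose (Arr G) ea fa"
    by unfold_locales (rule fg)
  have "restrict (compose (Obj G) eo fo) (Obj G) = compose (Obj G) (restrict eo (Obj G')) (restrict fo (Obj G))"
    "restrict (compose (Arr G) ea fa) H = compose H (restrict ea H') (restrict fa H)"
    "restrict (compose (Arr G) ea fa) K = compose K (restrict ea K') (restrict fa K)"
    by (auto simp: fun_eq_iff compose_def restrict_def f_simps X.H_simps X.K_simps)
  moreover have "fg.F_sq = compose (Gamma_squares pr (G, H, K, A)) g.F_sq F_sq"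
  proof (rule extensionalityI)
    show "fg.F_sq P = compose (Gamma_squares pr (G, H, K, A)) g.F_sq F_sq P"
      if P: "P \<in> Gamma_squares pr (G, H, K, A)" for P
    proof -
      obtain h k' k h' a where P': "P = X.sq h k' k h' a" "h \<in> H" "k' \<in> K" "k \<in> K" "h' \<in> H" "a \<in> A"
        using P by (elim X.Gamma_squares_cases) blast
      show ?thesis
        using P F_sq_mem[of h k' k h' a] fg.F_sq[of h k' k h' a] g.F_sq[OF F_sq_mem[of h k' k h' a]]
          F_sq[of h k' k h' a] P'(2-)
        by (simp add: P'(1) compose_eq X.H_simps X.K_simps X.A_simps)
    qed
  qed (auto simp: fg.F_sq_def)
  ultimately show "Gamma_arr pr (f \<cdot>\<^bsub>TwoSemi\<^esub> g) = Gamma_arr pr f \<cdot>\<^bsub>MaxExcl\<^esub> Gamma_arr pr g"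
    by (simp add: f' g' Gamma_obj_def X.Gamma_sel Gamma_map_eq g.Gamma_map_eq fg.Gamma_map_eq del: Gamma_map.simps)
qed

section \<open>Corners in a maximal exclusive double groupoid\<close>

lemma (in groupoid) eq_if_Cmp_inv_identity:
  assumes "f \<in> Arr C" "g \<in> Arr C" "Cod C f = Cod C g" "f \<cdot> inverse_arr C g \<in> identities C"
  shows "f = g"
proof -
  obtain x where x: "x \<in> Obj C" "f \<cdot> inverse_arr C g = Ide C x"
    using assms(4) by (auto simp: identities_def)
  have "f = (f \<cdot> inverse_arr C g) \<cdot> g"
    using assms(1-3) by (simp add: grp_simps Ide_right')
  moreover have "x = Dom C g"
    using arg_cong[OF x(2), of "Cod C"] assms(1-3) x(1) by (simp add: grp_simps)
  ultimately show ?thesis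
    using assms x by (simp add: grp_simps)
qed

section \<open>Invertibility of arrows and the sides of inverse squares\<close>

context double_category
begin

text \<open>Packaging the boundary laws as four functors lets inverses be transported: each functor
  sends the inverse of a square to the inverse of its side.\<close>

lemma is_functor_sides:
  "is_functor (HSq T) (Hor T) (Dom (Ver T)) (sTop T)" "is_functor (HSq T) (Hor T) (Cod (Ver T)) (sBot T)"
  "is_functor (VSq T) (Ver T) (Dom (Hor T)) (sLeft T)" "is_functor (VSq T) (Ver T) (Cod (Hor T)) (sRight T)"
  by (intro is_functorI; simp add: Obj_HSq Obj_VSq Arr_VSq Ver.Dom_in Ver.Cod_in Hor.Dom_in Hor.Cod_in
      sides_in corner_simps hid_simps vid_simps hcomp_simps vcomp_simps flip: Obj_Ver;
      simp add: Obj_Ver Hor.Dom_in Hor.Cod_in)+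

end

context double_groupoid
begin

lemma groupoid_HSq: "groupoid (HSq T)" and groupoid_VSq: "groupoid (VSq T)"
  by (auto intro!: groupoidI simp: cat_HSq cat_VSq h_invertible v_invertible Arr_VSq)

text \<open>A double groupoid is only required to have invertible squares. An arrow \<open>h\<close>
  is the top side of the square \<open>vid h\<close>, so its inverse is the top side of the
  horizontal inverse of that square.\<close>

lemma groupoid_Hor: "groupoid (Hor T)"
proof (rule groupoidI)
  fix h assume h: "h \<in> Arr (Hor T)"
  obtain X where "is_inverse (HSq T) (Ide (VSq T) h) X"
    using h_invertible[of "Ide (VSq T) h"] vid_simps(1)[OF h] by (auto simp: isomorphism_def)
  from is_functor_isomorphism[OF cat_HSq cat_Hor is_functor_sides(1) this]
  show "isomorphism (Hor T) h"
    using h by (auto simp: isomorphism_def vid_simps)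
qed (rule cat_Hor)

lemma groupoid_Ver: "groupoid (Ver T)"
proof (rule groupoidI)
  fix v assume v: "v \<in> Arr (Ver T)"
  obtain X where "is_inverse (VSq T) (Ide (HSq T) v) X"
    using v_invertible[of "Ide (HSq T) v"] hid_simps(1)[OF v] by (auto simp: isomorphism_def)
  from is_functor_isomorphism[OF cat_VSq cat_Ver is_functor_sides(3) this]
  show "isomorphism (Ver T) v"
    using v by (auto simp: isomorphism_def hid_simps)
qed (rule cat_Ver)

end

sublocale double_groupoid \<subseteq> Hor: groupoid "Hor T" by (rule groupoid_Hor)
sublocale double_groupoid \<subseteq> Ver: groupoid "Ver T" by (rule groupoid_Ver)
sublocale double_groupoid \<subseteq> HSq: groupoid "HSq T" by (rule groupoid_HSq)
sublocale double_groupoid \<subseteq> VSq: groupoid "VSq T" by (rule groupoid_VSq)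

context double_groupoid
begin

lemma hinv_simps:
  assumes "X \<in> Sqr T"
  shows "inverse_arr (HSq T) X \<in> Sqr T"
    "sLeft T (inverse_arr (HSq T) X) = sRight T X" "sRight T (inverse_arr (HSq T) X) = sLeft T X"
    "sTop T (inverse_arr (HSq T) X) = inverse_arr (Hor T) (sTop T X)"
    "sBot T (inverse_arr (HSq T) X) = inverse_arr (Hor T) (sBot T X)"
  using assms is_functor_inverse_arr[OF groupoid_HSq cat_Hor is_functor_sides(1)]
    is_functor_inverse_arr[OF groupoid_HSq cat_Hor is_functor_sides(2)]
  by (auto simp: HSq.inv_in HSq.Dom_inv HSq.Cod_inv)

lemma vinv_simps:
  assumes "X \<in> Sqr T"
  shows "inverse_arr (VSq T) X \<in> Sqr T"
    "sTop T (inverse_arr (VSq T) X) = sBot T X" "sBot T (inverse_arr (VSq T) X) = sTop T X"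
    "sLeft T (inverse_arr (VSq T) X) = inverse_arr (Ver T) (sLeft T X)"
    "sRight T (inverse_arr (VSq T) X) = inverse_arr (Ver T) (sRight T X)"
  using assms is_functor_inverse_arr[OF groupoid_VSq cat_Ver is_functor_sides(3)]
    is_functor_inverse_arr[OF groupoid_VSq cat_Ver is_functor_sides(4)] VSq.inv_in[of X]
  by (auto simp: VSq.Dom_inv VSq.Cod_inv Arr_VSq)

end

locale max_excl_groupoid = double_groupoid T for T :: "('o, 'h, 'v, 's) dcat" +
  fixes s :: "'s set \<Rightarrow> 's"
  assumes maximal: "maximal T" and exclusive: "exclusive T" and is_section: "is_section T s"
begin

abbreviation hc (infixl "\<circ>\<^sub>h" 70) where "X \<circ>\<^sub>h Y \<equiv> X \<cdot>\<^bsub>HSq T\<^esub> Y"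
abbreviation vc (infixl "\<circ>\<^sub>v" 70) where "X \<circ>\<^sub>v Y \<equiv> X \<cdot>\<^bsub>VSq T\<^esub> Y"
abbreviation vid where "vid \<equiv> Ide (VSq T)"
abbreviation hid where "hid \<equiv> Ide (HSq T)"

text \<open>The quotient of two squares with the same right and bottom sides can be completed to a
  square of the core groupoid, which has to lie in the core bundle.\<close>

lemma right_bot_determine:
  assumes X: "X \<in> Sqr T" and Y: "Y \<in> Sqr T" and eq: "sRight T X = sRight T Y" "sBot T X = sBot T Y"
  shows "sLeft T X = sLeft T Y" "sTop T X = sTop T Y"
proof -
  define Z where "Z = (X \<circ>\<^sub>h inverse_arr (HSq T) Y) \<circ>\<^sub>v hid (inverse_arr (Ver T) (sLeft T Y))"
  have co: "Cod (Ver T) (sLeft T X) = Cod (Ver T) (sLeft T Y)"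
    using corner_simps(3)[OF X] corner_simps(3)[OF Y] eq by simp
  have co': "Cod (Hor T) (sTop T X) = Cod (Hor T) (sTop T Y)"
    using corner_simps(2)[OF X] corner_simps(2)[OF Y] eq by simp
  note S = X Y eq co co' hinv_simps hid_simps sides_in Hor.inv_in Hor.Dom_inv Hor.Cod_inv Hor.inv_right
    Ver.inv_in Ver.Dom_inv Ver.Cod_inv Ver.inv_right corner_simps[OF X] corner_simps[OF Y]
  have Z1: "X \<circ>\<^sub>h inverse_arr (HSq T) Y \<in> Sqr T"
    "sBot T (X \<circ>\<^sub>h inverse_arr (HSq T) Y) = Ide (Hor T) (Cod (Ver T) (sLeft T Y))"
    by (simp_all add: hcomp_simps S)
  have Z: "Z \<in> Sqr T" "sLeft T Z = sLeft T X \<cdot>\<^bsub>Ver T\<^esub> inverse_arr (Ver T) (sLeft T Y)"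
    "sTop T Z = sTop T X \<cdot>\<^bsub>Hor T\<^esub> inverse_arr (Hor T) (sTop T Y)"
    "sRight T Z = Ide (Ver T) (Dom (Ver T) (sLeft T Y))"
    "sBot T Z = Ide (Hor T) (Dom (Ver T) (sLeft T Y))"
    unfolding Z_def by (simp_all add: vcomp_simps hcomp_simps Z1 S)
  moreover have "Dom (Ver T) (sLeft T Y) \<in> Obj (Ver T)"
    using Y by (simp add: sides_in Ver.Dom_in)
  ultimately have "Z \<in> core_groupoid T"
    using Obj_Ver by (auto simp: core_groupoid_def identities_def)
  then have "Z \<in> core_bundle T"
    using exclusive by (simp add: exclusive_def)
  then have i: "sLeft T Z \<in> identities (Ver T)" "sTop T Z \<in> identities (Hor T)"
    by (auto simp: core_bundle_def)
  show "sLeft T X = sLeft T Y"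
    using i(1) Z(2) co by (intro Ver.eq_if_Cmp_inv_identity) (simp_all add: sides_in X Y)
  show "sTop T X = sTop T Y"
    using i(2) Z(3) co' by (intro Hor.eq_if_Cmp_inv_identity) (simp_all add: sides_in X Y)
qed

text \<open>Vertical inversion turns the top right corner into the bottom right one. Horizontal
  inversion does the same for the left bottom corner in the next lemma.\<close>

lemma top_right_determine:
  assumes X: "X \<in> Sqr T" and Y: "Y \<in> Sqr T" and eq: "sTop T X = sTop T Y" "sRight T X = sRight T Y"
  shows "sLeft T X = sLeft T Y" "sBot T X = sBot T Y"
  using right_bot_determine[of "inverse_arr (VSq T) X" "inverse_arr (VSq T) Y"] assms
  by (simp_all add: vinv_simps) (metis Ver.inv_inv sides_in(1))

lemma left_bot_determine:
  assumes X: "X \<in> Sqr T" and Y: "Y \<in> Sqr T" and eq: "sLeft T X = sLeft T Y" "sBot T X = sBot T Y"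
  shows "sRight T X = sRight T Y" "sTop T X = sTop T Y"
  using right_bot_determine[of "inverse_arr (HSq T) X" "inverse_arr (HSq T) Y"] assms
  by (simp_all add: hinv_simps) (metis Hor.inv_inv sides_in(3))

text \<open>Maximality fills the corner at right and bottom; inverting such a square horizontally
  moves the corner to the left.\<close>

lemma ex_left_bot:
  assumes "k \<in> Arr (Ver T)" "h \<in> Arr (Hor T)" "Cod (Ver T) k = Dom (Hor T) h"
  shows "\<exists>X\<in>Sqr T. sLeft T X = k \<and> sBot T X = h"
proof -
  obtain X where "X \<in> Sqr T" "sRight T X = k" "sBot T X = inverse_arr (Hor T) h"
    using assms maximal by (metis maximal_def Hor.inv_in Hor.Cod_inv)
  then show ?thesis
    using assms by (intro bexI[of _ "inverse_arr (HSq T) X"]) (simp_all add: hinv_simps Hor.inv_inv)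
qed

lemma ex_top_right:
  assumes "h \<in> Arr (Hor T)" "k \<in> Arr (Ver T)" "Cod (Hor T) h = Dom (Ver T) k"
  shows "\<exists>X\<in>Sqr T. sTop T X = h \<and> sRight T X = k"
proof -
  obtain X where "X \<in> Sqr T" "sBot T X = h" "sRight T X = inverse_arr (Ver T) k"
    using assms maximal by (metis maximal_def Ver.inv_in Ver.Cod_inv)
  then show ?thesis
    using assms by (intro bexI[of _ "inverse_arr (VSq T) X"]) (simp_all add: vinv_simps Ver.inv_inv)
qed

section \<open>Canonical squares and the filling of corners\<close>

definition sec :: "'s \<Rightarrow> 's" where
  "sec X = s (proj_frame T X)"

definition canonical :: "'s \<Rightarrow> bool" where
  "canonical X \<longleftrightarrow> X \<in> Sqr T \<and> sec X = X"

lemma sec_simps: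
  assumes "X \<in> Sqr T"
  shows "sec X \<in> Sqr T" "sLeft T (sec X) = sLeft T X" "sRight T (sec X) = sRight T X"
    "sTop T (sec X) = sTop T X" "sBot T (sec X) = sBot T X"
  using is_sectionD(1)[OF is_section assms] by (auto simp: sec_def proj_frame_def)

lemma sec_eqI:
  assumes "X \<in> Sqr T" "sLeft T X = sLeft T Y" "sRight T X = sRight T Y" "sTop T X = sTop T Y" "sBot T X = sBot T Y"
  shows "sec X = sec Y"
  using assms proj_frame_eq_iff[of X Y] by (simp add: sec_def)

lemma canonicalD: "canonical X \<Longrightarrow> X \<in> Sqr T" "canonical X \<Longrightarrow> sec X = X"
  by (simp_all add: canonical_def)

lemma canonical_sec: "X \<in> Sqr T \<Longrightarrow> canonical (sec X)"
  using sec_eqI[of "sec X" X] by (simp add: canonical_def sec_simps)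

lemma sec_hcomp: "\<lbrakk>X \<in> Sqr T; Y \<in> Sqr T; sRight T X = sLeft T Y\<rbrakk> \<Longrightarrow> sec (X \<circ>\<^sub>h Y) = sec X \<circ>\<^sub>h sec Y"
  and sec_vcomp: "\<lbrakk>X \<in> Sqr T; Y \<in> Sqr T; sBot T X = sTop T Y\<rbrakk> \<Longrightarrow> sec (X \<circ>\<^sub>v Y) = sec X \<circ>\<^sub>v sec Y"
  and sec_hid: "v \<in> Arr (Ver T) \<Longrightarrow> sec (hid v) = hid v"
  and sec_vid: "h \<in> Arr (Hor T) \<Longrightarrow> sec (vid h) = vid h"
  using is_sectionD(2-5)[OF is_section] by (simp_all add: sec_def)

text \<open>Functoriality of the section in the form in which it is used: any pasting of canonical
  squares and identity squares is canonical.\<close>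

lemma canonical_intros:
  "v \<in> Arr (Ver T) \<Longrightarrow> canonical (hid v)" "h \<in> Arr (Hor T) \<Longrightarrow> canonical (vid h)"
  "\<lbrakk>canonical X; canonical Y; sRight T X = sLeft T Y\<rbrakk> \<Longrightarrow> canonical (X \<circ>\<^sub>h Y)"
  "\<lbrakk>canonical X; canonical Y; sBot T X = sTop T Y\<rbrakk> \<Longrightarrow> canonical (X \<circ>\<^sub>v Y)"
  by (simp_all add: canonical_def sec_hid sec_vid hid_simps vid_simps sec_hcomp sec_vcomp hcomp_simps vcomp_simps)

lemma canonical_left_bot_eq:
  assumes "canonical X" "canonical Y" "sLeft T X = sLeft T Y" "sBot T X = sBot T Y"
  shows "X = Y"
  using assms left_bot_determine[of X Y] sec_eqI[of X Y] by (simp add: canonical_def)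

lemma canonical_top_right_eq:
  assumes "canonical X" "canonical Y" "sTop T X = sTop T Y" "sRight T X = sRight T Y"
  shows "X = Y"
  using assms top_right_determine[of X Y] sec_eqI[of X Y] by (simp add: canonical_def)

text \<open>Fillers for the off-diagonal cells of the 2 by 2 array that defines the product. The
  upper right cell has its left and bottom sides prescribed by the diagonal squares, hence
  \<open>lb\<close>; the lower left cell has its top and right sides prescribed, hence
  \<open>tr\<close>.\<close>

definition lb :: "'v \<Rightarrow> 'h \<Rightarrow> 's" where
  "lb k h = (THE X. canonical X \<and> sLeft T X = k \<and> sBot T X = h)"

definition tr :: "'h \<Rightarrow> 'v \<Rightarrow> 's" where
  "tr h k = (THE X. canonical X \<and> sTop T X = h \<and> sRight T X = k)"

text \<open>The working form of uniqueness: a filler is identified by exhibiting any canonical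
  square with the two prescribed sides.\<close>

lemma lb_eqI: "\<lbrakk>canonical X; sLeft T X = k; sBot T X = h\<rbrakk> \<Longrightarrow> lb k h = X"
  unfolding lb_def using canonical_left_bot_eq by (intro the_equality) auto

lemma tr_eqI: "\<lbrakk>canonical X; sTop T X = h; sRight T X = k\<rbrakk> \<Longrightarrow> tr h k = X"
  unfolding tr_def using canonical_top_right_eq by (intro the_equality) auto

lemma lb_simps:
  assumes "k \<in> Arr (Ver T)" "h \<in> Arr (Hor T)" "Cod (Ver T) k = Dom (Hor T) h"
  shows "canonical (lb k h)" "sLeft T (lb k h) = k" "sBot T (lb k h) = h" "lb k h \<in> Sqr T"
    "Dom (Hor T) (sTop T (lb k h)) = Dom (Ver T) k" "Cod (Ver T) (sRight T (lb k h)) = Cod (Hor T) h"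
    "Cod (Hor T) (sTop T (lb k h)) = Dom (Ver T) (sRight T (lb k h))"
proof -
  obtain X where X: "X \<in> Sqr T" "sLeft T X = k" "sBot T X = h"
    using ex_left_bot[OF assms] by blast
  have "lb k h = sec X"
    using X by (intro lb_eqI) (simp_all add: canonical_sec sec_simps)
  then show "canonical (lb k h)" "sLeft T (lb k h) = k" "sBot T (lb k h) = h" "lb k h \<in> Sqr T"
    "Dom (Hor T) (sTop T (lb k h)) = Dom (Ver T) k" "Cod (Ver T) (sRight T (lb k h)) = Cod (Hor T) h"
    "Cod (Hor T) (sTop T (lb k h)) = Dom (Ver T) (sRight T (lb k h))"
    using X corner_simps[OF X(1)] by (simp_all add: canonical_sec sec_simps)
qed

lemma tr_simps:
  assumes "h \<in> Arr (Hor T)" "k \<in> Arr (Ver T)" "Cod (Hor T) h = Dom (Ver T) k"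
  shows "canonical (tr h k)" "sTop T (tr h k) = h" "sRight T (tr h k) = k" "tr h k \<in> Sqr T"
    "Dom (Ver T) (sLeft T (tr h k)) = Dom (Hor T) h" "Cod (Hor T) (sBot T (tr h k)) = Cod (Ver T) k"
    "Dom (Hor T) (sBot T (tr h k)) = Cod (Ver T) (sLeft T (tr h k))"
proof -
  obtain X where X: "X \<in> Sqr T" "sTop T X = h" "sRight T X = k"
    using ex_top_right[OF assms] by blast
  have "tr h k = sec X"
    using X by (intro tr_eqI) (simp_all add: canonical_sec sec_simps)
  then show "canonical (tr h k)" "sTop T (tr h k) = h" "sRight T (tr h k) = k" "tr h k \<in> Sqr T"
    "Dom (Ver T) (sLeft T (tr h k)) = Dom (Hor T) h" "Cod (Hor T) (sBot T (tr h k)) = Cod (Ver T) k"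
    "Dom (Hor T) (sBot T (tr h k)) = Cod (Ver T) (sLeft T (tr h k))"
    using X corner_simps[OF X(1)] by (simp_all add: canonical_sec sec_simps)
qed

section \<open>The diagonal groupoid\<close>

definition mult :: "'s \<Rightarrow> 's \<Rightarrow> 's" (infixl "\<bullet>" 70) where
  "X \<bullet> Y = (X \<circ>\<^sub>h lb (sRight T X) (sTop T Y)) \<circ>\<^sub>v (tr (sBot T X) (sLeft T Y) \<circ>\<^sub>h Y)"

definition diag :: "('o, 's) cat" where
  "diag = \<lparr>Obj = Obj (Hor T), Arr = Sqr T, Dom = (\<lambda>X. Dom (Ver T) (sLeft T X)),
    Cod = (\<lambda>X. Cod (Ver T) (sRight T X)), Ide = (\<lambda>x. hid (Ide (Ver T) x)), Cmp = mult\<rparr>"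

lemma diag_sel [simp]:
  "Obj diag = Obj (Hor T)" "Arr diag = Sqr T" "Dom diag X = Dom (Ver T) (sLeft T X)"
  "Cod diag X = Cod (Ver T) (sRight T X)" "Ide diag x = hid (Ide (Ver T) x)" "Cmp diag = mult"
  by (simp_all add: diag_def)

lemma fill_simps:
  assumes "X \<in> Sqr T" "Y \<in> Sqr T" "Cod (Ver T) (sRight T X) = Dom (Ver T) (sLeft T Y)"
  shows
    "canonical (lb (sRight T X) (sTop T Y))" "lb (sRight T X) (sTop T Y) \<in> Sqr T"
    "sLeft T (lb (sRight T X) (sTop T Y)) = sRight T X" "sBot T (lb (sRight T X) (sTop T Y)) = sTop T Y"
    "canonical (tr (sBot T X) (sLeft T Y))" "tr (sBot T X) (sLeft T Y) \<in> Sqr T"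
    "sTop T (tr (sBot T X) (sLeft T Y)) = sBot T X" "sRight T (tr (sBot T X) (sLeft T Y)) = sLeft T Y"
  using lb_simps[of "sRight T X" "sTop T Y"] tr_simps[of "sBot T X" "sLeft T Y"] assms
  by (simp_all add: sides_in corner_simps)

lemma mult_simps:
  assumes "X \<in> Sqr T" "Y \<in> Sqr T" "Cod (Ver T) (sRight T X) = Dom (Ver T) (sLeft T Y)"
  shows "X \<bullet> Y \<in> Sqr T"
    "sTop T (X \<bullet> Y) = sTop T X \<cdot>\<^bsub>Hor T\<^esub> sTop T (lb (sRight T X) (sTop T Y))"
    "sRight T (X \<bullet> Y) = sRight T (lb (sRight T X) (sTop T Y)) \<cdot>\<^bsub>Ver T\<^esub> sRight T Y"
    "sLeft T (X \<bullet> Y) = sLeft T X \<cdot>\<^bsub>Ver T\<^esub> sLeft T (tr (sBot T X) (sLeft T Y))"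
    "sBot T (X \<bullet> Y) = sBot T (tr (sBot T X) (sLeft T Y)) \<cdot>\<^bsub>Hor T\<^esub> sBot T Y"
proof -
  note f = fill_simps[OF assms]
  have e: "sBot T (X \<circ>\<^sub>h lb (sRight T X) (sTop T Y)) = sTop T (tr (sBot T X) (sLeft T Y) \<circ>\<^sub>h Y)"
    using assms by (simp add: hcomp_simps f)
  note v = vcomp_simps[OF _ _ e, folded mult_def]
  show "X \<bullet> Y \<in> Sqr T"
    "sTop T (X \<bullet> Y) = sTop T X \<cdot>\<^bsub>Hor T\<^esub> sTop T (lb (sRight T X) (sTop T Y))"
    "sRight T (X \<bullet> Y) = sRight T (lb (sRight T X) (sTop T Y)) \<cdot>\<^bsub>Ver T\<^esub> sRight T Y"
    "sLeft T (X \<bullet> Y) = sLeft T X \<cdot>\<^bsub>Ver T\<^esub> sLeft T (tr (sBot T X) (sLeft T Y))"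
    "sBot T (X \<bullet> Y) = sBot T (tr (sBot T X) (sLeft T Y)) \<cdot>\<^bsub>Hor T\<^esub> sBot T Y"
    using assms by (simp_all add: v hcomp_simps f)
qed

text \<open>A corner with an identity arrow on one side is filled by an identity square, which is
  canonical since the section preserves identities.\<close>

lemma lb_Ide:
  "k \<in> Arr (Ver T) \<Longrightarrow> x = Cod (Ver T) k \<Longrightarrow> lb k (Ide (Hor T) x) = hid k"
  "h \<in> Arr (Hor T) \<Longrightarrow> x = Dom (Hor T) h \<Longrightarrow> lb (Ide (Ver T) x) h = vid h"
  by (auto intro!: lb_eqI canonical_intros simp: hid_simps vid_simps)

lemma tr_Ide:
  "k \<in> Arr (Ver T) \<Longrightarrow> x = Dom (Ver T) k \<Longrightarrow> tr (Ide (Hor T) x) k = hid k"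
  "h \<in> Arr (Hor T) \<Longrightarrow> x = Cod (Hor T) h \<Longrightarrow> tr h (Ide (Ver T) x) = vid h"
  by (auto intro!: tr_eqI canonical_intros simp: hid_simps vid_simps)

lemma Ide_Ver_in: "x \<in> Obj (Hor T) \<Longrightarrow> Ide (Ver T) x \<in> Arr (Ver T)"
  "x \<in> Obj (Hor T) \<Longrightarrow> Dom (Ver T) (Ide (Ver T) x) = x"
  "x \<in> Obj (Hor T) \<Longrightarrow> Cod (Ver T) (Ide (Ver T) x) = x"
  using Obj_Ver by (auto simp: Ver.cat_simps)

lemma ends_in:
  "k \<in> Arr (Ver T) \<Longrightarrow> Dom (Ver T) k \<in> Obj (Hor T)" "k \<in> Arr (Ver T) \<Longrightarrow> Cod (Ver T) k \<in> Obj (Hor T)"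
  using Ver.Dom_in Ver.Cod_in Obj_Ver by auto

text \<open>Two cells of the array become identity squares and merge with the rest, so that the
  product reduces to one pasting with a canonical square. The next two lemmas do the same for the
  other positions.\<close>

lemma vid_mult:
  assumes "h \<in> Arr (Hor T)" "Y \<in> Sqr T" "Cod (Hor T) h = Dom (Ver T) (sLeft T Y)"
  shows "vid h \<bullet> Y = tr h (sLeft T Y) \<circ>\<^sub>h Y"
  using assms tr_simps[of h "sLeft T Y"]
  by (simp add: mult_def vid_simps lb_Ide sides_in corner_simps vid_hcomp[symmetric] vcomp_id hcomp_simps)

lemma hid_mult:
  assumes "k \<in> Arr (Ver T)" "Y \<in> Sqr T" "Cod (Ver T) k = Dom (Ver T) (sLeft T Y)"
  shows "hid k \<bullet> Y = lb k (sTop T Y) \<circ>\<^sub>v Y"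
  using assms lb_simps[of k "sTop T Y"]
  by (simp add: mult_def hid_simps tr_Ide sides_in corner_simps hcomp_id)

lemma mult_hid:
  assumes "k \<in> Arr (Ver T)" "X \<in> Sqr T" "Cod (Ver T) (sRight T X) = Dom (Ver T) k"
  shows "X \<bullet> hid k = X \<circ>\<^sub>v tr (sBot T X) k"
  using assms tr_simps[of "sBot T X" k]
  by (simp add: mult_def hid_simps lb_Ide sides_in corner_simps hcomp_id)

lemma Ide_mult: "\<lbrakk>X \<in> Sqr T; x = Dom (Ver T) (sLeft T X)\<rbrakk> \<Longrightarrow> hid (Ide (Ver T) x) \<bullet> X = X"
  by (simp add: hid_mult sides_in Ide_Ver_in ends_in lb_Ide corner_simps vcomp_id)

lemma mult_Ide: "\<lbrakk>X \<in> Sqr T; x = Cod (Ver T) (sRight T X)\<rbrakk> \<Longrightarrow> X \<bullet> hid (Ide (Ver T) x) = X"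
  by (simp add: mult_hid sides_in Ide_Ver_in ends_in tr_Ide corner_simps vcomp_id)

text \<open>Both bracketings are the composite of the 3 by 3 array with diagonal \<open>X, Y, Z\<close> and
  canonical squares elsewhere.\<close>

lemma mult_assoc:
  assumes X: "X \<in> Sqr T" and Y: "Y \<in> Sqr T" and Z: "Z \<in> Sqr T"
    and XY: "Cod (Ver T) (sRight T X) = Dom (Ver T) (sLeft T Y)"
    and YZ: "Cod (Ver T) (sRight T Y) = Dom (Ver T) (sLeft T Z)"
  shows "(X \<bullet> Y) \<bullet> Z = X \<bullet> (Y \<bullet> Z)"
proof -
  define U where "U = lb (sRight T X) (sTop T Y)"
  define V where "V = tr (sBot T X) (sLeft T Y)"
  define U' where "U' = lb (sRight T Y) (sTop T Z)"
  define V' where "V' = tr (sBot T Y) (sLeft T Z)"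
  note f = fill_simps[OF X Y XY, folded U_def V_def] fill_simps[OF Y Z YZ, folded U'_def V'_def]
  note m = mult_simps[OF X Y XY, folded U_def V_def] mult_simps[OF Y Z YZ, folded U'_def V'_def]
  have c: "Cod (Ver T) (sRight T U) = Dom (Hor T) (sTop T U')"
    "Cod (Hor T) (sBot T V) = Dom (Ver T) (sLeft T V')"
    using corner_simps[OF f(2)] corner_simps[OF f(6)] corner_simps[OF f(10)] corner_simps[OF f(14)] corner_simps[OF Y]
    by (simp_all add: f)
  define W where "W = lb (sRight T U) (sTop T U')"
  define W2 where "W2 = tr (sBot T V) (sLeft T V')"
  have w: "canonical W" "W \<in> Sqr T" "sLeft T W = sRight T U" "sBot T W = sTop T U'"
    "canonical W2" "W2 \<in> Sqr T" "sTop T W2 = sBot T V" "sRight T W2 = sLeft T V'"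
    unfolding W_def W2_def using lb_simps(1-4)[OF _ _ c(1)] tr_simps(1-4)[OF _ _ c(2)] f
    by (simp_all add: sides_in)
  \<comment> \<open>By uniqueness, a filler next to a product is the pasting of two cells of the 3
    by 3 array; the four equations identify all fillers of both bracketings in this way.\<close>
  have P: "lb (sRight T (X \<bullet> Y)) (sTop T Z) = W \<circ>\<^sub>v U'"
    by (rule lb_eqI) (simp_all add: canonical_intros f w m vcomp_simps)
  have Q: "tr (sBot T (X \<bullet> Y)) (sLeft T Z) = W2 \<circ>\<^sub>h V'"
    by (rule tr_eqI) (simp_all add: canonical_intros f w m hcomp_simps)
  have P': "lb (sRight T X) (sTop T (Y \<bullet> Z)) = U \<circ>\<^sub>h W"
    by (rule lb_eqI) (simp_all add: canonical_intros f w m hcomp_simps)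
  have Q': "tr (sBot T X) (sLeft T (Y \<bullet> Z)) = V \<circ>\<^sub>v W2"
    by (rule tr_eqI) (simp_all add: canonical_intros f w m vcomp_simps)
  note S = X Y Z f w hcomp_simps vcomp_simps
  have "(X \<bullet> Y) \<bullet> Z = (((X \<circ>\<^sub>h U) \<circ>\<^sub>v (V \<circ>\<^sub>h Y)) \<circ>\<^sub>h (W \<circ>\<^sub>v U')) \<circ>\<^sub>v ((W2 \<circ>\<^sub>h V') \<circ>\<^sub>h Z)"
    unfolding mult_def[of "X \<bullet> Y" Z] P Q by (simp add: mult_def U_def V_def)
  also have "((X \<circ>\<^sub>h U) \<circ>\<^sub>v (V \<circ>\<^sub>h Y)) \<circ>\<^sub>h (W \<circ>\<^sub>v U') = ((X \<circ>\<^sub>h U) \<circ>\<^sub>h W) \<circ>\<^sub>v ((V \<circ>\<^sub>h Y) \<circ>\<^sub>h U')"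
    by (rule interchange[symmetric]) (simp_all add: S)
  also have "(X \<circ>\<^sub>h U) \<circ>\<^sub>h W = X \<circ>\<^sub>h (U \<circ>\<^sub>h W)"
    by (rule HSq.Cmp_assoc) (simp_all add: S)
  also have "(V \<circ>\<^sub>h Y) \<circ>\<^sub>h U' = V \<circ>\<^sub>h (Y \<circ>\<^sub>h U')"
    by (rule HSq.Cmp_assoc) (simp_all add: S)
  also have "(W2 \<circ>\<^sub>h V') \<circ>\<^sub>h Z = W2 \<circ>\<^sub>h (V' \<circ>\<^sub>h Z)"
    by (rule HSq.Cmp_assoc) (simp_all add: S)
  also have "((X \<circ>\<^sub>h (U \<circ>\<^sub>h W)) \<circ>\<^sub>v (V \<circ>\<^sub>h (Y \<circ>\<^sub>h U'))) \<circ>\<^sub>v (W2 \<circ>\<^sub>h (V' \<circ>\<^sub>h Z)) =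
      (X \<circ>\<^sub>h (U \<circ>\<^sub>h W)) \<circ>\<^sub>v ((V \<circ>\<^sub>h (Y \<circ>\<^sub>h U')) \<circ>\<^sub>v (W2 \<circ>\<^sub>h (V' \<circ>\<^sub>h Z)))"
    by (rule VSq.Cmp_assoc) (simp_all add: S Arr_VSq)
  also have "(V \<circ>\<^sub>h (Y \<circ>\<^sub>h U')) \<circ>\<^sub>v (W2 \<circ>\<^sub>h (V' \<circ>\<^sub>h Z)) = (V \<circ>\<^sub>v W2) \<circ>\<^sub>h ((Y \<circ>\<^sub>h U') \<circ>\<^sub>v (V' \<circ>\<^sub>h Z))"
    by (rule interchange) (simp_all add: S)
  also have "(X \<circ>\<^sub>h (U \<circ>\<^sub>h W)) \<circ>\<^sub>v ((V \<circ>\<^sub>v W2) \<circ>\<^sub>h ((Y \<circ>\<^sub>h U') \<circ>\<^sub>v (V' \<circ>\<^sub>h Z))) = X \<bullet> (Y \<bullet> Z)"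
    unfolding mult_def[of X "Y \<bullet> Z"] P' Q' by (simp add: mult_def U'_def V'_def)
  finally show ?thesis .
qed

text \<open>\<open>sec\<close> preserves boundaries, on which alone the fillers depend, and it fixes
  the fillers because they are canonical.\<close>

lemma sec_mult:
  assumes "X \<in> Sqr T" "Y \<in> Sqr T" "Cod (Ver T) (sRight T X) = Dom (Ver T) (sLeft T Y)"
  shows "sec (X \<bullet> Y) = sec X \<bullet> sec Y"
proof -
  note f = fill_simps[OF assms]
  show ?thesis
    unfolding mult_def using assms
    by (simp add: sec_vcomp sec_hcomp hcomp_simps f sec_simps canonicalD(2)[OF f(1)] canonicalD(2)[OF f(5)])
qed

lemma category_diag: "category diag"
proof
  fix X Y assume "X \<in> Arr diag" "Y \<in> Arr diag" "Cod diag X = Dom diag Y"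
  then have XY: "X \<in> Sqr T" "Y \<in> Sqr T" "Cod (Ver T) (sRight T X) = Dom (Ver T) (sLeft T Y)"
    by simp_all
  note f = fill_simps[OF XY] and m = mult_simps[OF XY]
  show "X \<cdot>\<^bsub>diag\<^esub> Y \<in> Arr diag"
    by (simp add: m)
  show "Dom diag (X \<cdot>\<^bsub>diag\<^esub> Y) = Dom diag X" "Cod diag (X \<cdot>\<^bsub>diag\<^esub> Y) = Cod diag Y"
    using corner_simps[OF f(2)] corner_simps[OF f(6)] corner_simps[OF XY(1)] corner_simps[OF XY(2)] XY f
    by (simp_all add: m sides_in Ver.cat_simps)
qed (auto simp: sides_in ends_in Ide_Ver_in hid_simps Ide_mult mult_Ide mult_assoc)

end

sublocale max_excl_groupoid \<subseteq> diag: category diag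
  by (rule category_diag)

section \<open>Identity squares, canonical squares and the core bundle under the diagonal
  product\<close>

context max_excl_groupoid
begin

lemma is_functor_vid: "is_functor (Hor T) diag (\<lambda>x. x) vid"
proof (rule is_functorI)
  show "vid (h \<cdot>\<^bsub>Hor T\<^esub> g) = vid h \<cdot>\<^bsub>diag\<^esub> vid g"
    if "h \<in> Arr (Hor T)" "g \<in> Arr (Hor T)" "Cod (Hor T) h = Dom (Hor T) g" for h g
    using that by (simp add: vid_mult vid_simps Ide_Ver_in Hor.Dom_in tr_Ide vid_hcomp)
qed (simp_all add: vid_simps Ide_Ver_in Hor.Dom_in Hor.Cod_in hid_vid)

lemma is_functor_hid: "is_functor (Ver T) diag (\<lambda>x. x) hid"
proof (rule is_functorI)
  show "hid (k \<cdot>\<^bsub>Ver T\<^esub> l) = hid k \<cdot>\<^bsub>diag\<^esub> hid l"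
    if "k \<in> Arr (Ver T)" "l \<in> Arr (Ver T)" "Cod (Ver T) k = Dom (Ver T) l" for k l
    using that by (simp add: hid_mult hid_simps lb_Ide hid_vcomp)
qed (simp_all add: hid_simps Obj_Ver)

lemma is_functor_sec: "is_functor diag diag (\<lambda>x. x) sec"
  by (rule is_functorI) (simp_all add: sec_simps sec_mult sec_hid Ide_Ver_in)

text \<open>The product on the right reduces to the filler \<open>tr\<close> of the top and right
  sides, which is \<open>X\<close> by uniqueness. With the mirrored lemma below, canonical squares
  factor in both orders.\<close>

lemma canonical_eq_vid_hid:
  assumes "canonical X"
  shows "X = vid (sTop T X) \<bullet> hid (sRight T X)"
proof -
  note X = canonicalD(1)[OF assms]
  have "tr (sTop T X) (sRight T X) = X"
    using assms by (intro tr_eqI) simp_all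
  then show ?thesis
    using X by (simp add: vid_mult sides_in hid_simps corner_simps hcomp_id)
qed

lemma canonical_eq_hid_vid:
  assumes "canonical X"
  shows "X = hid (sLeft T X) \<bullet> vid (sBot T X)"
proof -
  note X = canonicalD(1)[OF assms]
  have "lb (sLeft T X) (sBot T X) = X"
    using assms by (intro lb_eqI) simp_all
  then show ?thesis
    using X by (simp add: hid_mult sides_in vid_simps Ide_Ver_in Hor.Dom_in corner_simps vcomp_id ends_in)
qed

lemma canonical_mult:
  assumes "canonical X" "canonical Y" "Cod (Ver T) (sRight T X) = Dom (Ver T) (sLeft T Y)"
  shows "canonical (X \<bullet> Y)"
  using assms sec_mult[of X Y] by (simp add: canonical_def mult_simps)

lemma sides_if_sec_eq_Ide:
  assumes "X \<in> Sqr T" "x \<in> Obj (Hor T)" "sec X = hid (Ide (Ver T) x)"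
  shows "sLeft T X = Ide (Ver T) x" "sRight T X = Ide (Ver T) x"
    "sTop T X = Ide (Hor T) x" "sBot T X = Ide (Hor T) x"
  using hid_simps(2-5)[OF Ide_Ver_in(1)[OF assms(2)]] Ide_Ver_in[OF assms(2)]
  unfolding assms(3)[symmetric] sec_simps(2-5)[OF assms(1)] by simp_all

text \<open>Corner equations put the four identity sides over one object, and \<open>sec\<close>
  depends only on the boundary. Describing the bundle as a kernel turns its closure properties into
  functoriality of \<open>sec\<close>.\<close>

lemma core_bundle_iff:
  "X \<in> core_bundle T \<longleftrightarrow> X \<in> Sqr T \<and> sec X = Ide diag (Dom diag X)"
proof
  assume X: "X \<in> core_bundle T"
  then have S: "X \<in> Sqr T" by (simp add: core_bundle_def)
  obtain x y z w where i: "x \<in> Obj (Hor T)" "sLeft T X = Ide (Ver T) x" "y \<in> Obj (Hor T)" "sRight T X = Ide (Ver T) y"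
    "z \<in> Obj (Hor T)" "sTop T X = Ide (Hor T) z" "w \<in> Obj (Hor T)" "sBot T X = Ide (Hor T) w"
    using X by (auto simp: core_bundle_def identities_def Obj_Ver)
  have "z = x" "w = x" "z = y"
    using corner_simps[OF S] i by (simp_all add: Ide_Ver_in Hor.cat_simps)
  then have "sec X = sec (hid (Ide (Ver T) x))"
    using i S by (intro sec_eqI) (simp_all add: hid_simps Ide_Ver_in)
  then show "X \<in> Sqr T \<and> sec X = Ide diag (Dom diag X)"
    using S i by (simp add: sec_hid Ide_Ver_in)
next
  assume *: "X \<in> Sqr T \<and> sec X = Ide diag (Dom diag X)"
  then have x: "Dom (Ver T) (sLeft T X) \<in> Obj (Hor T)"
    by (simp add: sides_in ends_in)
  with * have "sLeft T X = Ide (Ver T) (Dom (Ver T) (sLeft T X))"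
    "sRight T X = Ide (Ver T) (Dom (Ver T) (sLeft T X))"
    "sTop T X = Ide (Hor T) (Dom (Ver T) (sLeft T X))" "sBot T X = Ide (Hor T) (Dom (Ver T) (sLeft T X))"
    using sides_if_sec_eq_Ide[of X] by auto
  then show "X \<in> core_bundle T"
    using * x unfolding core_bundle_def identities_def Obj_Ver by blast
qed

lemma core_bundle_sides:
  assumes "X \<in> core_bundle T" "x = Dom (Ver T) (sLeft T X)"
  shows "X \<in> Sqr T" "sLeft T X = Ide (Ver T) x" "sRight T X = Ide (Ver T) x"
    "sTop T X = Ide (Hor T) x" "sBot T X = Ide (Hor T) x" "x \<in> Obj (Hor T)"
proof -
  have X: "X \<in> Sqr T" "sec X = hid (Ide (Ver T) x)"
    using assms core_bundle_iff by auto
  then show x: "x \<in> Obj (Hor T)"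
    unfolding assms(2) by (simp add: sides_in Ver.Dom_in flip: Obj_Ver)
  show "X \<in> Sqr T" "sLeft T X = Ide (Ver T) x" "sRight T X = Ide (Ver T) x"
    "sTop T X = Ide (Hor T) x" "sBot T X = Ide (Hor T) x"
    by (fact X(1)) (rule sides_if_sec_eq_Ide[OF X(1) x X(2)])+
qed

text \<open>The Eckmann-Hilton argument: two arrays with \<open>a\<close> and \<open>b\<close> on
  one diagonal and the identity square \<open>I\<close> on the other are evaluated by rows and by
  columns. In the diagonal product the fillers are also \<open>I\<close>.\<close>

lemma bundle_mult:
  assumes "a \<in> core_bundle T" "b \<in> core_bundle T" "Dom (Ver T) (sLeft T a) = Dom (Ver T) (sLeft T b)"
  shows "a \<bullet> b = a \<circ>\<^sub>v b" "a \<circ>\<^sub>v b = a \<circ>\<^sub>h b" "a \<circ>\<^sub>h b = b \<circ>\<^sub>v a"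
proof -
  define x where "x = Dom (Ver T) (sLeft T a)"
  note a = core_bundle_sides[OF assms(1) x_def] and b = core_bundle_sides[OF assms(2) x_def[unfolded assms(3)]]
  define I where "I = hid (Ide (Ver T) x)"
  have I: "I \<in> Sqr T" "sLeft T I = Ide (Ver T) x" "sRight T I = Ide (Ver T) x"
    "sTop T I = Ide (Hor T) x" "sBot T I = Ide (Hor T) x"
    using a(6) by (simp_all add: I_def hid_simps Ide_Ver_in)
  have I': "I = vid (Ide (Hor T) x)"
    using a(6) by (simp add: I_def hid_vid)
  have id: "a \<circ>\<^sub>h I = a" "I \<circ>\<^sub>h a = a" "b \<circ>\<^sub>h I = b" "I \<circ>\<^sub>h b = b"
    using a b by (simp_all add: I_def hcomp_id)
  have id': "a \<circ>\<^sub>v I = a" "I \<circ>\<^sub>v a = a" "b \<circ>\<^sub>v I = b" "I \<circ>\<^sub>v b = b"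
    using a b by (simp_all add: I' vcomp_id)
  have "lb (Ide (Ver T) x) (Ide (Hor T) x) = I" "tr (Ide (Hor T) x) (Ide (Ver T) x) = I"
    using a(6) by (simp_all add: I_def lb_Ide tr_Ide Ide_Ver_in)
  then show "a \<bullet> b = a \<circ>\<^sub>v b"
    by (simp add: mult_def a b id)
  have "(a \<circ>\<^sub>h I) \<circ>\<^sub>v (I \<circ>\<^sub>h b) = (a \<circ>\<^sub>v I) \<circ>\<^sub>h (I \<circ>\<^sub>v b)"
    by (rule interchange) (simp_all add: a b I)
  then show "a \<circ>\<^sub>v b = a \<circ>\<^sub>h b"
    by (simp add: id id')
  have "(I \<circ>\<^sub>h b) \<circ>\<^sub>v (a \<circ>\<^sub>h I) = (I \<circ>\<^sub>v a) \<circ>\<^sub>h (b \<circ>\<^sub>v I)"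
    by (rule interchange) (simp_all add: a b I)
  then show "a \<circ>\<^sub>h b = b \<circ>\<^sub>v a"
    by (simp add: id id')
qed

lemma isomorphism_vid: "h \<in> Arr (Hor T) \<Longrightarrow> isomorphism diag (vid h)"
  using is_functor_isomorphism[OF cat_Hor category_diag is_functor_vid Hor.is_inverse_inverse_arr]
  by (auto simp: isomorphism_def)

lemma isomorphism_hid: "k \<in> Arr (Ver T) \<Longrightarrow> isomorphism diag (hid k)"
  using is_functor_isomorphism[OF cat_Ver category_diag is_functor_hid Ver.is_inverse_inverse_arr]
  by (auto simp: isomorphism_def)

lemma isomorphism_mult:
  "\<lbrakk>isomorphism diag X; isomorphism diag Y; Cod diag X = Dom diag Y\<rbrakk> \<Longrightarrow> isomorphism diag (X \<bullet> Y)"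
  using diag.is_inverse_Cmp by (fastforce simp: isomorphism_def)

text \<open>On the core bundle the diagonal product is vertical composition, so the vertical inverse
  serves.\<close>

lemma isomorphism_bundle:
  assumes "a \<in> core_bundle T"
  shows "isomorphism diag a"
proof -
  define x where "x = Dom (Ver T) (sLeft T a)"
  note a = core_bundle_sides[OF assms x_def]
  define b where "b = inverse_arr (VSq T) a"
  have b: "b \<in> Sqr T" "sLeft T b = Ide (Ver T) x" "sRight T b = Ide (Ver T) x"
    "sTop T b = Ide (Hor T) x" "sBot T b = Ide (Hor T) x"
    using a vinv_simps[OF a(1)] by (simp_all add: b_def Ver.inv_Ide Obj_Ver)
  then have bA: "b \<in> core_bundle T"
    using a(6) by (auto simp: core_bundle_def identities_def Obj_Ver)
  have "a \<bullet> b = a \<circ>\<^sub>v b" "b \<bullet> a = b \<circ>\<^sub>v a"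
    using bundle_mult(1)[OF assms bA] bundle_mult(1)[OF bA assms] a(2) b(2) by simp_all
  moreover have "a \<circ>\<^sub>v b = vid (Ide (Hor T) x)" "b \<circ>\<^sub>v a = vid (Ide (Hor T) x)"
    unfolding b_def using a VSq.inv_right[of a] VSq.inv_left[of a] by (simp_all add: Arr_VSq)
  ultimately have "is_inverse diag a b"
    using a b by (simp add: is_inverse_def Ide_Ver_in hid_vid)
  then show ?thesis
    by (auto simp: isomorphism_def)
qed

lemma isomorphism_canonical:
  assumes "canonical X"
  shows "isomorphism diag X"
proof -
  have "isomorphism diag (vid (sTop T X) \<bullet> hid (sRight T X))"
    using canonicalD(1)[OF assms]
    by (intro isomorphism_mult isomorphism_vid isomorphism_hid)
      (simp_all add: sides_in vid_simps hid_simps corner_simps Ide_Ver_in ends_in)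
  then show ?thesis
    using canonical_eq_vid_hid[OF assms] by simp
qed

text \<open>Let \<open>c\<close> be the inverse of \<open>sec X\<close>. Functors preserve inverses
  and inverses are unique, so \<open>sec\<close> fixes \<open>c\<close>; thus
  \<open>X \<bullet> c\<close> lies in the kernel of \<open>sec\<close>. Then
  \<open>X = (X \<bullet> c) \<bullet> sec X\<close> is a product of an invertible bundle element
  and an invertible canonical square.\<close>

lemma groupoid_diag: "groupoid diag"
proof (rule groupoidI)
  fix X assume "X \<in> Arr diag"
  then have X: "X \<in> Sqr T" by simp
  note s = sec_simps[OF X]
  obtain c where c: "is_inverse diag (sec X) c"
    using isomorphism_canonical[OF canonical_sec[OF X]] by (auto simp: isomorphism_def)
  note c' = c[unfolded is_inverse_def, simplified]
  have "is_inverse diag (sec X) (sec c)"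
    using is_functor_isomorphism[OF category_diag category_diag is_functor_sec c]
      canonicalD(2)[OF canonical_sec[OF X]] by simp
  from diag.is_inverse_unique[OF this c] have sc: "sec c = c" .
  have a: "X \<bullet> c \<in> core_bundle T"
    using X c' s sec_mult[of X c] diag.cat_simps[simplified]
    by (simp add: core_bundle_iff sc)
  have "X = (X \<bullet> c) \<bullet> sec X"
    using X c' s by (simp add: mult_assoc mult_Ide)
  moreover have "isomorphism diag ((X \<bullet> c) \<bullet> sec X)"
    using X c' s a diag.cat_simps[simplified]
    by (intro isomorphism_mult isomorphism_bundle isomorphism_canonical canonical_sec) simp_all
  ultimately show "isomorphism diag X" by simp
qed (rule category_diag)

end

sublocale max_excl_groupoid \<subseteq> diag: groupoid diag
  by (rule groupoid_diag)

section \<open>The quadruple inside the diagonal groupoid\<close>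

context max_excl_groupoid
begin

definition HH :: "'s set" where "HH = vid ` Arr (Hor T)"
definition KK :: "'s set" where "KK = hid ` Arr (Ver T)"

lemma inv_vid: "h \<in> Arr (Hor T) \<Longrightarrow> inverse_arr diag (vid h) = vid (inverse_arr (Hor T) h)"
  using is_functor_inverse_arr[OF groupoid_Hor category_diag is_functor_vid] by simp

lemma inv_hid: "k \<in> Arr (Ver T) \<Longrightarrow> inverse_arr diag (hid k) = hid (inverse_arr (Ver T) k)"
  using is_functor_inverse_arr[OF groupoid_Ver category_diag is_functor_hid] by simp

lemma vid_mult_hid:
  assumes "h \<in> Arr (Hor T)" "k \<in> Arr (Ver T)" "Cod (Hor T) h = Dom (Ver T) k"
  shows "vid h \<bullet> hid k = tr h k"
  using assms by (simp add: vid_mult hid_simps tr_simps hcomp_id)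

lemma hid_mult_vid:
  assumes "h \<in> Arr (Hor T)" "k \<in> Arr (Ver T)" "Cod (Ver T) k = Dom (Hor T) h"
  shows "hid k \<bullet> vid h = lb k h"
  using assms by (simp add: hid_mult vid_simps lb_simps vcomp_id Ide_Ver_in Hor.Dom_in)

lemma set_cmp_HH_KK: "set_cmp diag HH KK = {X. canonical X}"
proof (intro equalityI subsetI)
  fix X assume "X \<in> set_cmp diag HH KK"
  then show "X \<in> {X. canonical X}"
    by (auto simp: set_cmp_def HH_def KK_def canonical_mult canonical_intros)
next
  fix X assume X: "X \<in> {X. canonical X}"
  then have "X \<in> Sqr T" by (simp add: canonical_def)
  then show "X \<in> set_cmp diag HH KK"
    using X canonical_eq_vid_hid[of X] unfolding set_cmp_def HH_def KK_def
    by (intro CollectI exI[of _ "vid (sTop T X)"] exI[of _ "hid (sRight T X)"])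
      (simp add: sides_in vid_simps hid_simps corner_simps Ide_Ver_in ends_in)
qed

lemma set_cmp_KK_HH: "set_cmp diag KK HH = {X. canonical X}"
proof (intro equalityI subsetI)
  fix X assume "X \<in> set_cmp diag KK HH"
  then show "X \<in> {X. canonical X}"
    by (auto simp: set_cmp_def HH_def KK_def canonical_mult canonical_intros)
next
  fix X assume X: "X \<in> {X. canonical X}"
  then have "X \<in> Sqr T" by (simp add: canonical_def)
  then show "X \<in> set_cmp diag KK HH"
    using X canonical_eq_hid_vid[of X] unfolding set_cmp_def HH_def KK_def
    by (intro CollectI exI[of _ "hid (sLeft T X)"] exI[of _ "vid (sBot T X)"])
      (simp add: sides_in vid_simps hid_simps corner_simps Ide_Ver_in ends_in)
qed

lemma identities_diag: "identities diag = (\<lambda>x. hid (Ide (Ver T) x)) ` Obj (Hor T)"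
  by (simp add: identities_def)

lemma subgroupoid_HH: "subgroupoid HH diag"
  unfolding subgroupoid_def
proof (intro conjI ballI impI)
  show "HH \<subseteq> Arr diag" by (auto simp: HH_def vid_simps)
  show "identities diag \<subseteq> HH"
    by (auto simp: identities_diag HH_def hid_vid Hor.Ide_in)
  show "f \<cdot>\<^bsub>diag\<^esub> g \<in> HH" if fg: "f \<in> HH" "g \<in> HH" "Cod diag f = Dom diag g" for f g
  proof -
    obtain h k where h: "f = vid h" "g = vid k" "h \<in> Arr (Hor T)" "k \<in> Arr (Hor T)"
      using fg unfolding HH_def by blast
    then have "Cod (Hor T) h = Dom (Hor T) k"
      using fg(3) by (simp add: vid_simps Ide_Ver_in Hor.Dom_in Hor.Cod_in)
    moreover from this have "vid (h \<cdot>\<^bsub>Hor T\<^esub> k) \<in> HH"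
      using h by (simp add: HH_def Hor.Cmp_in)
    ultimately show ?thesis
      using is_functor_Cmp[OF is_functor_vid, of h k] h by simp
  qed
  show "inverse_arr diag f \<in> HH" if "f \<in> HH" for f
    using that by (auto simp: HH_def inv_vid Hor.inv_in)
qed

lemma subgroupoid_KK: "subgroupoid KK diag"
  unfolding subgroupoid_def
proof (intro conjI ballI impI)
  show "KK \<subseteq> Arr diag" by (auto simp: KK_def hid_simps)
  show "identities diag \<subseteq> KK"
    by (auto simp: identities_diag KK_def Ide_Ver_in)
  show "f \<cdot>\<^bsub>diag\<^esub> g \<in> KK" if fg: "f \<in> KK" "g \<in> KK" "Cod diag f = Dom diag g" for f g
  proof -
    obtain h k where h: "f = hid h" "g = hid k" "h \<in> Arr (Ver T)" "k \<in> Arr (Ver T)"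
      using fg unfolding KK_def by blast
    then have "Cod (Ver T) h = Dom (Ver T) k"
      using fg(3) by (simp add: hid_simps)
    moreover from this have "hid (h \<cdot>\<^bsub>Ver T\<^esub> k) \<in> KK"
      using h by (simp add: KK_def Ver.Cmp_in)
    ultimately show ?thesis
      using is_functor_Cmp[OF is_functor_hid, of h k] h by simp
  qed
  show "inverse_arr diag f \<in> KK" if "f \<in> KK" for f
    using that by (auto simp: KK_def inv_hid Ver.inv_in)
qed

lemma core_bundle_ends:
  assumes "a \<in> core_bundle T"
  shows "a \<in> Sqr T" "Cod diag a = Dom diag a"
proof -
  note a = core_bundle_sides[OF assms refl]
  show "a \<in> Sqr T" by (rule a)
  have "Cod (Ver T) (sRight T a) = Dom (Ver T) (sLeft T a)"
    unfolding a(3) by (rule Ide_Ver_in(3)[OF a(6)])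
  then show "Cod diag a = Dom diag a" by simp
qed

lemma subgroupoid_core_bundle: "subgroupoid (core_bundle T) diag"
  unfolding subgroupoid_def
proof (intro conjI ballI impI)
  show "core_bundle T \<subseteq> Arr diag"
    using core_bundle_ends by auto
  show "identities diag \<subseteq> core_bundle T"
    by (auto simp: identities_diag core_bundle_iff hid_simps Ide_Ver_in sec_hid)
  show "a \<cdot>\<^bsub>diag\<^esub> b \<in> core_bundle T"
    if "a \<in> core_bundle T" "b \<in> core_bundle T" "Cod diag a = Dom diag b" for a b
  proof -
    define x where "x = Dom diag a"
    have x: "x \<in> Obj diag" "Cod diag a = x" "Dom diag b = x" "Dom diag a = x"
      using core_bundle_ends[OF that(1)] that(3) diag.Dom_in[of a] by (simp_all add: x_def)
    have "sec (a \<bullet> b) = Ide diag x \<cdot>\<^bsub>diag\<^esub> Ide diag x"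
      using that x sec_mult[of a b] unfolding core_bundle_iff by simp
    also have "\<dots> = Ide diag x"
      using diag.Ide_left'[of "Ide diag x" x] diag.Ide_in[OF x(1)] diag.Dom_Ide[OF x(1)] by simp
    also have "x = Dom diag (a \<bullet> b)"
      using diag.Dom_Cmp[of a b] that core_bundle_ends(1) by (simp add: x_def)
    finally have "sec (a \<bullet> b) = Ide diag (Dom diag (a \<bullet> b))" .
    then show ?thesis
      using that core_bundle_ends(1) by (simp add: core_bundle_iff[of "a \<bullet> b"] mult_simps)
  qed
  show "inverse_arr diag a \<in> core_bundle T" if "a \<in> core_bundle T" for a
    using is_functor_inverse_arr[OF groupoid_diag category_diag is_functor_sec, of a] that
      core_bundle_ends[OF that] diag.inv_in[of a] diag.Dom_inv[of a] diag.inv_Ide[of "Dom diag a"] diag.Dom_in[of a]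
    unfolding core_bundle_iff by simp
qed

text \<open>A kernel is normal: \<open>sec\<close> sends the conjugate to a conjugate of an
  identity. Hence every square acts on the bundle, not just those in \<open>HH\<close> and
  \<open>KK\<close>.\<close>

lemma conj_core_bundle:
  assumes "X \<in> Sqr T" "a \<in> core_bundle T" "Cod diag X = Dom diag a"
  shows "conj_arr diag X a \<in> core_bundle T"
proof -
  have a: "a \<in> Arr diag" "Cod diag a = Dom diag a" "sec a = Ide diag (Dom diag a)"
    using core_bundle_ends[OF assms(2)] assms(2) by (auto simp: core_bundle_iff)
  have "sec (conj_arr diag X a) = conj_arr diag (sec X) (Ide diag (Dom diag a))"
    using assms a is_functor_conj_arr[OF groupoid_diag groupoid_diag is_functor_sec, of X a] by simp
  also have "\<dots> = Ide diag (Dom diag X)"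
    using assms(1,3) diag.conj_Ide_right[of "sec X" "Dom diag a"] by (simp add: sec_simps)
  finally show ?thesis
    using assms a diag.conj_simps[of X a] by (simp add: core_bundle_iff)
qed

lemma is_quad_diag: "is_quad (diag, HH, KK, core_bundle T)"
  unfolding is_quad.simps
proof (intro conjI ballI impI)
  show "groupoid diag" "subgroupoid HH diag" "subgroupoid KK diag"
    by (rule groupoid_diag subgroupoid_HH subgroupoid_KK)+
  show "set_cmp diag HH KK = set_cmp diag KK HH"
    by (simp add: set_cmp_HH_KK set_cmp_KK_HH)
  \<comment> \<open>A canonical square equals its own \<open>sec\<close>, which is an identity if
    the square lies in the bundle. As \<open>HH\<close> and \<open>KK\<close> consist of canonical
    squares, this settles both intersections with the bundle.\<close>
  have HA: "X \<in> identities diag" if "X \<in> core_bundle T" "canonical X" for X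
    unfolding identities_def using that core_bundle_sides(6)[OF that(1) refl]
    by (intro image_eqI[of _ _ "Dom diag X"]) (simp_all add: core_bundle_iff canonical_def)
  have c: "canonical X" if "X \<in> HH \<or> X \<in> KK" for X
    using that by (auto simp: HH_def KK_def canonical_intros)
  show "discrete diag (HH \<inter> KK)"
    unfolding discrete_def
  proof
    fix X assume "X \<in> HH \<inter> KK"
    then obtain h k where "X = vid h" "h \<in> Arr (Hor T)" "X = hid k" "k \<in> Arr (Ver T)"
      unfolding HH_def KK_def by blast
    \<comment> \<open>The left side of an identity square of a horizontal arrow is an identity, so
      \<open>k\<close> itself is one.\<close>
    then have "sLeft T (hid k) = Ide (Ver T) (Dom (Hor T) h)" "sLeft T (hid k) = k"
      by (metis vid_simps(4)) (simp add: hid_simps \<open>k \<in> Arr (Ver T)\<close>)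
    then show "X \<in> identities diag"
      using \<open>X = hid k\<close> \<open>h \<in> Arr (Hor T)\<close> by (auto simp: identities_diag Hor.Dom_in)
  qed
  show "core_bundle T \<inter> HH = core_bundle T \<inter> KK"
    using HA c subgroupoid_HH subgroupoid_KK unfolding subgroupoid_def by blast
  show "discrete diag (core_bundle T \<inter> HH)"
    using HA c unfolding discrete_def by blast
  show "abelian_subgroupoid (core_bundle T) diag"
    unfolding abelian_subgroupoid_def
  proof (intro conjI ballI impI)
    show "subgroupoid (core_bundle T) diag" by (rule subgroupoid_core_bundle)
    show "Dom diag a = Cod diag a" if "a \<in> core_bundle T" for a
      using core_bundle_ends[OF that] by simp
    show "a \<cdot>\<^bsub>diag\<^esub> b = b \<cdot>\<^bsub>diag\<^esub> a"
      if "a \<in> core_bundle T" "b \<in> core_bundle T" "Cod diag a = Dom diag b" for a b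
      using bundle_mult[OF that(1,2)] bundle_mult(1)[OF that(2,1)] that(3) core_bundle_ends[OF that(1)] by simp
  qed
  show "conj_arr diag h a \<in> core_bundle T" if "h \<in> HH" "a \<in> core_bundle T" "Cod diag h = Dom diag a" for h a
    using that subgroupoid_HH by (intro conj_core_bundle) (auto simp: subgroupoid_def)
  show "conj_arr diag h a \<in> core_bundle T" if "h \<in> KK" "a \<in> core_bundle T" "Cod diag h = Dom diag a" for h a
    using that subgroupoid_KK by (intro conj_core_bundle) (auto simp: subgroupoid_def)
qed

text \<open>The element of the core bundle by which \<open>X\<close> differs from the canonical square with the same
  boundary.\<close>

definition defect :: "'s \<Rightarrow> 's" where
  "defect X = X \<bullet> inverse_arr diag (sec X)"

text \<open>\<open>sec\<close> fixes \<open>sec X\<close> and therefore its inverse, so it sends the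
  quotient \<open>X (sec X)\<^sup>-\<^sup>1\<close> to an identity.\<close>

lemma defect_simps:
  assumes X: "X \<in> Sqr T"
  shows "defect X \<in> core_bundle T" "Dom diag (defect X) = Dom diag X" "defect X \<bullet> sec X = X"
proof -
  note s = sec_simps[OF X]
  have i: "inverse_arr diag (sec X) \<in> Arr diag" "Dom diag (inverse_arr diag (sec X)) = Cod diag X"
    "Cod diag (inverse_arr diag (sec X)) = Dom diag X"
    using diag.inv_in[of "sec X"] diag.Dom_inv[of "sec X"] diag.Cod_inv[of "sec X"] s by simp_all
  have "sec (inverse_arr diag (sec X)) = inverse_arr diag (sec X)"
    using is_functor_inverse_arr[OF groupoid_diag category_diag is_functor_sec, of "sec X"]
      canonicalD(2)[OF canonical_sec[OF X]] s by simp
  then have "sec (defect X) = Ide diag (Dom diag X)"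
    using X i sec_mult[of X] diag.inv_right[of "sec X"] s by (simp add: defect_def)
  moreover show "Dom diag (defect X) = Dom diag X"
    using X i diag.Dom_Cmp[of X "inverse_arr diag (sec X)"] by (simp add: defect_def)
  ultimately show "defect X \<in> core_bundle T"
    using X i mult_simps(1) by (simp add: core_bundle_iff defect_def)
  show "defect X \<bullet> sec X = X"
    using X i s diag.inv_left[of "sec X"] mult_Ide[of X] by (simp add: defect_def mult_assoc)
qed

lemma defect_canonical: "canonical X \<Longrightarrow> defect X = Ide diag (Dom diag X)"
  using diag.inv_right[of X] by (simp add: defect_def canonical_def)

text \<open>The splitting \<open>X = defect X \<bullet> sec X\<close> is unique: bundle elements and
  canonical squares over a common object can be prescribed independently. Surjectivity of the unit
  depends on this.\<close>

lemma defect_mult: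
  assumes "a \<in> core_bundle T" "canonical X" "Dom diag a = Dom diag X"
  shows "sec (a \<bullet> X) = X" "defect (a \<bullet> X) = a"
proof -
  note X = canonicalD[OF assms(2)] and a = core_bundle_ends[OF assms(1)]
  have "sec (a \<bullet> X) = Ide diag (Dom diag X) \<bullet> X"
    using assms a X sec_mult[of a X] by (simp add: core_bundle_iff)
  then show s: "sec (a \<bullet> X) = X"
    using X Ide_mult by simp
  show "defect (a \<bullet> X) = a"
    using assms(3) a X diag.inv_in[of X] diag.Dom_inv[of X] diag.inv_right[of X] mult_Ide[of a]
    by (simp add: defect_def s mult_assoc)
qed

text \<open>\<open>KH\<close> is the set of canonical squares, that is, the image of
  \<open>sec\<close>, and the bundle is the kernel. The splitting by \<open>defect\<close> yields
  \<open>G = AKH\<close>, and an element common to kernel and image is an identity.\<close>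

lemma fibered_semidirect_diag: "fibered_semidirect (diag, HH, KK, core_bundle T)"
  unfolding fibered_semidirect.simps
proof
  show "discrete diag (core_bundle T \<inter> set_cmp diag KK HH)"
    using core_bundle_sides(6)
    by (auto simp: discrete_def set_cmp_KK_HH core_bundle_iff[of _] identities_diag canonical_def)
  show "Arr diag = set_cmp diag (set_cmp diag (core_bundle T) KK) HH"
  proof (intro equalityI subsetI)
    fix X assume "X \<in> Arr diag"
    then have X: "X \<in> Sqr T" by simp
    have "sec X \<in> set_cmp diag KK HH"
      using canonical_sec[OF X] by (simp add: set_cmp_KK_HH)
    then obtain k h where kh: "sec X = k \<bullet> h" "k \<in> KK" "h \<in> HH" "Cod diag k = Dom diag h"
      by (auto simp: set_cmp_def)
    have kh': "k \<in> Sqr T" "h \<in> Sqr T"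
      using kh subgroupoid_HH subgroupoid_KK by (auto simp: subgroupoid_def)
    note d = defect_simps[OF X]
    have D: "Cod diag (defect X) = Dom diag k"
      using diag.Dom_Cmp[of k h] kh kh' d core_bundle_ends[OF d(1)] sec_simps[OF X] by simp
    have "X = (defect X \<bullet> k) \<bullet> h"
      using d(3) kh kh' D core_bundle_ends[OF d(1)] by (simp add: mult_assoc)
    moreover have "Cod diag (defect X \<bullet> k) = Dom diag h"
      using diag.Cod_Cmp[of "defect X" k] kh(4) kh' D core_bundle_ends[OF d(1)] by simp
    ultimately show "X \<in> set_cmp diag (set_cmp diag (core_bundle T) KK) HH"
      using d(1) kh D unfolding set_cmp_def
      by (intro CollectI exI[of _ "defect X \<bullet> k"] exI[of _ h]) auto
  next
    fix X assume "X \<in> set_cmp diag (set_cmp diag (core_bundle T) KK) HH"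
    then show "X \<in> Arr diag"
      using subgroupoid_HH subgroupoid_KK core_bundle_ends(1) diag.Cmp_in
      unfolding set_cmp_def subgroupoid_def by (smt (verit) diag_sel(2) mem_Collect_eq subset_iff)
  qed
qed

text \<open>Let \<open>N\<close> be the bracketed factor; its left side is an identity, so the lower
  left filler of \<open>X \<bullet> N\<close> is an identity square. The upper right filler placed
  above \<open>N\<close> gives \<open>hid k \<bullet> N = Y\<close>. Interchange evaluates the array
  by columns, which are \<open>X\<close> and \<open>Y\<close>.\<close>

lemma hcomp_eq_mult:
  assumes "X \<in> Sqr T" "Y \<in> Sqr T" "sRight T X = sLeft T Y"
  shows "X \<circ>\<^sub>h Y = X \<bullet> (inverse_arr diag (hid (sRight T X)) \<bullet> Y)"
proof -
  define k where "k = sRight T X"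
  have k: "k \<in> Arr (Ver T)" "sLeft T Y = k" "sRight T X = k"
    using assms by (simp_all add: k_def sides_in)
  define N where "N = hid (inverse_arr (Ver T) k) \<bullet> Y"
  have N: "N \<in> Sqr T" "sLeft T N = Ide (Ver T) (Cod (Ver T) k)"
    using k assms(2) by (simp_all add: N_def mult_simps hid_simps Ver.inv_in Ver.Dom_inv Ver.Cod_inv tr_Ide Ver.inv_left)
  have Y: "hid k \<bullet> N = Y"
    using diag.inv_cancel_left'[of "hid k" Y] k assms(2) by (simp add: N_def hid_simps inv_hid)
  have e: "Cod (Ver T) k \<in> Obj (Hor T)"
    using k by (simp add: ends_in)
  have tN: "sTop T N \<in> Arr (Hor T)" "Dom (Hor T) (sTop T N) = Cod (Ver T) k"
    using N e by (simp_all add: sides_in corner_simps Ide_Ver_in)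
  have bX: "sBot T X \<in> Arr (Hor T)" "Cod (Hor T) (sBot T X) = Cod (Ver T) k"
    using assms(1) k by (simp_all add: sides_in corner_simps)
  define S where "S = lb k (sTop T N)"
  have S: "S \<in> Sqr T" "sLeft T S = k" "sBot T S = sTop T N"
    using lb_simps[OF k(1) tN(1)] tN(2) by (simp_all add: S_def)
  have "X \<bullet> N = (X \<circ>\<^sub>h S) \<circ>\<^sub>v (vid (sBot T X) \<circ>\<^sub>h N)"
    using bX by (simp add: mult_def k N S_def tr_Ide)
  also have "\<dots> = (X \<circ>\<^sub>v vid (sBot T X)) \<circ>\<^sub>h (S \<circ>\<^sub>v N)"
    by (rule interchange) (simp_all add: assms S N vid_simps bX k)
  also have "X \<circ>\<^sub>v vid (sBot T X) = X"
    by (simp add: vcomp_id assms)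
  also have "S \<circ>\<^sub>v N = Y"
    using Y k N e by (simp add: hid_mult S_def Ide_Ver_in)
  finally show ?thesis
    by (simp add: N_def k inv_hid)
qed

text \<open>Now the bracketed factor \<open>N\<close> has an identity as its top side. The array is
  composed by rows: the upper row is \<open>X\<close> with an identity square attached, and the
  lower row is \<open>vid h \<bullet> N = Y\<close>.\<close>

lemma vcomp_eq_mult:
  assumes "X \<in> Sqr T" "Y \<in> Sqr T" "sBot T X = sTop T Y"
  shows "X \<circ>\<^sub>v Y = X \<bullet> (inverse_arr diag (vid (sBot T X)) \<bullet> Y)"
proof -
  define h where "h = sBot T X"
  have h: "h \<in> Arr (Hor T)" "sTop T Y = h" "sBot T X = h"
    using assms by (simp_all add: h_def sides_in)
  have cY: "Dom (Ver T) (sLeft T Y) = Dom (Hor T) h" and cX: "Cod (Ver T) (sRight T X) = Cod (Hor T) h"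
    using corner_simps[OF assms(2)] corner_simps[OF assms(1)] h by simp_all
  have e: "Dom (Hor T) h \<in> Obj (Hor T)" "Cod (Hor T) h \<in> Obj (Hor T)"
    using h by (simp_all add: Hor.Dom_in Hor.Cod_in)
  define N where "N = vid (inverse_arr (Hor T) h) \<bullet> Y"
  have N: "N \<in> Sqr T" "sTop T N = Ide (Hor T) (Cod (Hor T) h)"
    using h assms(2) e by (simp_all add: N_def mult_simps vid_simps Hor.inv_in Hor.Dom_inv Hor.Cod_inv
        lb_Ide Hor.inv_left Ide_Ver_in cY)
  have Y: "vid h \<bullet> N = Y"
    using diag.inv_cancel_left'[of "vid h" Y] h assms(2) e by (simp add: N_def vid_simps inv_vid Ide_Ver_in cY)
  have lN: "sLeft T N \<in> Arr (Ver T)" "Dom (Ver T) (sLeft T N) = Cod (Hor T) h"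
    using N e corner_simps(1)[OF N(1)] by (simp_all add: sides_in Hor.cat_simps)
  have "X \<bullet> N = X \<circ>\<^sub>v (tr h (sLeft T N) \<circ>\<^sub>h N)"
    using assms(1) by (simp add: mult_def h N lb_Ide sides_in cX hcomp_id)
  also have "tr h (sLeft T N) \<circ>\<^sub>h N = Y"
    using Y h N lN by (simp add: vid_mult)
  finally show ?thesis
    by (simp add: N_def h inv_vid)
qed

end

section \<open>Defects of composite squares\<close>

lemma (in groupoid) cancel_middle:
  assumes "t \<in> Arr C" "r \<in> Arr C" "d \<in> Arr C" "Cod C t = Dom C r" "Dom C d = Dom C r"
  shows "(t \<cdot> r) \<cdot> (inverse_arr C r \<cdot> d) = t \<cdot> d"
  using assms by (simp add: grp_simps)

text \<open>The computation behind both defect formulas, isolated from squares. In use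
  \<open>r\<close> is the common side, \<open>t \<cdot> r\<close> is \<open>sec X\<close> and
  \<open>d\<close> is \<open>sec Y\<close>, so that the left side is the defect of the
  composite.\<close>

lemma (in groupoid) quotient_Cmp:
  assumes "t \<in> Arr C" "r \<in> Arr C" "X \<in> Arr C" "Y \<in> Arr C" "d \<in> Arr C"
    "Cod C t = Dom C r" "Dom C t = Dom C X" "Cod C r = Cod C X" "Dom C Y = Dom C r"
    "Dom C d = Dom C Y" "Cod C d = Cod C Y"
  shows "(X \<cdot> (inverse_arr C r \<cdot> Y)) \<cdot> inverse_arr C (t \<cdot> d) =
    (X \<cdot> inverse_arr C (t \<cdot> r)) \<cdot> conj_arr C t (Y \<cdot> inverse_arr C d)"
  using assms by (simp add: conj_arr_def grp_simps)

context max_excl_groupoid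
begin

lemma sec_eq_mult:
  assumes "X \<in> Sqr T"
  shows "sec X = vid (sTop T X) \<bullet> hid (sRight T X)" "sec X = hid (sLeft T X) \<bullet> vid (sBot T X)"
  using canonical_eq_vid_hid[OF canonical_sec[OF assms]] canonical_eq_hid_vid[OF canonical_sec[OF assms]]
  unfolding sec_simps[OF assms] .

lemma vid_diag:
  assumes "h \<in> Arr (Hor T)"
  shows "vid h \<in> Arr diag" "Dom diag (vid h) = Dom (Hor T) h" "Cod diag (vid h) = Cod (Hor T) h"
  using functor_simps[OF is_functor_vid] assms by simp_all

lemma hid_diag:
  assumes "k \<in> Arr (Ver T)"
  shows "hid k \<in> Arr diag" "Dom diag (hid k) = Dom (Ver T) k" "Cod diag (hid k) = Cod (Ver T) k"
  using functor_simps[OF is_functor_hid] assms by simp_all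

text \<open>This is the bundle coordinate of \<open>\<circ>\<^sub>h\<close> in
  \<open>\<Gamma>\<close>. The common side cancels in \<open>sec X \<circ>\<^sub>h sec Y\<close>,
  leaving the top of \<open>X\<close> times \<open>sec Y\<close>.\<close>

lemma defect_hcomp:
  assumes X: "X \<in> Sqr T" and Y: "Y \<in> Sqr T" and XY: "sRight T X = sLeft T Y"
  shows "defect (X \<circ>\<^sub>h Y) = defect X \<bullet> conj_arr diag (vid (sTop T X)) (defect Y)"
proof -
  define t where "t = vid (sTop T X)"
  define r where "r = hid (sRight T X)"
  have t: "t \<in> Arr diag" "Dom diag t = Dom diag X" "Cod diag t = Dom diag Y"
    unfolding t_def using X Y XY vid_diag[of "sTop T X"] by (simp_all add: sides_in corner_simps)
  have r: "r \<in> Arr diag" "Dom diag r = Dom diag Y" "Cod diag r = Cod diag X"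
    unfolding r_def using X Y XY hid_diag[of "sRight T X"] by (simp_all add: sides_in)
  note s = sec_simps[OF X] sec_simps[OF Y]
  have sX: "sec X = t \<bullet> r"
    unfolding t_def r_def by (rule sec_eq_mult(1)[OF X])
  have "sec (X \<circ>\<^sub>h Y) = sec X \<circ>\<^sub>h sec Y"
    by (rule sec_hcomp[OF X Y XY])
  also have "\<dots> = sec X \<bullet> (inverse_arr diag r \<bullet> sec Y)"
    using hcomp_eq_mult[of "sec X" "sec Y"] XY s by (simp add: r_def)
  also have "\<dots> = (t \<bullet> r) \<bullet> (inverse_arr diag r \<bullet> sec Y)"
    by (simp only: sX)
  also have "\<dots> = t \<bullet> sec Y"
    by (rule diag.cancel_middle[of t r "sec Y", unfolded diag_sel(6)]) (use t r Y in \<open>simp_all add: sec_simps\<close>)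
  finally have e: "sec (X \<circ>\<^sub>h Y) = t \<bullet> sec Y" .
  have "defect (X \<circ>\<^sub>h Y) = (X \<bullet> (inverse_arr diag r \<bullet> Y)) \<bullet> inverse_arr diag (t \<bullet> sec Y)"
    by (simp only: defect_def e) (simp only: hcomp_eq_mult[OF X Y XY] r_def)
  also have "\<dots> = (X \<bullet> inverse_arr diag (t \<bullet> r)) \<bullet> conj_arr diag t (Y \<bullet> inverse_arr diag (sec Y))"
    by (rule diag.quotient_Cmp[of t r X Y "sec Y", unfolded diag_sel(6)])
      (use t r X Y in \<open>simp_all add: sec_simps\<close>)
  also have "\<dots> = defect X \<bullet> conj_arr diag t (defect Y)"
    by (simp only: defect_def sX)
  finally show ?thesis
    by (simp only: t_def)
qed

text \<open>Here \<open>t\<close> is the left side and \<open>r\<close> the bottom side of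
  \<open>X\<close>, so the other factorisation of \<open>sec X\<close> takes over; hence conjugation
  by a vertical arrow.\<close>

lemma defect_vcomp:
  assumes X: "X \<in> Sqr T" and Y: "Y \<in> Sqr T" and XY: "sBot T X = sTop T Y"
  shows "defect (X \<circ>\<^sub>v Y) = defect X \<bullet> conj_arr diag (hid (sLeft T X)) (defect Y)"
proof -
  define t where "t = hid (sLeft T X)"
  define r where "r = vid (sBot T X)"
  have c: "Dom (Hor T) (sTop T Y) = Cod (Ver T) (sLeft T X)" "Cod (Hor T) (sTop T Y) = Cod (Ver T) (sRight T X)"
    "Dom (Ver T) (sLeft T Y) = Cod (Ver T) (sLeft T X)"
    using corner_simps[OF X] corner_simps[OF Y] XY by simp_all
  have t: "t \<in> Arr diag" "Dom diag t = Dom diag X" "Cod diag t = Dom diag Y"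
    unfolding t_def using X hid_diag[of "sLeft T X"] c by (simp_all add: sides_in)
  have r: "r \<in> Arr diag" "Dom diag r = Dom diag Y" "Cod diag r = Cod diag X"
    unfolding r_def using X Y XY vid_diag[of "sBot T X"] c by (simp_all add: sides_in)
  note s = sec_simps[OF X] sec_simps[OF Y]
  have sX: "sec X = t \<bullet> r"
    unfolding t_def r_def by (rule sec_eq_mult(2)[OF X])
  have "sec (X \<circ>\<^sub>v Y) = sec X \<circ>\<^sub>v sec Y"
    by (rule sec_vcomp[OF X Y XY])
  also have "\<dots> = sec X \<bullet> (inverse_arr diag r \<bullet> sec Y)"
    using vcomp_eq_mult[of "sec X" "sec Y"] XY s by (simp add: r_def)
  also have "\<dots> = (t \<bullet> r) \<bullet> (inverse_arr diag r \<bullet> sec Y)"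
    by (simp only: sX)
  also have "\<dots> = t \<bullet> sec Y"
    by (rule diag.cancel_middle[of t r "sec Y", unfolded diag_sel(6)]) (use t r Y in \<open>simp_all add: sec_simps\<close>)
  finally have e: "sec (X \<circ>\<^sub>v Y) = t \<bullet> sec Y" .
  have "defect (X \<circ>\<^sub>v Y) = (X \<bullet> (inverse_arr diag r \<bullet> Y)) \<bullet> inverse_arr diag (t \<bullet> sec Y)"
    by (simp only: defect_def e) (simp only: vcomp_eq_mult[OF X Y XY] r_def)
  also have "\<dots> = (X \<bullet> inverse_arr diag (t \<bullet> r)) \<bullet> conj_arr diag t (Y \<bullet> inverse_arr diag (sec Y))"
    by (rule diag.quotient_Cmp[of t r X Y "sec Y", unfolded diag_sel(6)])
      (use t r X Y in \<open>simp_all add: sec_simps\<close>)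
  also have "\<dots> = defect X \<bullet> conj_arr diag t (defect Y)"
    by (simp only: defect_def sX)
  finally show ?thesis
    by (simp only: t_def)
qed

end

section \<open>The functor \<open>\<Lambda>\<close>\<close>

lemma max_excl_groupoidI: "is_max_excl (T, s) \<Longrightarrow> max_excl_groupoid T s"
  by (simp add: max_excl_groupoid_def max_excl_groupoid_axioms_def)

lemma double_functor_sides:
  assumes "double_functor T T' Fo Fh Fv Fs" "double_category T" "X \<in> Sqr T"
  shows "sLeft T' (Fs X) = Fv (sLeft T X)" "sRight T' (Fs X) = Fv (sRight T X)"
    "sTop T' (Fs X) = Fh (sTop T X)" "sBot T' (Fs X) = Fh (sBot T X)"
  using assms double_category.Arr_VSq[of T]
  by (simp_all add: double_functor_def is_functor_Dom is_functor_Cod)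

locale section_preserving = A: max_excl_groupoid T s + B: max_excl_groupoid T' s'
  for T :: "('o, 'h, 'v, 's) dcat" and s and T' :: "('p, 'i, 'w, 't) dcat" and s' +
  fixes Fo Fh Fv Fs
  assumes F: "double_functor T T' Fo Fh Fv Fs"
    and F_sec: "X \<in> Sqr T \<Longrightarrow> Fs (A.sec X) = B.sec (Fs X)"
begin

lemma F_Hor: "is_functor (Hor T) (Hor T') Fo Fh" and F_Ver: "is_functor (Ver T) (Ver T') Fo Fv"
  and F_HSq: "is_functor (HSq T) (HSq T') Fv Fs" and F_VSq: "is_functor (VSq T) (VSq T') Fh Fs"
  using F by (auto simp: double_functor_def)

lemmas F_sides = double_functor_sides[OF F A.double_category_axioms]

lemma F_in: "x \<in> Obj (Hor T) \<Longrightarrow> Fo x \<in> Obj (Hor T')" "h \<in> Arr (Hor T) \<Longrightarrow> Fh h \<in> Arr (Hor T')"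
  "k \<in> Arr (Ver T) \<Longrightarrow> Fv k \<in> Arr (Ver T')" "X \<in> Sqr T \<Longrightarrow> Fs X \<in> Sqr T'"
  using A.double_functor_Pi[OF F B.double_category_axioms] by auto

lemma F_hid: "k \<in> Arr (Ver T) \<Longrightarrow> Fs (A.hid k) = B.hid (Fv k)"
  using is_functor_Ide[OF F_HSq] by (simp add: A.Obj_HSq)

lemma F_vid: "h \<in> Arr (Hor T) \<Longrightarrow> Fs (A.vid h) = B.vid (Fh h)"
  using is_functor_Ide[OF F_VSq] by (simp add: A.Obj_VSq)

lemma F_hcomp: "\<lbrakk>X \<in> Sqr T; Y \<in> Sqr T; sRight T X = sLeft T Y\<rbrakk> \<Longrightarrow> Fs (A.hc X Y) = B.hc (Fs X) (Fs Y)"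
  using is_functor_Cmp[OF F_HSq] by simp

lemma F_vcomp: "\<lbrakk>X \<in> Sqr T; Y \<in> Sqr T; sBot T X = sTop T Y\<rbrakk> \<Longrightarrow> Fs (A.vc X Y) = B.vc (Fs X) (Fs Y)"
  using is_functor_Cmp[OF F_VSq] by (simp add: A.Arr_VSq)

lemma F_canonical: "A.canonical X \<Longrightarrow> B.canonical (Fs X)"
  using F_sec[of X] F_in(4)[of X] by (simp add: A.canonical_def B.canonical_def)

text \<open>Preservation of the section makes the image of a canonical square canonical. So fillers
  go to squares with the defining properties of fillers, and uniqueness identifies them.\<close>

lemma F_mult:
  assumes "X \<in> Sqr T" "Y \<in> Sqr T" "Cod (Ver T) (sRight T X) = Dom (Ver T) (sLeft T Y)"
  shows "Fs (A.mult X Y) = B.mult (Fs X) (Fs Y)"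
proof -
  note f = A.fill_simps[OF assms]
  have "B.lb (sRight T' (Fs X)) (sTop T' (Fs Y)) = Fs (A.lb (sRight T X) (sTop T Y))"
    by (rule B.lb_eqI) (simp_all add: F_canonical f F_sides assms)
  moreover have "B.tr (sBot T' (Fs X)) (sLeft T' (Fs Y)) = Fs (A.tr (sBot T X) (sLeft T Y))"
    by (rule B.tr_eqI) (simp_all add: F_canonical f F_sides assms)
  ultimately show ?thesis
    unfolding A.mult_def B.mult_def using assms by (simp add: F_vcomp F_hcomp A.hcomp_simps f)
qed

lemma F_Dom_Cod:
  "k \<in> Arr (Ver T) \<Longrightarrow> Dom (Ver T') (Fv k) = Fo (Dom (Ver T) k)"
  "k \<in> Arr (Ver T) \<Longrightarrow> Cod (Ver T') (Fv k) = Fo (Cod (Ver T) k)"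
  "x \<in> Obj (Hor T) \<Longrightarrow> Fv (Ide (Ver T) x) = Ide (Ver T') (Fo x)"
  using functor_simps[OF F_Ver] by (simp_all add: A.Obj_Ver)

lemma is_functor_diag: "is_functor A.diag B.diag Fo Fs"
  by (rule is_functorI) (simp_all add: F_in F_sides F_hid F_mult F_Dom_Cod A.sides_in A.Ide_Ver_in)

lemma F_defect: "X \<in> Sqr T \<Longrightarrow> Fs (A.defect X) = B.defect (Fs X)"
  using is_functor_Cmp[OF is_functor_diag, of X "inverse_arr A.diag (A.sec X)"]
    is_functor_inverse_arr[OF A.groupoid_diag B.category_diag is_functor_diag, of "A.sec X"]
    A.diag.inv_in[of "A.sec X"] A.diag.Dom_inv[of "A.sec X"] A.sec_simps[of X] F_sec[of X]
  by (simp add: A.defect_def B.defect_def)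

lemma F_core_bundle: "a \<in> core_bundle T \<Longrightarrow> Fs a \<in> core_bundle T'"
  using F_sec[of a] is_functor_Ide[OF is_functor_diag, of "Dom A.diag a"]
    is_functor_Dom[OF is_functor_diag, of a] A.diag.Dom_in[of a] F_in(4)[of a]
  unfolding A.core_bundle_iff B.core_bundle_iff by simp

lemma F_HH_KK: "Fs ` A.HH \<subseteq> B.HH" "Fs ` A.KK \<subseteq> B.KK"
  by (auto simp: A.HH_def B.HH_def A.KK_def B.KK_def F_vid F_hid F_in)

end

fun Lambda_obj :: "('o, 'u) max_excl \<Rightarrow> ('o, 'u) quad" where
  "Lambda_obj (T, s) =
     (max_excl_groupoid.diag T s, max_excl_groupoid.HH T, max_excl_groupoid.KK T, core_bundle T)"

fun Lambda_arr :: "('o, 'u) max_excl_arr \<Rightarrow> ('o, 'u) quad_arr" where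
  "Lambda_arr (\<tau>, (Fo, Fh, Fv, Fs), \<tau>') = (Lambda_obj \<tau>, (Fo, Fs), Lambda_obj \<tau>')"

lemma section_preservingI:
  assumes "is_max_excl (T, s)" "is_max_excl (T', s')" "is_max_excl_map (T, s) (Fo, Fh, Fv, Fs) (T', s')"
  shows "section_preserving T s T' s' Fo Fh Fv Fs"
proof -
  interpret A: max_excl_groupoid T s by (rule max_excl_groupoidI) fact
  interpret B: max_excl_groupoid T' s' by (rule max_excl_groupoidI) fact
  show ?thesis
    using assms(3) unfolding is_max_excl_map_iff[OF A.double_category_axioms]
    by unfold_locales (auto simp: A.sec_def B.sec_def)
qed

lemma is_quad_Lambda: "is_max_excl \<tau> \<Longrightarrow> is_quad (Lambda_obj \<tau>)"
  using max_excl_groupoid.is_quad_diag[OF max_excl_groupoidI] by (cases \<tau>) (simp del: is_quad.simps is_max_excl.simps)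

lemma fibered_semidirect_Lambda: "is_max_excl \<tau> \<Longrightarrow> fibered_semidirect (Lambda_obj \<tau>)"
  using max_excl_groupoid.fibered_semidirect_diag[OF max_excl_groupoidI]
  by (cases \<tau>) (simp del: fibered_semidirect.simps is_max_excl.simps)

lemma is_functor_Lambda: "is_functor MaxExcl TwoSemi Lambda_obj Lambda_arr"
proof (rule is_functorI)
  fix \<tau> :: "('o, 'u) max_excl" assume "\<tau> \<in> Obj MaxExcl"
  then have \<tau>: "is_max_excl \<tau>" by simp
  show "Lambda_obj \<tau> \<in> Obj TwoSemi"
    using is_quad_Lambda[OF \<tau>] by simp
  obtain T s where \<tau>': "\<tau> = (T, s)" by (cases \<tau>)
  interpret max_excl_groupoid T s using \<tau> max_excl_groupoidI unfolding \<tau>' by blast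
  show "Lambda_arr (Ide MaxExcl \<tau>) = Ide TwoSemi (Lambda_obj \<tau>)"
    by (simp add: \<tau>')
next
  fix f :: "('o, 'u) max_excl_arr" assume f: "f \<in> Arr MaxExcl"
  obtain T s Fo Fh Fv Fs T' s' where f': "f = ((T, s), (Fo, Fh, Fv, Fs), (T', s'))" by (metis prod.exhaust)
  have a: "is_max_excl (T, s)" "is_max_excl (T', s')" "is_max_excl_map (T, s) (Fo, Fh, Fv, Fs) (T', s')"
    using f unfolding f' by (simp_all only: MaxExcl_sel)
  interpret section_preserving T s T' s' Fo Fh Fv Fs
    using section_preservingI[OF a] .
  have "Fo \<in> extensional (Obj (Hor T))" "Fs \<in> extensional (Sqr T)"
    using a(3) by simp_all
  then have "is_quad_map (Lambda_obj (T, s)) (Fo, Fs) (Lambda_obj (T', s'))"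
    using is_functor_diag F_HH_KK F_core_bundle by (auto simp: image_subset_iff)
  then show "Lambda_arr f \<in> Arr TwoSemi"
    using is_quad_Lambda a unfolding f' Lambda_arr.simps TwoSemi_sel by blast
  show "Dom TwoSemi (Lambda_arr f) = Lambda_obj (Dom MaxExcl f)"
    "Cod TwoSemi (Lambda_arr f) = Lambda_obj (Cod MaxExcl f)"
    by (simp_all add: f' del: Lambda_obj.simps)
  fix g :: "('o, 'u) max_excl_arr" assume g: "g \<in> Arr MaxExcl" "Cod MaxExcl f = Dom MaxExcl g"
  obtain Eo Eh Ev Es Z where g': "g = ((T', s'), (Eo, Eh, Ev, Es), Z)"
    using g(2) f' by (cases g) auto
  show "Lambda_arr (f \<cdot>\<^bsub>MaxExcl\<^esub> g) = Lambda_arr f \<cdot>\<^bsub>TwoSemi\<^esub> Lambda_arr g"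
    by (simp add: f' g')
qed

section \<open>The unit\<close>

lemma restrict_inv_into:
  assumes "bij_betw f A B"
  shows "y \<in> B \<Longrightarrow> restrict (inv_into A f) B y \<in> A" "y \<in> B \<Longrightarrow> f (restrict (inv_into A f) B y) = y"
    "x \<in> A \<Longrightarrow> restrict (inv_into A f) B (f x) = x"
  using assms by (auto simp: bij_betw_def inv_into_into f_inv_into_f)

lemma compose_restrict_inv_into:
  assumes "bij_betw f A B"
  shows "compose A (restrict (inv_into A f) B) f = (\<lambda>x\<in>A. x)"
    "compose B f (restrict (inv_into A f) B) = (\<lambda>y\<in>B. y)"
  using assms by (auto simp: compose_def bij_betw_def f_inv_into_f intro!: restrict_ext)

text \<open>The inverse maps are double functors by \<open>is_functor_inverse_functor\<close>. They
  preserve the sections because \<open>Fs\<close> does: apply \<open>F_sec\<close> to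
  \<open>Gs Y\<close> and cancel.\<close>

lemma isomorphism_MaxExclI:
  assumes f: "((T, s), (Fo, Fh, Fv, Fs), (T', s')) \<in> Arr MaxExcl"
    and bij: "bij_betw Fo (Obj (Hor T)) (Obj (Hor T'))" "bij_betw Fh (Arr (Hor T)) (Arr (Hor T'))"
      "bij_betw Fv (Arr (Ver T)) (Arr (Ver T'))" "bij_betw Fs (Sqr T) (Sqr T')"
  shows "isomorphism MaxExcl ((T, s), (Fo, Fh, Fv, Fs), (T', s'))"
proof -
  have a: "is_max_excl (T, s)" "is_max_excl (T', s')" "is_max_excl_map (T, s) (Fo, Fh, Fv, Fs) (T', s')"
    using f by (simp_all only: MaxExcl_sel)
  interpret section_preserving T s T' s' Fo Fh Fv Fs
    using section_preservingI[OF a] .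
  define Go where "Go = restrict (inv_into (Obj (Hor T)) Fo) (Obj (Hor T'))"
  define Gh where "Gh = restrict (inv_into (Arr (Hor T)) Fh) (Arr (Hor T'))"
  define Gv where "Gv = restrict (inv_into (Arr (Ver T)) Fv) (Arr (Ver T'))"
  define Gs where "Gs = restrict (inv_into (Sqr T) Fs) (Sqr T')"
  note o = restrict_inv_into[OF bij(1), folded Go_def] and h = restrict_inv_into[OF bij(2), folded Gh_def]
    and v = restrict_inv_into[OF bij(3), folded Gv_def] and s = restrict_inv_into[OF bij(4), folded Gs_def]
  have "double_functor T' T Go Gh Gv Gs"
    unfolding double_functor_def
  proof (intro conjI)
    show "is_functor (Hor T') (Hor T) Go Gh"
      by (rule is_functor_inverse_functor[OF A.cat_Hor F_Hor]) (simp_all add: o h)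
    show "is_functor (Ver T') (Ver T) Go Gv"
      by (rule is_functor_inverse_functor[OF A.cat_Ver F_Ver]) (simp_all add: o v A.Obj_Ver B.Obj_Ver)
    show "is_functor (HSq T') (HSq T) Gv Gs"
      by (rule is_functor_inverse_functor[OF A.cat_HSq F_HSq]) (simp_all add: s v A.Obj_HSq B.Obj_HSq)
    show "is_functor (VSq T') (VSq T) Gh Gs"
      by (rule is_functor_inverse_functor[OF A.cat_VSq F_VSq])
        (simp_all add: s h A.Obj_VSq B.Obj_VSq A.Arr_VSq B.Arr_VSq)
  qed
  moreover have "Gs (s' (proj_frame T' Y)) = s (proj_frame T (Gs Y))" if "Y \<in> Sqr T'" for Y
    using F_sec[of "Gs Y"] s(3)[of "A.sec (Gs Y)"] A.sec_simps(1)[of "Gs Y"] s(1,2)[OF that]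
    by (simp add: A.sec_def B.sec_def)
  ultimately have m: "is_max_excl_map (T', s') (Go, Gh, Gv, Gs) (T, s)"
    unfolding is_max_excl_map_iff[OF B.double_category_axioms] by (simp add: Go_def Gh_def Gv_def Gs_def)
  have "is_inverse MaxExcl ((T, s), (Fo, Fh, Fv, Fs), (T', s')) ((T', s'), (Go, Gh, Gv, Gs), (T, s))"
    unfolding is_inverse_def MaxExcl_sel max_excl_comp.simps max_excl_id.simps
    using a m by (simp add: Go_def Gh_def Gv_def Gs_def compose_restrict_inv_into bij
        del: is_max_excl.simps is_max_excl_map.simps)
  then show ?thesis
    unfolding isomorphism_def by blast
qed

locale max_excl_unit = max_excl_groupoid T s
  for T :: "('o, 'u, 'u, 'u) dcat" and s +
  fixes pr :: "'u \<times> 'u \<Rightarrow> 'u"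
  assumes inj_pr: "inj pr"

sublocale max_excl_unit \<subseteq> Q: gamma diag HH KK "core_bundle T" pr
  by unfold_locales (fact is_quad_diag, fact inj_pr)

context max_excl_unit
begin

definition unit_sq :: "'u \<Rightarrow> 'u" where
  "unit_sq = (\<lambda>X\<in>Sqr T. Q.sq (vid (sTop T X)) (hid (sRight T X)) (hid (sLeft T X)) (vid (sBot T X)) (defect X))"

definition unit_map :: "('o, 'u) dmap" where
  "unit_map = (\<lambda>x\<in>Obj (Hor T). x, \<lambda>h\<in>Arr (Hor T). vid h, \<lambda>k\<in>Arr (Ver T). hid k, unit_sq)"

lemma HH_KK_memI: "h \<in> Arr (Hor T) \<Longrightarrow> vid h \<in> HH" "k \<in> Arr (Ver T) \<Longrightarrow> hid k \<in> KK"
  by (simp_all add: HH_def KK_def)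

lemma Cmp_vid: "\<lbrakk>h \<in> Arr (Hor T); g \<in> Arr (Hor T); Cod (Hor T) h = Dom (Hor T) g\<rbrakk> \<Longrightarrow>
    vid (h \<cdot>\<^bsub>Hor T\<^esub> g) = vid h \<bullet> vid g"
  using is_functor_Cmp[OF is_functor_vid] by simp

lemma Cmp_hid: "\<lbrakk>k \<in> Arr (Ver T); l \<in> Arr (Ver T); Cod (Ver T) k = Dom (Ver T) l\<rbrakk> \<Longrightarrow>
    hid (k \<cdot>\<^bsub>Ver T\<^esub> l) = hid k \<bullet> hid l"
  using is_functor_Cmp[OF is_functor_hid] by simp

lemma unit_sq_mem:
  assumes X: "X \<in> Sqr T"
  shows "unit_sq X \<in> Sqr Q.\<Gamma>"
proof -
  note d = defect_simps[OF X]
  have "Cod diag (vid (sTop T X)) = Dom diag (hid (sRight T X))"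
    "Cod diag (hid (sLeft T X)) = Dom diag (vid (sBot T X))"
    "Dom diag (defect X) = Dom diag (vid (sTop T X))"
    unfolding d(2) vid_diag[OF sides_in(3)[OF X]] vid_diag[OF sides_in(4)[OF X]]
      hid_diag[OF sides_in(1)[OF X]] hid_diag[OF sides_in(2)[OF X]] corner_simps[OF X] by simp_all
  \<comment> \<open>The boundary commutes because both products are factorisations of
    \<open>sec X\<close>.\<close>
  moreover have "vid (sTop T X) \<cdot>\<^bsub>diag\<^esub> hid (sRight T X) = hid (sLeft T X) \<cdot>\<^bsub>diag\<^esub> vid (sBot T X)"
    unfolding diag_sel(6) using sec_eq_mult[OF X] by (rule trans[OF sym])
  ultimately show ?thesis
    using X d(1) unfolding Q.Gamma_sel unit_sq_def restrict_apply
    by (simp only: Q.sq_mem_iff HH_KK_memI sides_in simp_thms if_True)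
qed

text \<open>Sides compose because \<open>vid\<close> is a functor, and the bundle coordinates
  compose by \<open>defect_hcomp\<close>; identity squares are canonical, so their defect is
  trivial.\<close>

lemma is_functor_HSq_unit: "is_functor (HSq T) (HSq Q.\<Gamma>) (\<lambda>k\<in>Arr (Ver T). hid k) unit_sq"
proof (rule is_functorI)
  show "unit_sq (hid k) = Ide (HSq Q.\<Gamma>) ((\<lambda>k\<in>Arr (Ver T). hid k) k)" if "k \<in> Obj (HSq T)" for k
  proof -
    have k: "k \<in> Arr (Ver T)" using that by (simp add: Obj_HSq)
    then have "defect (hid k) = Ide diag (Dom diag (hid k))"
      by (intro defect_canonical canonical_intros)
    with k show ?thesis
      by (simp add: unit_sq_def hid_simps Q.Gamma_sel hid_vid ends_in)
  qed
  show "unit_sq (X \<circ>\<^sub>h Y) = unit_sq X \<cdot>\<^bsub>HSq Q.\<Gamma>\<^esub> unit_sq Y"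
    if X: "X \<in> Sqr T" and Y: "Y \<in> Sqr T" and XY: "sRight T X = sLeft T Y" for X Y
  proof -
    have c: "Cod (Hor T) (sTop T X) = Dom (Hor T) (sTop T Y)" "Cod (Hor T) (sBot T X) = Dom (Hor T) (sBot T Y)"
      using corner_simps[OF X] corner_simps[OF Y] XY by simp_all
    show ?thesis
      using X Y XY by (simp add: unit_sq_def hcomp_simps Cmp_vid sides_in c Q.Gamma_sel defect_hcomp)
  qed
qed (simp_all add: Obj_HSq unit_sq_mem HH_KK_memI sides_in, simp_all add: Q.Gamma_sel HH_KK_memI unit_sq_def)

lemma is_functor_VSq_unit: "is_functor (VSq T) (VSq Q.\<Gamma>) (\<lambda>h\<in>Arr (Hor T). vid h) unit_sq"
proof (rule is_functorI)
  show "unit_sq (vid h) = Ide (VSq Q.\<Gamma>) ((\<lambda>h\<in>Arr (Hor T). vid h) h)" if "h \<in> Obj (VSq T)" for h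
  proof -
    have h: "h \<in> Arr (Hor T)" using that by (simp add: Obj_VSq)
    then have "defect (vid h) = Ide diag (Dom diag (vid h))"
      by (intro defect_canonical canonical_intros)
    with h show ?thesis
      by (simp add: unit_sq_def vid_simps Q.Gamma_sel Ide_Ver_in Hor.Dom_in Hor.Cod_in)
  qed
  show "unit_sq (X \<circ>\<^sub>v Y) = unit_sq X \<cdot>\<^bsub>VSq Q.\<Gamma>\<^esub> unit_sq Y"
    if "X \<in> Arr (VSq T)" "Y \<in> Arr (VSq T)" and XY: "sBot T X = sTop T Y" for X Y
  proof -
    have X: "X \<in> Sqr T" and Y: "Y \<in> Sqr T" using that Arr_VSq by auto
    have c: "Cod (Ver T) (sLeft T X) = Dom (Ver T) (sLeft T Y)" "Cod (Ver T) (sRight T X) = Dom (Ver T) (sRight T Y)"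
      using corner_simps[OF X] corner_simps[OF Y] XY by simp_all
    show ?thesis
      using X Y XY by (simp add: unit_sq_def vcomp_simps Cmp_hid sides_in c Q.Gamma_sel defect_vcomp)
  qed
qed (simp_all add: Obj_VSq Arr_VSq unit_sq_mem[unfolded Q.Gamma_sel(5)] sides_in Q.Gamma_sel HH_KK_memI,
    simp_all add: Q.Gamma_sel unit_sq_def)

lemma double_functor_unit:
  "double_functor T Q.\<Gamma> (\<lambda>x\<in>Obj (Hor T). x) (\<lambda>h\<in>Arr (Hor T). vid h) (\<lambda>k\<in>Arr (Ver T). hid k) unit_sq"
  unfolding double_functor_def
proof (intro conjI is_functor_HSq_unit is_functor_VSq_unit)
  show "is_functor (Hor T) (Hor Q.\<Gamma>) (\<lambda>x\<in>Obj (Hor T). x) (\<lambda>h\<in>Arr (Hor T). vid h)"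
    using functor_simps[OF is_functor_vid]
    by (intro is_functorI) (simp_all add: Q.Gamma_sel HH_KK_memI Hor.cat_simps)
  show "is_functor (Ver T) (Ver Q.\<Gamma>) (\<lambda>x\<in>Obj (Hor T). x) (\<lambda>k\<in>Arr (Ver T). hid k)"
    using functor_simps[OF is_functor_hid]
    by (intro is_functorI) (simp_all add: Q.Gamma_sel HH_KK_memI Obj_Ver ends_in Ver.Cmp_in Ide_Ver_in)
qed

lemma is_max_excl_map_unit: "is_max_excl_map (T, s) unit_map (Gamma_obj pr (Lambda_obj (T, s)))"
  unfolding unit_map_def Gamma_obj_def Lambda_obj.simps is_max_excl_map_iff[OF double_category_axioms]
proof (intro conjI ballI double_functor_unit)
  fix X assume X: "X \<in> Sqr T"
  note sX = sec_simps[OF X]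
  have "unit_sq (sec X) = Q.sq (vid (sTop T X)) (hid (sRight T X)) (hid (sLeft T X)) (vid (sBot T X))
      (Ide diag (Dom diag (vid (sTop T X))))"
    using sX X defect_canonical[OF canonical_sec[OF X]] vid_diag(2)[of "sTop T X"]
    by (simp add: unit_sq_def sides_in corner_simps)
  also have "\<dots> = Gamma_section pr (diag, HH, KK, core_bundle T) (proj_frame Q.\<Gamma> (unit_sq X))"
    using unit_sq_mem[OF X] X by (simp add: unit_sq_def Q.Gamma_section_proj_frame)
  finally show "unit_sq (s (proj_frame T X)) =
      Gamma_section pr (diag, HH, KK, core_bundle T) (proj_frame Q.\<Gamma> (unit_sq X))"
    by (simp add: sec_def)
qed (simp_all add: unit_sq_def)

text \<open>Injectivity recovers \<open>sec X\<close> from the top and right sides and then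
  \<open>X\<close> from its defect. For surjectivity, a canonical square with all four prescribed
  sides is multiplied by the prescribed bundle element.\<close>

lemma bij_betw_unit_sq: "bij_betw unit_sq (Sqr T) (Sqr Q.\<Gamma>)"
proof (rule bij_betw_imageI)
  show "inj_on unit_sq (Sqr T)"
  proof (rule inj_onI)
    fix X Y assume X: "X \<in> Sqr T" and Y: "Y \<in> Sqr T" and eq: "unit_sq X = unit_sq Y"
    then have *: "vid (sTop T X) = vid (sTop T Y)" "hid (sRight T X) = hid (sRight T Y)" "defect X = defect Y"
      by (simp_all add: unit_sq_def)
    then have "sec X = sec Y"
      using sec_eq_mult(1)[OF X] sec_eq_mult(1)[OF Y] by (simp only:)
    with * have "defect X \<bullet> sec X = defect Y \<bullet> sec Y" by (simp only:)
    then show "X = Y"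
      unfolding defect_simps(3)[OF X] defect_simps(3)[OF Y] .
  qed
  show "unit_sq ` Sqr T = Sqr Q.\<Gamma>"
  proof (intro equalityI subsetI)
    fix P assume "P \<in> Sqr Q.\<Gamma>"
    then obtain f l' l f' a where P: "P = Q.sq f l' l f' a" "f \<in> HH" "l' \<in> KK" "l \<in> KK" "f' \<in> HH"
      "a \<in> core_bundle T" "Cod diag f = Dom diag l'" "Cod diag l = Dom diag f'"
      "f \<cdot>\<^bsub>diag\<^esub> l' = l \<cdot>\<^bsub>diag\<^esub> f'" "Dom diag a = Dom diag f"
      unfolding Q.Gamma_sel by (rule Q.Gamma_squares_cases)
    obtain h k' k h' where p: "f = vid h" "l' = hid k'" "l = hid k" "f' = vid h'"
      "h \<in> Arr (Hor T)" "k' \<in> Arr (Ver T)" "k \<in> Arr (Ver T)" "h' \<in> Arr (Hor T)"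
      using P(2-5) unfolding HH_def KK_def by blast
    have D: "Cod (Hor T) h = Dom (Ver T) k'" "Cod (Ver T) k = Dom (Hor T) h'"
      using P(7,8) unfolding p(1-4) vid_diag[OF p(5)] vid_diag[OF p(8)] hid_diag[OF p(6)] hid_diag[OF p(7)] .
    \<comment> \<open>The commuting condition says that the fillers of two opposite corners
      coincide, so a single canonical square has all four sides.\<close>
    have eq: "tr h k' = lb k h'"
      using P(9) vid_mult_hid[OF p(5,6) D(1)] hid_mult_vid[OF p(8,7) D(2)] by (simp add: p(1-4))
    define c where "c = tr h k'"
    have c: "canonical c" "sTop T c = h" "sRight T c = k'" "sLeft T c = k" "sBot T c = h'"
      using tr_simps[OF p(5,6) D(1)] lb_simps[OF p(7,8) D(2)] eq by (simp_all add: c_def)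
    have ac: "Dom diag a = Dom diag c"
      using P(10) vid_diag(2)[OF p(5)] corner_simps(1)[OF canonicalD(1)[OF c(1)]] c by (simp add: p(1))
    note m = defect_mult[OF P(6) c(1) ac]
    have "a \<bullet> c \<in> Sqr T"
      using ac core_bundle_ends[OF P(6)] canonicalD(1)[OF c(1)] by (intro mult_simps(1)) simp_all
    moreover from sec_simps(2-5)[OF this] have "unit_sq (a \<bullet> c) = P"
      unfolding m(1) using c m(2) calculation by (simp add: unit_sq_def P(1) p(1-4))
    ultimately show "P \<in> unit_sq ` Sqr T" by blast
  qed (auto simp: unit_sq_mem)
qed

lemma isomorphism_unit:
  assumes "is_max_excl (T, s)"
  shows "isomorphism MaxExcl ((T, s), unit_map, Gamma_obj pr (Lambda_obj (T, s)))"
  unfolding unit_map_def Gamma_obj_def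
proof (rule isomorphism_MaxExclI)
  show "((T, s), (\<lambda>x\<in>Obj (Hor T). x, \<lambda>h\<in>Arr (Hor T). vid h, \<lambda>k\<in>Arr (Ver T). hid k, unit_sq),
      Gamma_dcat pr (Lambda_obj (T, s)), Gamma_section pr (Lambda_obj (T, s))) \<in> Arr MaxExcl"
    using assms Q.is_max_excl_Gamma is_max_excl_map_unit
    unfolding unit_map_def Gamma_obj_def MaxExcl_sel Lambda_obj.simps by blast
  show "bij_betw unit_sq (Sqr T) (Sqr (Gamma_dcat pr (Lambda_obj (T, s))))"
    using bij_betw_unit_sq by simp
  show "bij_betw (\<lambda>x\<in>Obj (Hor T). x) (Obj (Hor T)) (Obj (Hor (Gamma_dcat pr (Lambda_obj (T, s)))))"
    by (simp add: Q.Gamma_sel bij_betw_def inj_on_def)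
  have "inj_on vid (Arr (Hor T))" "inj_on hid (Arr (Ver T))"
    by (metis inj_onI vid_simps(2)) (metis inj_onI hid_simps(2))
  then show "bij_betw (\<lambda>h\<in>Arr (Hor T). vid h) (Arr (Hor T)) (Arr (Hor (Gamma_dcat pr (Lambda_obj (T, s)))))"
    "bij_betw (\<lambda>k\<in>Arr (Ver T). hid k) (Arr (Ver T)) (Arr (Ver (Gamma_dcat pr (Lambda_obj (T, s)))))"
    by (simp_all add: Q.Gamma_sel bij_betw_def inj_on_restrict_eq) (simp_all add: HH_def KK_def)
qed

end

section \<open>The counit\<close>

text \<open>Makes the diagonal construction available for \<open>\<Gamma>(G,H,K,A)\<close>:
  \<open>M.diag\<close> is the groupoid of \<open>\<Lambda>(\<Gamma>(G,H,K,A))\<close>.\<close>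

sublocale gamma \<subseteq> M: max_excl_groupoid \<Gamma> "Gamma_section pr (G, H, K, A)"
proof -
  have "is_max_excl (\<Gamma>, Gamma_section pr (G, H, K, A))"
    using is_max_excl_Gamma by (simp only: Gamma_obj_def)
  then show "max_excl_groupoid \<Gamma> (Gamma_section pr (G, H, K, A))"
    by (rule max_excl_groupoidI)
qed

context gamma
begin

definition counit_sq :: "'u \<Rightarrow> 'u" where
  "counit_sq = (\<lambda>X\<in>squares.
     case unsq5 pr X of (h, k', k, h', a) \<Rightarrow> a \<cdot> (h \<cdot> k'))"

definition counit_map :: "('o, 'u) quad_map" where
  "counit_map = (\<lambda>x\<in>Obj G. x, counit_sq)"

lemma counit_sq: "sq h k' k h' a \<in> squares \<Longrightarrow> counit_sq (sq h k' k h' a) = a \<cdot> (h \<cdot> k')"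
  by (simp add: counit_sq_def)

lemma canonical_sq:
  assumes "M.canonical (sq h k' k h' a)"
  shows "a = Ide G (Dom G h)"
proof -
  have "sq h k' k h' (Ide G (Dom G h)) = sq h k' k h' a"
    using assms Gamma_section_proj_frame[of h k' k h' a] by (simp add: M.canonical_def M.sec_def)
  then show ?thesis by simp
qed

text \<open>Pushing \<open>b\<close> past the path \<open>hk'\<close> conjugates it by that path,
  and this is exactly the bundle element that the 2 by 2 array assigns to the product.\<close>

lemma counit_mult:
  assumes P: "P \<in> Sqr \<Gamma>" and Q: "Q \<in> Sqr \<Gamma>" and PQ: "Cod M.diag P = Dom M.diag Q"
  shows "counit_sq (M.mult P Q) = counit_sq P \<cdot> counit_sq Q"
proof -
  obtain h k' k h' a where P': "P = sq h k' k h' a" "h \<in> H" "k' \<in> K" "k \<in> K" "h' \<in> H" "a \<in> A"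
    "Cod G h = Dom G k'" "Cod G k = Dom G h'" "h \<cdot> k' = k \<cdot> h'" "Dom G a = Dom G h"
    "Dom G k = Dom G h" "Cod G k' = Cod G h'"
    using P unfolding Gamma_sel by (rule Gamma_squares_cases)
  obtain g l' l g' b where Q': "Q = sq g l' l g' b" "g \<in> H" "l' \<in> K" "l \<in> K" "g' \<in> H" "b \<in> A"
    "Cod G g = Dom G l'" "Cod G l = Dom G g'" "g \<cdot> l' = l \<cdot> g'" "Dom G b = Dom G g"
    "Dom G l = Dom G g" "Cod G l' = Cod G g'"
    using Q unfolding Gamma_sel by (rule Gamma_squares_cases)
  have c: "Cod G k' = Dom G g"
    using PQ Q'(11) by (simp add: P'(1) Q'(1) Gamma_sel)
  have PQ': "Cod (Ver \<Gamma>) (sRight \<Gamma> P) = Dom (Ver \<Gamma>) (sLeft \<Gamma> Q)"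
    using PQ by simp
  note f = M.fill_simps[OF P Q PQ']
  \<comment> \<open>Two sides of each filler are prescribed; the others are unknown, but its
    boundary commutes, as in \<open>u w = k' g\<close>. As a canonical square it has a trivial
    bundle element.\<close>
  obtain u w e where U: "M.lb (sRight \<Gamma> P) (sTop \<Gamma> Q) = sq u w k' g e" "u \<in> H" "w \<in> K"
    "Cod G u = Dom G w" "u \<cdot> w = k' \<cdot> g" "Dom G u = Dom G k'" "Cod G w = Cod G g"
  proof -
    obtain u w x y e where U: "M.lb (sRight \<Gamma> P) (sTop \<Gamma> Q) = sq u w x y e" "u \<in> H" "w \<in> K"
      "Cod G u = Dom G w" "u \<cdot> w = x \<cdot> y" "Dom G x = Dom G u" "Cod G w = Cod G y"
      using f(2) unfolding Gamma_sel(5) by (elim Gamma_squares_cases) blast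
    moreover have "x = k'" "y = g"
      using f(3,4) unfolding U(1) by (simp_all add: P'(1) Q'(1) Gamma_sel)
    ultimately show thesis using that by metis
  qed
  obtain v y e' where V: "M.tr (sBot \<Gamma> P) (sLeft \<Gamma> Q) = sq h' l v y e'" "v \<in> K" "y \<in> H"
    "Cod G v = Dom G y" "Dom G v = Dom G h'"
  proof -
    obtain x z v y e where U: "M.tr (sBot \<Gamma> P) (sLeft \<Gamma> Q) = sq x z v y e" "v \<in> K" "y \<in> H"
      "Cod G v = Dom G y" "Dom G v = Dom G x"
      using f(6) unfolding Gamma_sel(5) by (elim Gamma_squares_cases) blast
    moreover have "x = h'" "z = l"
      using f(7,8) unfolding U(1) by (simp_all add: P'(1) Q'(1) Gamma_sel)
    ultimately show thesis using that by metis
  qed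
  have e: "e = Ide G (Dom G u)" "e' = Ide G (Dom G h')"
    using f(1,5) unfolding U(1) V(1) by (auto dest: canonical_sq)
  have mult: "M.mult P Q = sq (h \<cdot> u) (w \<cdot> l') (k \<cdot> v) (y \<cdot> g')
      ((a \<cdot> conj_arr G h e) \<cdot> conj_arr G k (e' \<cdot> conj_arr G h' b))"
    unfolding M.mult_def U(1) V(1) by (simp add: P'(1) Q'(1) Gamma_sel)
  have "M.mult P Q \<in> squares"
    using M.mult_simps(1)[OF P Q PQ'] unfolding Gamma_sel .
  then have "counit_sq (M.mult P Q) =
      ((a \<cdot> conj_arr G h e) \<cdot> conj_arr G k (e' \<cdot> conj_arr G h' b)) \<cdot> ((h \<cdot> u) \<cdot> (w \<cdot> l'))"
    unfolding mult by (rule counit_sq)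
  also have "a \<cdot> conj_arr G h e = a"
    using P' U by (simp add: e quad_simps)
  \<comment> \<open>The array transports \<open>b\<close> along the left and bottom sides of
    \<open>P\<close>; the commuting boundary replaces that path by the top and right sides.\<close>
  also have "conj_arr G k (e' \<cdot> conj_arr G h' b) = conj_arr G (h \<cdot> k') b"
    using P' Q' c by (simp add: e conj_Cmp_left H_simps K_simps A_simps Ide_left' conj_simps)
  also have "(h \<cdot> u) \<cdot> (w \<cdot> l') = (h \<cdot> k') \<cdot> (g \<cdot> l')"
  proof -
    have "(h \<cdot> u) \<cdot> (w \<cdot> l') = h \<cdot> ((u \<cdot> w) \<cdot> l')"
      using P'(2-8) Q'(2-8) U(2-4,6,7) Q'(12) by (simp add: H_simps K_simps cat_simps Cmp_assoc)
    also have "\<dots> = (h \<cdot> k') \<cdot> (g \<cdot> l')"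
      unfolding U(5) using P'(2-8) Q'(2-8) c by (simp add: H_simps K_simps cat_simps Cmp_assoc)
    finally show ?thesis .
  qed
  also have "(a \<cdot> conj_arr G (h \<cdot> k') b) \<cdot> ((h \<cdot> k') \<cdot> (g \<cdot> l')) = (a \<cdot> (h \<cdot> k')) \<cdot> (b \<cdot> (g \<cdot> l'))"
  proof -
    define f where "f = h \<cdot> k'"
    have "f \<in> Arr G" "Dom G f = Dom G a" "Cod G f = Dom G b"
      using P' Q' c unfolding f_def by (simp_all add: H_simps K_simps cat_simps)
    then show ?thesis
      unfolding f_def[symmetric] using P'(6) Q'(2-) by (simp add: conj_arr_def grp_simps H_simps K_simps A_simps)
  qed
  also have "\<dots> = counit_sq P \<cdot> counit_sq Q"
    using P Q unfolding P'(1) Q'(1) Gamma_sel by (simp add: counit_sq)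
  finally show ?thesis .
qed

lemma counit_sq_diag:
  assumes "P \<in> Sqr \<Gamma>"
  shows "counit_sq P \<in> Arr G" "Dom G (counit_sq P) = Dom M.diag P" "Cod G (counit_sq P) = Cod M.diag P"
proof -
  have P: "P \<in> squares" using assms unfolding Gamma_sel .
  then obtain h k' k h' a where P': "P = sq h k' k h' a" "h \<in> H" "k' \<in> K" "a \<in> A"
    "Cod G h = Dom G k'" "Dom G a = Dom G h" "Dom G k = Dom G h" "Cod G k' = Cod G h'"
    by (elim Gamma_squares_cases) blast
  show "counit_sq P \<in> Arr G" "Dom G (counit_sq P) = Dom M.diag P" "Cod G (counit_sq P) = Cod M.diag P"
    using P P'(2-) unfolding P'(1) by (simp_all add: counit_sq quad_simps, simp_all add: Gamma_sel)
qed

lemma is_functor_counit: "is_functor M.diag G (\<lambda>x\<in>Obj G. x) counit_sq"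
proof (rule is_functorI)
  show "counit_sq (Ide M.diag x) = Ide G ((\<lambda>x\<in>Obj G. x) x)" if "x \<in> Obj M.diag" for x
  proof -
    have x: "x \<in> Obj G" using that by (simp add: Gamma_sel)
    have "Ide M.diag x \<in> squares"
      using M.diag.Ide_in[OF that] by (simp add: Gamma_sel)
    moreover have "Ide M.diag x = sq (Ide G x) (Ide G x) (Ide G x) (Ide G x) (Ide G x)"
      using x by (simp add: Gamma_sel cat_simps)
    ultimately show ?thesis
      using x by (simp add: counit_sq cat_simps Ide_left')
  qed
  show "counit_sq (P \<cdot>\<^bsub>M.diag\<^esub> Q) = counit_sq P \<cdot> counit_sq Q"
    if "P \<in> Arr M.diag" "Q \<in> Arr M.diag" "Cod M.diag P = Dom M.diag Q" for P Q
    using counit_mult[of P Q] that by simp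
qed (use M.diag.Dom_in M.diag.Cod_in in \<open>simp_all add: counit_sq_diag\<close>, simp_all add: Gamma_sel)

lemma counit_vid: "h \<in> H \<Longrightarrow> counit_sq (M.vid h) = h"
  using \<Gamma>.vid_simps(1)[of h] by (simp add: Gamma_sel counit_sq H_simps Ide_left' Ide_right' grp_simps)

lemma counit_hid: "k \<in> K \<Longrightarrow> counit_sq (M.hid k) = k"
  using \<Gamma>.hid_simps(1)[of k] by (simp add: Gamma_sel counit_sq K_simps Ide_left' Ide_right' grp_simps)

lemma HH_KK_Gamma: "M.HH = M.vid ` H" "M.KK = M.hid ` K"
  by (simp_all add: M.HH_def M.KK_def Gamma_sel)

lemma core_bundle_Gamma:
  "core_bundle \<Gamma> = (\<lambda>a. sq (Ide G (Dom G a)) (Ide G (Dom G a)) (Ide G (Dom G a)) (Ide G (Dom G a)) a) ` A"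
proof (intro equalityI subsetI)
  fix X assume X: "X \<in> core_bundle \<Gamma>"
  note s = M.core_bundle_sides[OF X refl]
  obtain h k' k h' a where P: "X = sq h k' k h' a" "h \<in> H" "a \<in> A" "Dom G a = Dom G h" "Dom G k = Dom G h"
    using s(1) unfolding Gamma_sel by (elim Gamma_squares_cases) blast
  have D: "Dom (Ver \<Gamma>) (sLeft \<Gamma> X) = Dom G a"
    using P by (simp add: Gamma_sel)
  have "h = Ide G (Dom G a)" "k' = Ide G (Dom G a)" "k = Ide G (Dom G a)" "h' = Ide G (Dom G a)"
    using s(2-5) unfolding D unfolding P(1) Gamma_sel by simp_all
  then show "X \<in> (\<lambda>a. sq (Ide G (Dom G a)) (Ide G (Dom G a)) (Ide G (Dom G a)) (Ide G (Dom G a)) a) ` A"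
    using P by (intro image_eqI[of _ _ a]) simp_all
next
  fix X assume "X \<in> (\<lambda>a. sq (Ide G (Dom G a)) (Ide G (Dom G a)) (Ide G (Dom G a)) (Ide G (Dom G a)) a) ` A"
  then obtain a where a: "a \<in> A" "X = sq (Ide G (Dom G a)) (Ide G (Dom G a)) (Ide G (Dom G a)) (Ide G (Dom G a)) a"
    by blast
  then have x: "Dom G a \<in> Obj G" by (simp add: A_simps Dom_in)
  then show "X \<in> core_bundle \<Gamma>"
    unfolding core_bundle_def a(2) using a(1)
    by (simp add: Gamma_sel sq_mem_iff identities_def quad_simps)
qed

lemma sq_bundle_mem:
  assumes "a \<in> A"
  shows "sq (Ide G (Dom G a)) (Ide G (Dom G a)) (Ide G (Dom G a)) (Ide G (Dom G a)) a \<in> squares"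
  using assms Dom_in[of a] by (simp add: sq_mem_iff quad_simps)

text \<open>Inclusions would make the counit an arrow; the equalities are what its invertibility
  requires.\<close>

lemma counit_images:
  "counit_sq ` M.HH = H" "counit_sq ` M.KK = K" "counit_sq ` core_bundle \<Gamma> = A"
proof -
  show "counit_sq ` M.HH = H" "counit_sq ` M.KK = K"
    by (simp_all add: HH_KK_Gamma image_image counit_vid counit_hid)
  have "counit_sq (sq (Ide G (Dom G a)) (Ide G (Dom G a)) (Ide G (Dom G a)) (Ide G (Dom G a)) a) = a"
    if "a \<in> A" for a
    using that sq_bundle_mem[OF that] Dom_in[of a] by (simp add: counit_sq A_simps cat_simps Ide_left' Ide_right')
  then show "counit_sq ` core_bundle \<Gamma> = A"
    by (simp add: core_bundle_Gamma image_image)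
qed

lemma is_quad_map_counit:
  "is_quad_map (Lambda_obj (Gamma_obj pr (G, H, K, A))) counit_map (G, H, K, A)"
  using is_functor_counit counit_images
  by (simp add: Gamma_obj_def counit_map_def) (simp add: Gamma_sel counit_sq_def)

lemma counit_sec:
  assumes "sq h k' k h' a \<in> squares"
  shows "counit_sq (M.sec (sq h k' k h' a)) = h \<cdot> k'"
proof -
  have "M.sec (sq h k' k h' a) = sq h k' k h' (Ide G (Dom G h))"
    using assms Gamma_section_proj_frame[of h k' k h' a] by (simp add: M.sec_def Gamma_sel(5))
  moreover have "sq h k' k h' (Ide G (Dom G h)) \<in> squares"
    using assms by (simp add: sq_mem_iff H_simps A_simps grp_simps)
  moreover have "Ide G (Dom G h) \<cdot> (h \<cdot> k') = h \<cdot> k'"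
  proof (rule Ide_left')
    have "h \<in> Arr G" "k' \<in> Arr G" "Cod G h = Dom G k'"
      using assms by (simp_all add: sq_mem_iff H_simps K_simps)
    then show "h \<cdot> k' \<in> Arr G" "Dom G (h \<cdot> k') = Dom G h"
      by (simp_all add: cat_simps)
  qed
  ultimately show ?thesis
    by (simp add: counit_sq)
qed

text \<open>The counit is a functor with value \<open>ahk'\<close> on the square and
  \<open>hk'\<close> on its canonical companion; the quotient of the two is \<open>a\<close>. This
  supplies the bundle coordinate of the triangle identity at \<open>\<Gamma>\<close>.\<close>

lemma counit_defect:
  assumes P: "sq h k' k h' a \<in> squares"
  shows "counit_sq (M.defect (sq h k' k h' a)) = a"
proof -
  note * = P[unfolded sq_mem_iff]
  let ?P = "sq h k' k h' a"
  have kh: "Dom G k = Dom G h"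
    using P by (elim Gamma_squares_cases) simp
  have m: "?P \<in> Sqr \<Gamma>" using P unfolding Gamma_sel .
  note s = M.sec_simps[OF m]
  have i: "inverse_arr M.diag (M.sec ?P) \<in> Arr M.diag" "Dom M.diag (inverse_arr M.diag (M.sec ?P)) = Cod M.diag ?P"
    using M.diag.inv_in[of "M.sec ?P"] M.diag.Dom_inv[of "M.sec ?P"] s by simp_all
  have "counit_sq (M.defect ?P) = counit_sq ?P \<cdot> counit_sq (inverse_arr M.diag (M.sec ?P))"
    unfolding M.defect_def using i m by (intro counit_mult) simp_all
  also have "counit_sq (inverse_arr M.diag (M.sec ?P)) = inverse_arr G (counit_sq (M.sec ?P))"
    using s by (intro is_functor_inverse_arr[OF M.groupoid_diag category_axioms is_functor_counit]) simp
  also have "counit_sq ?P \<cdot> inverse_arr G (counit_sq (M.sec ?P)) = a"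
    unfolding counit_sec[OF P] counit_sq[OF P]
  proof -
    define f where "f = h \<cdot> k'"
    have "f \<in> Arr G" "Dom G f = Dom G a"
      using * Cmp_in[of h k'] Dom_Cmp[of h k'] by (simp_all add: f_def H_simps K_simps)
    then show "(a \<cdot> (h \<cdot> k')) \<cdot> inverse_arr G (h \<cdot> k') = a"
      unfolding f_def[symmetric] using * by (simp add: A_simps grp_simps)
  qed
  finally show ?thesis .
qed

text \<open>A product of permutable subgroupoids is closed under quotients: the inner factors form
  an element of \<open>HK\<close>, which is rewritten in \<open>KH\<close> and absorbed by the outer
  \<open>k\<close>.\<close>

lemma set_cmp_KH_closed:
  assumes "f \<in> set_cmp G K H" "g \<in> set_cmp G K H" "Cod G f = Cod G g"
  shows "f \<cdot> inverse_arr G g \<in> set_cmp G K H"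
proof -
  obtain k h where f: "f = k \<cdot> h" "k \<in> K" "h \<in> H" "Cod G k = Dom G h"
    using assms(1) by (auto simp: set_cmp_def)
  obtain l m where g: "g = l \<cdot> m" "l \<in> K" "m \<in> H" "Cod G l = Dom G m"
    using assms(2) by (auto simp: set_cmp_def)
  have hm: "Cod G h = Cod G m"
    using assms(3) f g by (simp add: H_simps K_simps cat_simps)
  have "(h \<cdot> inverse_arr G m) \<cdot> inverse_arr G l \<in> set_cmp G H K"
    unfolding set_cmp_def using f g hm
    by (intro CollectI exI[of _ "h \<cdot> inverse_arr G m"] exI[of _ "inverse_arr G l"])
      (simp add: H_simps K_simps grp_simps)
  then obtain k' h' where kh: "(h \<cdot> inverse_arr G m) \<cdot> inverse_arr G l = k' \<cdot> h'" "k' \<in> K" "h' \<in> H" "Cod G k' = Dom G h'"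
    unfolding HK_KH by (auto simp: set_cmp_def)
  have "Dom G k' = Dom G h"
    using arg_cong[OF kh(1), of "Dom G"] kh(2-) f g hm by (simp add: H_simps K_simps grp_simps)
  moreover have "f \<cdot> inverse_arr G g = k \<cdot> ((h \<cdot> inverse_arr G m) \<cdot> inverse_arr G l)"
    using f g hm by (simp add: H_simps K_simps grp_simps)
  ultimately have "f \<cdot> inverse_arr G g = (k \<cdot> k') \<cdot> h'"
    unfolding kh(1) using f kh(2-) by (simp add: H_simps K_simps grp_simps)
  then show ?thesis
    unfolding set_cmp_def using f kh \<open>Dom G k' = Dom G h\<close>
    by (intro CollectI exI[of _ "k \<cdot> k'"] exI[of _ h']) (simp add: H_simps K_simps grp_simps)
qed

text \<open>Injectivity peels off coordinates one after another: the bundle elements by discreteness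
  of \<open>A \<inter> KH\<close>, then the two factorisations \<open>hk'\<close> and
  \<open>kh'\<close> by discreteness of \<open>H \<inter> K\<close>. Surjectivity is
  \<open>G = AKH\<close>.\<close>

lemma bij_betw_counit:
  assumes fib: "fibered_semidirect (G, H, K, A)"
  shows "bij_betw counit_sq (Sqr \<Gamma>) (Arr G)"
proof (rule bij_betw_imageI)
  show "inj_on counit_sq (Sqr \<Gamma>)"
  proof (rule inj_onI)
    fix P Q assume "P \<in> Sqr \<Gamma>" "Q \<in> Sqr \<Gamma>" and eq: "counit_sq P = counit_sq Q"
    then have PG: "P \<in> squares" and QG: "Q \<in> squares"
      unfolding Gamma_sel by auto
    obtain h k' k h' a where P: "P = sq h k' k h' a" "h \<in> H" "k' \<in> K" "k \<in> K" "h' \<in> H" "a \<in> A"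
      "Cod G h = Dom G k'" "Cod G k = Dom G h'" "h \<cdot> k' = k \<cdot> h'" "Dom G a = Dom G h"
      "Dom G k = Dom G h" "Cod G k' = Cod G h'"
      using PG by (rule Gamma_squares_cases)
    obtain g l' l g' b where Q: "Q = sq g l' l g' b" "g \<in> H" "l' \<in> K" "l \<in> K" "g' \<in> H" "b \<in> A"
      "Cod G g = Dom G l'" "Cod G l = Dom G g'" "g \<cdot> l' = l \<cdot> g'" "Dom G b = Dom G g"
      "Dom G l = Dom G g" "Cod G l' = Cod G g'"
      using QG by (rule Gamma_squares_cases)
    have e: "a \<cdot> (h \<cdot> k') = b \<cdot> (g \<cdot> l')"
      using eq PG QG unfolding P(1) Q(1) by (simp add: counit_sq)
    define c where "c = h \<cdot> k'"
    define d where "d = g \<cdot> l'"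
    have c: "c \<in> Arr G" "Dom G c = Dom G a" "Cod G c = Cod G k'" and d: "d \<in> Arr G" "Dom G d = Dom G b" "Cod G d = Cod G l'"
      using P Q by (simp_all add: c_def d_def H_simps K_simps cat_simps)
    have e': "a \<cdot> c = b \<cdot> d" using e by (simp add: c_def d_def)
    have D: "Dom G a = Dom G b" "Cod G k' = Cod G l'"
      using arg_cong[OF e', of "Dom G"] arg_cong[OF e', of "Cod G"] c d P(6) Q(6)
      by (simp_all add: A_simps cat_simps)
    have "c \<in> set_cmp G K H" "d \<in> set_cmp G K H"
      using P Q unfolding HK_KH[symmetric] set_cmp_def c_def d_def by blast+
    then have "d \<cdot> inverse_arr G c \<in> set_cmp G K H"
      using c d D by (intro set_cmp_KH_closed) simp_all
    \<comment> \<open>The quotient of the bundle elements equals a quotient of two elements of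
      \<open>KH\<close>, so it lies in \<open>A \<inter> KH\<close>.\<close>
    moreover have "inverse_arr G b \<cdot> a = d \<cdot> inverse_arr G c"
      using e' c d D P(6) Q(6) by (intro flip_square) (simp_all add: A_simps)
    moreover have "inverse_arr G b \<cdot> a = a \<cdot> inverse_arr G b"
      using P(6) Q(6) D by (intro A_commute) (simp_all add: A_simps grp_simps)
    moreover have "a \<cdot> inverse_arr G b \<in> A"
      using P(6) Q(6) D by (simp add: A_simps grp_simps)
    ultimately have "a \<cdot> inverse_arr G b \<in> identities G"
      using fib by (auto simp: discrete_def)
    then have ab: "a = b"
      using P(6) Q(6) D by (intro eq_if_Cmp_inv_identity) (simp_all add: A_simps)
    then have cd: "c = d"
      using left_cancel[of a c d] e' c d D P(6) by (simp add: A_simps)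
    have Dhg: "Dom G h = Dom G g"
      using P(10) Q(10) ab by simp
    \<comment> \<open>Cancelling across \<open>hk' = gl'\<close> leaves an arrow of \<open>H\<close>
      equal to an arrow of \<open>K\<close>. The same device is applied below to the left and bottom
      sides.\<close>
    have "inverse_arr G h \<cdot> g = k' \<cdot> inverse_arr G l'"
      using cd P Q unfolding c_def d_def by (intro flip_square) (simp_all add: H_simps K_simps)
    moreover have "inverse_arr G h \<cdot> g \<in> H" "k' \<cdot> inverse_arr G l' \<in> K"
      using P Q D Dhg by (simp_all add: H_simps K_simps grp_simps)
    ultimately have "k' \<cdot> inverse_arr G l' \<in> identities G"
      using H_Int_K[of "k' \<cdot> inverse_arr G l'"] by simp
    then have k: "k' = l'"
      using P Q D by (intro eq_if_Cmp_inv_identity) (simp_all add: K_simps)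
    then have h: "h = g"
      using cd right_cancel[of h k' g] P Q unfolding c_def d_def by (simp add: H_simps K_simps)
    have cd': "k \<cdot> h' = l \<cdot> g'"
      using cd P(9) Q(9) unfolding c_def d_def by simp
    have "inverse_arr G k \<cdot> l = h' \<cdot> inverse_arr G g'"
      using cd' P Q by (intro flip_square) (simp_all add: H_simps K_simps)
    moreover have "inverse_arr G k \<cdot> l \<in> K" "h' \<cdot> inverse_arr G g' \<in> H"
      using P Q D Dhg by (simp_all add: H_simps K_simps grp_simps)
    ultimately have "h' \<cdot> inverse_arr G g' \<in> identities G"
      using H_Int_K[of "h' \<cdot> inverse_arr G g'"] by simp
    then have h': "h' = g'"
      using P Q D by (intro eq_if_Cmp_inv_identity) (simp_all add: H_simps)
    then have "k = l"
      using cd' right_cancel[of k h' l] P Q by (simp add: H_simps K_simps)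
    then show "P = Q"
      by (simp add: P(1) Q(1) ab k h h')
  qed
  show "counit_sq ` Sqr \<Gamma> = Arr G"
  proof (intro equalityI subsetI)
    fix f assume "f \<in> Arr G"
    then have "f \<in> set_cmp G (set_cmp G A K) H"
      using fib by simp
    then obtain a k h' where f: "f = (a \<cdot> k) \<cdot> h'" "a \<in> A" "k \<in> K" "h' \<in> H" "Cod G a = Dom G k" "Cod G (a \<cdot> k) = Dom G h'"
      by (auto simp: set_cmp_def)
    have kh: "Cod G k = Dom G h'"
      using f by (simp add: A_simps K_simps cat_simps)
    then have "k \<cdot> h' \<in> set_cmp G H K"
      using f unfolding HK_KH unfolding set_cmp_def by blast
    then obtain h k' where hk: "k \<cdot> h' = h \<cdot> k'" "h \<in> H" "k' \<in> K" "Cod G h = Dom G k'"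
      by (auto simp: set_cmp_def)
    have "Dom G h = Dom G k"
      using arg_cong[OF hk(1), of "Dom G"] f hk(2-) kh by (simp add: H_simps K_simps cat_simps)
    then have "sq h k' k h' a \<in> squares"
      using f hk kh by (simp add: sq_mem_iff A_simps)
    moreover from counit_sq[OF this] have "counit_sq (sq h k' k h' a) = f"
      unfolding hk(1)[symmetric] f(1) using f(2-5) kh by (simp add: A_simps H_simps K_simps Cmp_assoc)
    ultimately show "f \<in> counit_sq ` Sqr \<Gamma>"
      unfolding Gamma_sel by blast
  qed (auto simp: counit_sq_diag)
qed

end

text \<open>Bijectivity on arrows alone could still send a subgroupoid onto a proper part of its
  counterpart. Equality of the images ensures that the inverse maps each counterpart back.\<close>

lemma isomorphism_TwoSemiI:
  assumes f: "((G, H, K, A), (fo, fa), (G', H', K', A')) \<in> Arr TwoSemi"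
    and bij: "bij_betw fo (Obj G) (Obj G')" "bij_betw fa (Arr G) (Arr G')"
    and im: "fa ` H = H'" "fa ` K = K'" "fa ` A = A'"
  shows "isomorphism TwoSemi ((G, H, K, A), (fo, fa), (G', H', K', A'))"
proof -
  have a: "is_quad (G, H, K, A)" "is_quad (G', H', K', A')" "is_quad_map (G, H, K, A) (fo, fa) (G', H', K', A')"
    using f by (simp_all only: TwoSemi_sel)
  note q = is_quad_subsets[OF a(1)]
  define go where "go = restrict (inv_into (Obj G) fo) (Obj G')"
  define ga where "ga = restrict (inv_into (Arr G) fa) (Arr G')"
  note o = restrict_inv_into[OF bij(1), folded go_def] and r = restrict_inv_into[OF bij(2), folded ga_def]
  have "is_functor G' G go ga"
    by (rule is_functor_inverse_functor[OF q(2), of _ fo fa]) (use a(3) in \<open>simp_all add: o r\<close>)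
  moreover have "ga ` fa ` S = S" if "S \<subseteq> Arr G" for S
    using that r(3) by (force simp: image_image)
  ultimately have m: "is_quad_map (G', H', K', A') (go, ga) (G, H, K, A)"
    using q(3-5) by (simp add: go_def ga_def flip: im)
  have "is_inverse TwoSemi ((G, H, K, A), (fo, fa), (G', H', K', A')) ((G', H', K', A'), (go, ga), (G, H, K, A))"
    unfolding is_inverse_def TwoSemi_sel quad_comp.simps quad_id.simps
    using a m by (simp add: go_def ga_def compose_restrict_inv_into bij del: is_quad.simps is_quad_map.simps)
  then show ?thesis
    unfolding isomorphism_def by blast
qed

section \<open>The adjunction\<close>

fun unit_arr :: "('u \<times> 'u \<Rightarrow> 'u) \<Rightarrow> ('o, 'u) max_excl \<Rightarrow> ('o, 'u) max_excl_arr" where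
  "unit_arr pr (T, s) = ((T, s), max_excl_unit.unit_map T s pr, Gamma_obj pr (Lambda_obj (T, s)))"

fun counit_arr :: "('u \<times> 'u \<Rightarrow> 'u) \<Rightarrow> ('o, 'u) quad \<Rightarrow> ('o, 'u) quad_arr" where
  "counit_arr pr (G, H, K, A) =
     (Lambda_obj (Gamma_obj pr (G, H, K, A)), gamma.counit_map G H K A pr, (G, H, K, A))"

lemma max_excl_unitI: "is_max_excl (T, s) \<Longrightarrow> inj pr \<Longrightarrow> max_excl_unit T s pr"
  by (simp add: max_excl_unit_def max_excl_unit_axioms_def max_excl_groupoidI del: is_max_excl.simps)

lemma gammaI: "is_quad (G, H, K, A) \<Longrightarrow> inj pr \<Longrightarrow> gamma G H K A pr"
  by (simp add: gamma_def gamma_axioms_def quadruple_def del: is_quad.simps)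

lemma unit_natural:
  assumes "inj pr" "u \<in> Arr MaxExcl"
  shows "u \<cdot>\<^bsub>MaxExcl\<^esub> unit_arr pr (Cod MaxExcl u) = unit_arr pr (Dom MaxExcl u) \<cdot>\<^bsub>MaxExcl\<^esub> Gamma_arr pr (Lambda_arr u)"
proof -
  obtain T s Fo Fh Fv Fs T' s' where u: "u = ((T, s), (Fo, Fh, Fv, Fs), (T', s'))" by (metis prod.exhaust)
  have a: "is_max_excl (T, s)" "is_max_excl (T', s')" "is_max_excl_map (T, s) (Fo, Fh, Fv, Fs) (T', s')"
    using assms(2) unfolding u by (simp_all only: MaxExcl_sel)
  interpret section_preserving T s T' s' Fo Fh Fv Fs
    using section_preservingI[OF a] .
  interpret A: max_excl_unit T s pr using max_excl_unitI[OF a(1) assms(1)] .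
  interpret B: max_excl_unit T' s' pr using max_excl_unitI[OF a(2) assms(1)] .
  have "Lambda_arr u \<in> Arr TwoSemi"
    using is_functor_Arr[OF is_functor_Lambda assms(2)] .
  then interpret m: gamma_map A.diag A.HH A.KK "core_bundle T" pr B.diag B.HH B.KK "core_bundle T'" Fo Fs
    by unfold_locales (simp add: u del: is_quad.simps is_quad_map.simps)
  have "compose (Obj (Hor T)) (\<lambda>x\<in>Obj (Hor T'). x) Fo = compose (Obj (Hor T)) (restrict Fo (Obj (Hor T))) (\<lambda>x\<in>Obj (Hor T). x)"
    "compose (Arr (Hor T)) (\<lambda>h\<in>Arr (Hor T'). B.vid h) Fh = compose (Arr (Hor T)) (restrict Fs A.HH) (\<lambda>h\<in>Arr (Hor T). A.vid h)"
    "compose (Arr (Ver T)) (\<lambda>k\<in>Arr (Ver T'). B.hid k) Fv = compose (Arr (Ver T)) (restrict Fs A.KK) (\<lambda>k\<in>Arr (Ver T). A.hid k)"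
    by (auto simp: compose_def F_in F_vid F_hid A.HH_KK_memI intro!: restrict_ext)
  \<comment> \<open>On squares naturality amounts to \<open>Fs\<close> commuting with identity
    squares and with \<open>defect\<close>.\<close>
  moreover have "compose (Sqr T) B.unit_sq Fs = compose (Sqr T) m.F_sq A.unit_sq"
    unfolding compose_def
  proof (rule restrict_ext)
    fix X assume X: "X \<in> Sqr T"
    then show "B.unit_sq (Fs X) = m.F_sq (A.unit_sq X)"
      using A.unit_sq_mem[OF X] unfolding A.Q.Gamma_sel
      by (simp add: A.unit_sq_def B.unit_sq_def m.F_sq F_in F_sides F_vid F_hid F_defect A.sides_in)
  qed
  ultimately show ?thesis
    by (simp add: u A.unit_map_def B.unit_map_def Gamma_obj_def m.Gamma_map_eq del: Gamma_map.simps)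
qed

lemma counit_natural:
  assumes "inj pr" "w \<in> Arr TwoSemi"
  shows "Lambda_arr (Gamma_arr pr w) \<cdot>\<^bsub>TwoSemi\<^esub> counit_arr pr (Cod TwoSemi w) = counit_arr pr (Dom TwoSemi w) \<cdot>\<^bsub>TwoSemi\<^esub> w"
proof -
  obtain G H K A fo fa G' H' K' A' where w: "w = ((G, H, K, A), (fo, fa), (G', H', K', A'))"
    by (metis prod.exhaust)
  interpret gamma_map G H K A pr G' H' K' A' fo fa
    using assms by unfold_locales (simp_all add: w del: is_quad.simps is_quad_map.simps)
  have "compose (Obj G) (\<lambda>x\<in>Obj G'. x) (restrict fo (Obj G)) = compose (Obj G) fo (\<lambda>x\<in>Obj G. x)"
    by (auto simp: compose_def f_simps intro!: restrict_ext)
  moreover have "compose (Sqr X.\<Gamma>) Y.counit_sq F_sq = compose (Sqr X.\<Gamma>) fa X.counit_sq"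
    unfolding compose_def
  proof (rule restrict_ext)
    fix P assume P: "P \<in> Sqr X.\<Gamma>"
    then obtain h k' k h' a where P': "P = X.sq h k' k h' a" "h \<in> H" "k' \<in> K" "a \<in> A" "Cod G h = Dom G k'" "Dom G a = Dom G h"
      unfolding X.Gamma_sel by (elim X.Gamma_squares_cases) blast
    then show "Y.counit_sq (F_sq P) = fa (X.counit_sq P)"
      using P F_sq_mem[of h k' k h' a] unfolding X.Gamma_sel
      by (simp add: F_sq X.counit_sq Y.counit_sq f_simps X.H_simps X.K_simps X.A_simps X.cat_simps)
  qed
  ultimately show ?thesis
    by (simp add: w Gamma_obj_def X.counit_map_def Y.counit_map_def Gamma_map_eq X.Gamma_sel(1) del: Gamma_map.simps)
qed

lemma triangle_Lambda:
  assumes "inj pr" "is_max_excl \<tau>"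
  shows "Lambda_arr (unit_arr pr \<tau>) \<cdot>\<^bsub>TwoSemi\<^esub> counit_arr pr (Lambda_obj \<tau>) = Ide TwoSemi (Lambda_obj \<tau>)"
proof -
  obtain T s where \<tau>: "\<tau> = (T, s)" by (cases \<tau>)
  interpret max_excl_unit T s pr using max_excl_unitI assms unfolding \<tau> by blast
  have "compose (Sqr T) Q.counit_sq unit_sq = (\<lambda>X\<in>Sqr T. X)"
    unfolding compose_def
  proof (rule restrict_ext)
    fix X assume X: "X \<in> Sqr T"
    \<comment> \<open>The triangle identity is the splitting of \<open>X\<close>: the counit
      multiplies the defect by the factorisation of \<open>sec X\<close> that the unit
      recorded.\<close>
    have "Q.counit_sq (unit_sq X) = mult (defect X) (mult (vid (sTop T X)) (hid (sRight T X)))"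
      using unit_sq_mem[OF X] X unfolding Q.Gamma_sel by (simp add: unit_sq_def Q.counit_sq)
    also have "\<dots> = X"
      unfolding sec_eq_mult(1)[OF X, symmetric] by (rule defect_simps(3)[OF X])
    finally show "Q.counit_sq (unit_sq X) = X" .
  qed
  moreover have "compose (Obj (Hor T)) (\<lambda>x\<in>Obj (Hor T). x) (\<lambda>x\<in>Obj (Hor T). x) = (\<lambda>x\<in>Obj (Hor T). x)"
    by (auto simp: compose_def)
  ultimately show ?thesis
    by (simp add: \<tau> unit_map_def Q.counit_map_def)
qed

lemma triangle_Gamma:
  assumes "inj pr" "is_quad Y"
  shows "unit_arr pr (Gamma_obj pr Y) \<cdot>\<^bsub>MaxExcl\<^esub> Gamma_arr pr (counit_arr pr Y) = Ide MaxExcl (Gamma_obj pr Y)"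
proof -
  obtain G H K A where Y: "Y = (G, H, K, A)" by (cases Y)
  interpret gamma G H K A pr using gammaI assms unfolding Y by blast
  interpret U: max_excl_unit \<Gamma> "Gamma_section pr (G, H, K, A)" pr
    by unfold_locales (fact assms(1))
  interpret m: gamma_map M.diag M.HH M.KK "core_bundle \<Gamma>" pr G H K A "\<lambda>x\<in>Obj G. x" counit_sq
    using is_quad_map_counit by unfold_locales (simp only: Gamma_obj_def Lambda_obj.simps counit_map_def)
  have 1: "compose (Obj G) (restrict (\<lambda>x\<in>Obj G. x) (Obj G)) (\<lambda>x\<in>Obj G. x) = (\<lambda>x\<in>Obj G. x)"
    "compose H (restrict counit_sq M.HH) (\<lambda>h\<in>H. M.vid h) = (\<lambda>h\<in>H. h)"
    "compose K (restrict counit_sq M.KK) (\<lambda>k\<in>K. M.hid k) = (\<lambda>k\<in>K. k)"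
    by (auto simp: compose_def HH_KK_Gamma counit_vid counit_hid simp del: Gamma_sel intro!: restrict_ext)
  have 2: "compose (Sqr \<Gamma>) m.F_sq U.unit_sq = (\<lambda>X\<in>Sqr \<Gamma>. X)"
    unfolding compose_def
  proof (rule restrict_ext)
    fix P assume P: "P \<in> Sqr \<Gamma>"
    then have PG: "P \<in> Gamma_squares pr (G, H, K, A)" unfolding Gamma_sel .
    then obtain h k' k h' a where P': "P = sq h k' k h' a" "h \<in> H" "k' \<in> K" "k \<in> K" "h' \<in> H"
      by (elim Gamma_squares_cases) blast
    \<comment> \<open>The counit is applied to each of the five coordinates recorded by the unit; it
      turns identity squares back into arrows and the defect back into the bundle element.\<close>
    have "m.F_sq (U.unit_sq P) = sq (counit_sq (M.vid (sTop \<Gamma> P))) (counit_sq (M.hid (sRight \<Gamma> P)))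
        (counit_sq (M.hid (sLeft \<Gamma> P))) (counit_sq (M.vid (sBot \<Gamma> P))) (counit_sq (M.defect P))"
      using U.unit_sq_mem[OF P] P unfolding U.unit_sq_def U.Q.Gamma_sel(5) by (simp add: m.F_sq)
    also have "\<dots> = P"
      using P'(2-) counit_defect[OF PG[unfolded P'(1)]] unfolding P'(1) Gamma_sel(7-10)
      by (simp only: counit_vid counit_hid)
    finally show "m.F_sq (U.unit_sq P) = P" .
  qed
  have "(compose (Obj (Hor \<Gamma>)) (restrict (\<lambda>x\<in>Obj G. x) (Obj M.diag)) (\<lambda>x\<in>Obj (Hor \<Gamma>). x),
      compose (Arr (Hor \<Gamma>)) (restrict counit_sq M.HH) (\<lambda>h\<in>Arr (Hor \<Gamma>). M.vid h),
      compose (Arr (Ver \<Gamma>)) (restrict counit_sq M.KK) (\<lambda>k\<in>Arr (Ver \<Gamma>). M.hid k),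
      compose (Sqr \<Gamma>) m.F_sq U.unit_sq) = max_excl_id (\<Gamma>, Gamma_section pr (G, H, K, A))"
    using 1 2 by (simp add: Gamma_sel(1,2))
  then show ?thesis
    unfolding Y Gamma_obj_def unit_arr.simps counit_arr.simps Gamma_arr.simps Lambda_obj.simps
      U.unit_map_def counit_map_def m.Gamma_map_eq MaxExcl_sel max_excl_comp.simps by simp
qed

lemma unit_counit_Lambda_Gamma:
  fixes pr :: "'u \<times> 'u \<Rightarrow> 'u"
  assumes "inj pr"
  shows "unit_counit (MaxExcl :: (('o, 'u) max_excl, _) cat) TwoSemi Lambda_obj Lambda_arr
    (Gamma_obj pr) (Gamma_arr pr) (unit_arr pr) (counit_arr pr)"
proof (intro unit_counit.intro unit_counit_axioms.intro category_MaxExcl category_TwoSemi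
    is_functor_Lambda is_functor_Gamma assms unit_natural counit_natural)
  fix \<tau> :: "('o, 'u) max_excl" assume "\<tau> \<in> Obj MaxExcl"
  then have \<tau>: "is_max_excl \<tau>" by simp
  show "Lambda_arr (unit_arr pr \<tau>) \<cdot>\<^bsub>TwoSemi\<^esub> counit_arr pr (Lambda_obj \<tau>) = Ide TwoSemi (Lambda_obj \<tau>)"
    by (rule triangle_Lambda[OF assms \<tau>])
  obtain T s where \<tau>': "\<tau> = (T, s)" by (cases \<tau>)
  interpret max_excl_unit T s pr using max_excl_unitI assms \<tau> unfolding \<tau>' by blast
  show "unit_arr pr \<tau> \<in> hom MaxExcl \<tau> (Gamma_obj pr (Lambda_obj \<tau>))"
    using \<tau> is_max_excl_map_unit Q.is_max_excl_Gamma unfolding \<tau>' unit_arr.simps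
    by (intro homI) (simp_all only: MaxExcl_sel Lambda_obj.simps simp_thms)
next
  fix Y :: "('o, 'u) quad" assume "Y \<in> Obj TwoSemi"
  then have Y: "is_quad Y" by simp
  show "unit_arr pr (Gamma_obj pr Y) \<cdot>\<^bsub>MaxExcl\<^esub> Gamma_arr pr (counit_arr pr Y) = Ide MaxExcl (Gamma_obj pr Y)"
    by (rule triangle_Gamma[OF assms Y])
  obtain G H K A where Y': "Y = (G, H, K, A)" by (cases Y)
  interpret gamma G H K A pr using gammaI assms Y unfolding Y' by blast
  show "counit_arr pr Y \<in> hom TwoSemi (Lambda_obj (Gamma_obj pr Y)) Y"
    using Y is_quad_map_counit is_quad_Lambda[OF is_max_excl_Gamma] unfolding Y' counit_arr.simps
    by (intro homI) (simp_all only: TwoSemi_sel simp_thms)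
qed

lemma isomorphism_unit_arr:
  assumes "inj pr" "is_max_excl \<tau>"
  shows "isomorphism MaxExcl (unit_arr pr \<tau>)"
proof -
  obtain T s where \<tau>: "\<tau> = (T, s)" by (cases \<tau>)
  interpret max_excl_unit T s pr using max_excl_unitI assms unfolding \<tau> by blast
  show ?thesis
    using isomorphism_unit assms(2) unfolding \<tau> unit_arr.simps by blast
qed

lemma isomorphism_counit_arr:
  assumes "inj pr" "is_quad Y" "fibered_semidirect Y"
  shows "isomorphism TwoSemi (counit_arr pr Y)"
proof -
  obtain G H K A where Y: "Y = (G, H, K, A)" by (cases Y)
  interpret gamma G H K A pr using gammaI assms unfolding Y by blast
  have "counit_arr pr Y \<in> Arr TwoSemi"
    using unit_counit.counit_simps(1)[OF unit_counit_Lambda_Gamma[OF assms(1)]] assms(2) by simp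
  moreover have "bij_betw (\<lambda>x\<in>Obj G. x) (Obj M.diag) (Obj G)"
    by (simp add: bij_betw_def inj_on_def Gamma_sel)
  moreover have "bij_betw counit_sq (Arr M.diag) (Arr G)"
    using bij_betw_counit assms(3) unfolding Y by simp
  ultimately show ?thesis
    unfolding Y Gamma_obj_def counit_arr.simps Lambda_obj.simps counit_map_def
    by (intro isomorphism_TwoSemiI counit_images)
qed

theorem theorem3p1:
  fixes pr :: "'u \<times> 'u \<Rightarrow> 'u"
  assumes "inj pr"
  shows "\<exists>(\<Lambda>o :: ('o, 'u) max_excl \<Rightarrow> ('o, 'u) quad)
          (\<Lambda>a :: ('o, 'u) max_excl_arr \<Rightarrow> ('o, 'u) quad_arr)
          (\<phi> :: ('o, 'u) max_excl \<Rightarrow> ('o, 'u) quad \<Rightarrow> ('o, 'u) max_excl_arr \<Rightarrow> ('o, 'u) quad_arr).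
    adjunction MaxExcl TwoSemi \<Lambda>o \<Lambda>a (Gamma_obj pr) (Gamma_arr pr) \<phi> \<and>
    adjoint_equivalence MaxExcl (full_subcategory TwoSemi fibered_semidirect)
      \<Lambda>o \<Lambda>a (Gamma_obj pr) (Gamma_arr pr) \<phi>"
proof -
  interpret E: unit_counit "MaxExcl :: (('o, 'u) max_excl, _) cat" TwoSemi Lambda_obj Lambda_arr
    "Gamma_obj pr" "Gamma_arr pr" "unit_arr pr" "counit_arr pr"
    by (rule unit_counit_Lambda_Gamma[OF assms])
  interpret S: unit_counit "MaxExcl :: (('o, 'u) max_excl, _) cat" "full_subcategory TwoSemi fibered_semidirect"
    Lambda_obj Lambda_arr "Gamma_obj pr" "Gamma_arr pr" "unit_arr pr" "counit_arr pr"
    by (rule E.unit_counit_full_subcategory) (simp add: fibered_semidirect_Lambda)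
  \<comment> \<open>The statement asks for one family of bijections serving both claims. The two
    transposes agree as functions because composition in the full subcategory is inherited.\<close>
  have "S.transpose = E.transpose"
    by (intro ext) (simp add: S.transpose_def E.transpose_def)
  moreover have "adjoint_equivalence MaxExcl (full_subcategory TwoSemi fibered_semidirect)
      Lambda_obj Lambda_arr (Gamma_obj pr) (Gamma_arr pr) S.transpose"
    unfolding adjoint_equivalence_def
  proof (intro conjI ballI S.adjunction_transpose)
    show "isomorphism MaxExcl (adj_unit MaxExcl (full_subcategory TwoSemi fibered_semidirect)
        Lambda_obj (Gamma_obj pr) S.transpose \<tau>)" if "\<tau> \<in> Obj MaxExcl" for \<tau> :: "('o, 'u) max_excl"
      unfolding S.adj_unit_transpose[OF that] using assms that by (simp add: isomorphism_unit_arr)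
    show "isomorphism (full_subcategory TwoSemi fibered_semidirect) (adj_counit MaxExcl (Gamma_obj pr) S.transpose Y)"
      if "Y \<in> Obj (full_subcategory TwoSemi fibered_semidirect)" for Y :: "('o, 'u) quad"
      unfolding S.adj_counit_transpose[OF that] using assms that S.counit_simps[OF that]
      by (intro isomorphism_full_subcategory) (simp_all add: isomorphism_counit_arr)
  qed
  ultimately show ?thesis
    using E.adjunction_transpose by metis
qed

end
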